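(* Let $X$ be a compact connected metric space, let $T:X\to X$ be a strictly ergodic homeomorphism, let $v\in C^{0}(X,\mathbb{R})$ and let $g>0$. Put $$\underline{g}_{cr}=\inf\{L(E):E\in\mathbb{R}\},\qquad \overline{g}^{cr}=\sup\{L(E):E\in\Sigma(0)\}.$$ Then: (1) If $g\leqslant \underline{g}_{cr}$, then $\Sigma(g)=\Sigma(0)\subseteq\mathbb{R}$. (2) If $\underline{g}_{cr}<g<\overline{g}^{cr}$, then $\Sigma(g)$ contains both complex and real components, i.e. $\mathcal{E}_0\neq\emptyset$ and $\Sigma(0)\cap\mathcal{E}_+\neq\emptyset$. (3) If $g\geqslant\overline{g}^{cr}$, then $\Sigma(g)=\mathcal{E}_0$ contains only complex components, i.e. $\Sigma(g)=\mathcal{E}_0$ and $\Sigma(0)\cap\mathcal{E}_+=\emptyset$.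
   Context: $(X,T)$ is strictly ergodic if it is both minimal and uniquely ergodic; $\mu$ denotes the unique $T$-invariant Borel probability measure. For $g\ge 0$ and $x\in X$, the Hatano-Nelson operator $\mathcal{H}(g,x):\ell^2(\mathbb{Z})\to\ell^2(\mathbb{Z})$ is $$[\mathcal{H}(g,x)u]_n=-\mathrm{e}^{g}u_{n+1}-\mathrm{e}^{-g}u_{n-1}+v(T^nx)u_n,\quad n\in\mathbb{Z}.$$ Since $T$ is minimal, the spectrum of $\mathcal{H}(g,x)$ is the same set for all $x\in X$; it is denoted $\Sigma(g)\subseteq\mathbb{C}$. For $E\in\mathbb{C}$ let $$S_E(x)=\begin{pmatrix} v(x)-E&-1\\1&0\end{pmatrix},\qquad A_n(x)=S_E(T^{n-1}x)\cdots S_E(Tx)S_E(x)\quad (n\ge 1),$$ and define the Lyapunov exponent (corresponding to $g=0$) by $L(E)=\lim_{n\to\infty}\int_X\frac1n\log\|A_n(x)\|\,\mathrm{d}\mu(x)$. Set $\mathcal{E}_0=\{E\in\mathbb{C}:L(E)=g\}$ and $\mathcal{E}_+=\{E\in\mathbb{C}:L(E)>g\}$. For real-valued $v$, the set $\Sigma(0)\cap\mathcal{E}_+$ is called the real component and $\mathcal{E}_0$ the complex component of $\Sigma(g)$ (even if $\mathcal{E}_0$ intersects $\mathbb{R}$). *)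

theory Defs
  imports "HOL-Probability.Probability"
begin

section \<open>Bounded operators on the two-sided sequence space and their spectra\<close>

definition l2 :: "(int \<Rightarrow> complex) set" where
  "l2 = {u. (\<lambda>n. (cmod (u n))\<^sup>2) summable_on UNIV}"

definition l2_norm :: "(int \<Rightarrow> complex) \<Rightarrow> real" where
  "l2_norm u = sqrt (\<Sum>\<^sub>\<infinity>n. (cmod (u n))\<^sup>2)"

text \<open>Operators are total functions on all sequences; only their restriction to
  \<open>l2\<close> matters.\<close>

definition l2_bounded_operator :: "((int \<Rightarrow> complex) \<Rightarrow> (int \<Rightarrow> complex)) \<Rightarrow> bool" where
  "l2_bounded_operator A \<longleftrightarrow>
     (\<forall>u\<in>l2. A u \<in> l2) \<and>
     (\<forall>u\<in>l2. \<forall>w\<in>l2. \<forall>a b.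
        A (\<lambda>n. a * u n + b * w n) = (\<lambda>n. a * A u n + b * A w n)) \<and>
     (\<exists>C. \<forall>u\<in>l2. l2_norm (A u) \<le> C * l2_norm u)"

definition l2_spectrum :: "((int \<Rightarrow> complex) \<Rightarrow> (int \<Rightarrow> complex)) \<Rightarrow> complex set" where
  "l2_spectrum A = {E. \<not> (\<exists>R. l2_bounded_operator R \<and>
     (\<forall>u\<in>l2. R (\<lambda>n. A u n - E * u n) = u \<and>
              (\<lambda>n. A (R u) n - E * R u n) = u))}"

section \<open>Strictly ergodic dynamics\<close>

definition int_iterate :: "('a \<Rightarrow> 'a) \<Rightarrow> int \<Rightarrow> 'a \<Rightarrow> 'a" where
  "int_iterate T n = (if 0 \<le> n then T ^^ nat n else inv T ^^ nat (- n))"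

definition minimal_map :: "('a::topological_space \<Rightarrow> 'a) \<Rightarrow> bool" where
  "minimal_map T \<longleftrightarrow> (\<forall>x. closure (range (\<lambda>n. int_iterate T n x)) = UNIV)"

definition invariant_prob :: "('a::topological_space \<Rightarrow> 'a) \<Rightarrow> 'a measure \<Rightarrow> bool" where
  "invariant_prob T \<mu> \<longleftrightarrow>
     prob_space \<mu> \<and> sets \<mu> = sets borel \<and> T \<in> measurable \<mu> \<mu> \<and> distr \<mu> \<mu> T = \<mu>"

definition uniquely_ergodic :: "('a::topological_space \<Rightarrow> 'a) \<Rightarrow> bool" where
  "uniquely_ergodic T \<longleftrightarrow> (\<exists>!\<mu>. invariant_prob T \<mu>)"

definition strictly_ergodic :: "('a::topological_space \<Rightarrow> 'a) \<Rightarrow> bool" where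
  "strictly_ergodic T \<longleftrightarrow> minimal_map T \<and> uniquely_ergodic T"

section \<open>The Hatano--Nelson operator and its spectrum\<close>

definition hatano_nelson ::
  "('a \<Rightarrow> 'a) \<Rightarrow> ('a \<Rightarrow> real) \<Rightarrow> real \<Rightarrow> 'a \<Rightarrow> (int \<Rightarrow> complex) \<Rightarrow> (int \<Rightarrow> complex)" where
  "hatano_nelson T v g x u =
     (\<lambda>n. - of_real (exp g) * u (n + 1) - of_real (exp (- g)) * u (n - 1)
          + of_real (v (int_iterate T n x)) * u n)"

text \<open>The common value of the spectra over all phases \<open>x\<close>; it exists when \<open>T\<close> is a
  minimal homeomorphism of a compact space and \<open>v\<close> is continuous.\<close>

definition Sigma_HN :: "('a \<Rightarrow> 'a) \<Rightarrow> ('a \<Rightarrow> real) \<Rightarrow> real \<Rightarrow> complex set" where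
  "Sigma_HN T v g = (THE S. \<forall>x. l2_spectrum (hatano_nelson T v g x) = S)"

section \<open>The Lyapunov exponent\<close>

definition schrodinger_matrix :: "('a \<Rightarrow> real) \<Rightarrow> complex \<Rightarrow> 'a \<Rightarrow> complex ^ 2 ^ 2" where
  "schrodinger_matrix v E x = vector [vector [of_real (v x) - E, - 1], vector [1, 0]]"

primrec transfer_matrix ::
  "('a \<Rightarrow> 'a) \<Rightarrow> ('a \<Rightarrow> real) \<Rightarrow> complex \<Rightarrow> nat \<Rightarrow> 'a \<Rightarrow> complex ^ 2 ^ 2" where
  "transfer_matrix T v E 0 x = mat 1"
| "transfer_matrix T v E (Suc n) x =
     schrodinger_matrix v E ((T ^^ n) x) ** transfer_matrix T v E n x"

text \<open>The matrix norm is the operator norm with respect to the Euclidean norm, not the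
  entrywise \<open>norm\<close> of the type of matrices.\<close>

definition lyapunov ::
  "('a \<Rightarrow> 'a) \<Rightarrow> ('a \<Rightarrow> real) \<Rightarrow> 'a measure \<Rightarrow> complex \<Rightarrow> real" where
  "lyapunov T v \<mu> E =
     lim (\<lambda>n. \<integral>x. 1 / real n * ln (onorm ((*v) (transfer_matrix T v E n x))) \<partial>\<mu>)"

definition E_zero ::
  "('a \<Rightarrow> 'a) \<Rightarrow> ('a \<Rightarrow> real) \<Rightarrow> 'a measure \<Rightarrow> real \<Rightarrow> complex set" where
  "E_zero T v \<mu> g = {E. lyapunov T v \<mu> E = g}"

definition E_plus ::
  "('a \<Rightarrow> 'a) \<Rightarrow> ('a \<Rightarrow> real) \<Rightarrow> 'a measure \<Rightarrow> real \<Rightarrow> complex set" where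
  "E_plus T v \<mu> g = {E. lyapunov T v \<mu> E > g}"

definition g_cr_lower :: "('a \<Rightarrow> 'a) \<Rightarrow> ('a \<Rightarrow> real) \<Rightarrow> 'a measure \<Rightarrow> real" where
  "g_cr_lower T v \<mu> = (INF E\<in>\<real>. lyapunov T v \<mu> E)"

definition g_cr_upper :: "('a \<Rightarrow> 'a) \<Rightarrow> ('a \<Rightarrow> real) \<Rightarrow> 'a measure \<Rightarrow> real" where
  "g_cr_upper T v \<mu> = (SUP E\<in>Sigma_HN T v 0. lyapunov T v \<mu> E)"

end

theory Submission
  imports Defs "HOL-Complex_Analysis.Great_Picard"
    "HOL-Computational_Algebra.Fundamental_Theorem_Algebra"
begin

text \<open>
  Write \<open>A\<^sub>n(x)\<close> for the transfer matrices at energy \<open>E\<close> and \<open>L\<close> for the Lyapunov exponent. All three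
  parts follow from one description of the spectrum (\<open>has_green_iff\<close>): for \<open>g \<ge> 0\<close> the energy \<open>E\<close> lies
  outside \<open>\<Sigma>(g)\<close> iff either \<open>L(E) < g\<close>, or \<open>L(E) > g\<close> and \<open>E\<close> lies outside \<open>\<Sigma>(0)\<close>. In other words
  \<open>\<Sigma>(g) = {L = g} \<union> (\<Sigma>(0) \<inter> {L > g})\<close>.

  The gauge transformation \<open>u\<^sub>n = exp(- g n) w\<^sub>n\<close> turns the eigenvalue equation of \<open>H(g)\<close> into that of
  \<open>H(0)\<close>. Therefore \<open>E\<close> is outside the spectrum of \<open>H(g)\<close> iff there is a kernel \<open>W(m,n)\<close> that inverts
  \<open>H(0) - E\<close> in each variable and satisfies \<open>|W(m,n)| \<le> C exp(g (n - m) - \<kappa> |n - m|)\<close> for some \<open>\<kappa> > 0\<close>: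
  the Combes--Thomas estimate yields the decay (\<open>green_kernel_of_inverse\<close>), Schur's test the converse
  (\<open>schur_inverse\<close>). Such kernels survive limits of translates, so by minimality the spectrum does not
  depend on the phase. Kernels are related to \<open>L\<close> as follows.
  \<^item> Unique ergodicity gives \<open>\<parallel>A\<^sub>n(x)\<parallel> \<le> C exp(\<Lambda> n)\<close> uniformly in \<open>x\<close> for each \<open>\<Lambda> > L(E)\<close>. If \<open>L(E) < g\<close>,
    the solutions started at one site with zero data to the left form a kernel (\<open>has_green_below_rate\<close>).
  \<^item> If \<open>L(E) \<le> g\<close> and a kernel exists, its columns decay faster to the left than any nonzero solution
    can, so they vanish there; what remains are the solutions above, now bounded by
    \<open>exp((g - \<kappa>) n)\<close>, whence \<open>L(E) \<le> g - \<kappa>\<close> (\<open>lyapunov_less_of_green\<close>).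
  \<^item> If \<open>L(E) > g\<close> and a kernel exists, choose a phase at which some solution outgrows \<open>exp(g n)\<close>. There
    the kernel has the form \<open>S(max m n) F(min m n)\<close> with two solutions \<open>S\<close> and \<open>F\<close>
    (\<open>green_kernel_factorization\<close>). It is symmetric, so its decay to the left also holds to the right,
    and \<open>E\<close> is outside \<open>\<Sigma>(0)\<close>.
  \<^item> If \<open>E\<close> is outside \<open>\<Sigma>(0)\<close>, the same factorization shows that \<open>n \<mapsto> \<parallel>A\<^sub>n\<parallel>\<close> is supermultiplicative up
    to a constant and that the kernel is of size \<open>1/\<parallel>A\<^sub>n\<parallel>\<close>. Unique ergodicity now bounds \<open>\<parallel>A\<^sub>n\<parallel>\<close> from
    below uniformly, and the kernel decays at every rate below \<open>L(E)\<close> (\<open>green_decay_rate\<close>).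

  The dependence of \<open>L\<close> on \<open>E\<close> is read off from the entries of \<open>A\<^sub>n\<close>, which are polynomials in \<open>E\<close> with
  real zeros in a fixed interval. Comparing their linear factors at two energies shows that \<open>L\<close> strictly
  increases when one leaves the real axis vertically, is continuous along vertical lines above the axis,
  and tends to infinity (\<open>lyapunov_compare\<close> and its consequences).

  For \<open>g \<ge> sup {L(E) | E \<in> \<Sigma>(0)}\<close> the description of \<open>\<Sigma>(g)\<close> reduces to \<open>{L = g}\<close>. For intermediate \<open>g\<close>, a
  point of \<open>\<Sigma>(0)\<close> with \<open>L > g\<close> exists by the definition of the supremum, and a point with \<open>L = g\<close> by the
  intermediate value theorem above a real point with \<open>L < g\<close>. For \<open>g \<le> inf {L(E) | E real}\<close> it remains to
  see that no \<open>E\<close> outside \<open>\<Sigma>(0)\<close> has \<open>L(E) = g\<close>: such an \<open>E\<close> would be a minimum of \<open>L\<close> in a spectral gap.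
  There \<open>W\<close> is holomorphic in the energy; a maximum principle on a small circle, where \<open>L \<ge> g\<close> everywhere
  and \<open>L \<ge> g + c\<close> on two arcs, makes \<open>W\<close> decay at \<open>E\<close> faster than the rate \<open>L(E) = g\<close> allows
  (\<open>lyapunov_no_real_minimum\<close>). Holomorphy and Liouville's theorem also show that \<open>\<Sigma>(0)\<close> is nonempty.
\<close>

section \<open>Measures from finitely additive contents\<close>

text \<open>
  Supplies the finite decomposition of a compact set that makes the open-set content countably
  subadditive.
\<close>

lemma closed_shrinking_of_open_cover:
  fixes U :: "nat \<Rightarrow> 'a::metric_space set"
  assumes "compact K" and "\<And>i. open (U i)" and "K \<subseteq> (\<Union>i. U i)"
  obtains n C where "\<And>i. closed (C i)" and "\<And>i. C i \<subseteq> U i" and "K \<subseteq> (\<Union>i<(n::nat). C i)"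
proof -
  have "\<forall>x\<in>K. \<exists>i e. 0 < e \<and> cball x e \<subseteq> U i"
    using assms(2,3) by (metis UN_E open_contains_cball subset_iff)
  then obtain i e where ie: "\<And>x. x \<in> K \<Longrightarrow> 0 < e x \<and> cball x (e x) \<subseteq> U (i x)"
    by metis
  have "K \<subseteq> (\<Union>x\<in>K. ball x (e x))"
    using ie by auto
  then obtain D where D: "D \<subseteq> K" "finite D" "K \<subseteq> (\<Union>x\<in>D. ball x (e x))"
    using compactE_image[OF assms(1), of K "\<lambda>x. ball x (e x)"] by (metis open_ball)
  define C where "C j = (\<Union>x\<in>{x\<in>D. i x = j}. cball x (e x))" for j
  show thesis
  proof (rule that[of C "Suc (Max (insert 0 (i ` D)))"])
    show "closed (C j)" for j
      unfolding C_def using D(2) by (intro closed_UN) auto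
    show "C j \<subseteq> U j" for j
      unfolding C_def using ie D(1) by blast
    show "K \<subseteq> (\<Union>j<Suc (Max (insert 0 (i ` D))). C j)"
    proof
      fix y assume "y \<in> K"
      then obtain x where x: "x \<in> D" "y \<in> ball x (e x)" using D(3) by blast
      then have "y \<in> C (i x)" unfolding C_def by auto
      moreover have "i x < Suc (Max (insert 0 (i ` D)))"
        using x(1) D(2) by (simp add: less_Suc_eq_le)
      ultimately show "y \<in> (\<Union>j<Suc (Max (insert 0 (i ` D))). C j)" by blast
    qed
  qed
qed

text \<open>
  The inner content of an open set, and the outer measure generated by it: the two steps of the
  construction of a regular measure, starting from a merely finitely additive \<open>m\<close>.
\<close>

definition content_open :: "('a::topological_space set \<Rightarrow> real) \<Rightarrow> 'a set \<Rightarrow> ennreal" where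
  "content_open m U = (SUP K\<in>{K. closed K \<and> K \<subseteq> U}. ennreal (m K))"

definition content_outer :: "('a::topological_space set \<Rightarrow> real) \<Rightarrow> 'a set \<Rightarrow> ennreal" where
  "content_outer m A = (INF U\<in>{U. open U \<and> A \<subseteq> U}. content_open m U)"

text \<open>
  A finitely additive probability on all subsets of a compact metric space induces a Borel
  probability. The value on an open set \<open>U\<close> is the supremum of \<open>m\<close> over closed subsets of \<open>U\<close>; on opens
  this is countably subadditive by compactness. Open sets are Caratheodory measurable because \<open>m\<close> is
  additive on a closed subset of \<open>V \<inter> U\<close> and a disjoint closed subset of the rest of \<open>V\<close>.
\<close>

lemma measure_of_content:
  fixes m :: "'a::metric_space set \<Rightarrow> real"
  assumes cpt: "compact (UNIV :: 'a set)"
    and nonneg: "\<And>A. 0 \<le> m A"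
    and add: "\<And>A B. A \<inter> B = {} \<Longrightarrow> m (A \<union> B) = m A + m B"
    and one: "m UNIV = 1"
  obtains \<nu> where "prob_space \<nu>" and "sets \<nu> = sets borel"
    and "\<And>A. A \<in> sets borel \<Longrightarrow> emeasure \<nu> A = content_outer m A"
proof -
  have m0: "m {} = 0" using add[of "{}" "{}"] by simp
  have mono: "m A \<le> m B" if "A \<subseteq> B" for A B
    using add[of A "B - A"] nonneg[of "B - A"] that by (simp add: Un_absorb1)
  have sub: "m (A \<union> B) \<le> m A + m B" for A B
    using add[of A "B - A"] mono[of "B - A" B] by simp
  have subsum: "m (\<Union>i<(n::nat). C i) \<le> (\<Sum>i<n. m (C i))" for n C
  proof (induction n)
    case (Suc n)
    have "m (\<Union>i<Suc n. C i) \<le> m (\<Union>i<n. C i) + m (C n)"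
      using sub[of "\<Union>i<n. C i" "C n"] by (simp add: lessThan_Suc Un_commute)
    with Suc show ?case by simp
  qed (simp add: m0)
  have oI: "ennreal (m K) \<le> content_open m U" if "closed K" "K \<subseteq> U" for K U
    unfolding content_open_def using that by (intro SUP_upper) auto
  have omono: "content_open m U \<le> content_open m V" if "U \<subseteq> V" for U V
    unfolding content_open_def using that by (intro SUP_subset_mono) auto
  have omsub: "content_open m (\<Union>i. U i) \<le> (\<Sum>i. content_open m (U i))"
    if op: "\<And>i. open (U i)" for U :: "nat \<Rightarrow> 'a set"
    unfolding content_open_def[of m "\<Union>i. U i"]
  proof (rule SUP_least)
    fix K assume "K \<in> {K. closed K \<and> K \<subseteq> (\<Union>i. U i)}"
    then have K: "closed K" "K \<subseteq> (\<Union>i. U i)" by auto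
    have "compact K" using cpt K(1) compact_Int_closed by force
    then obtain n C where C: "\<And>i. closed (C i)" "\<And>i. C i \<subseteq> U i" "K \<subseteq> (\<Union>i<(n::nat). C i)"
      using closed_shrinking_of_open_cover op K(2) by metis
    have "ennreal (m K) \<le> ennreal (\<Sum>i<n. m (C i))"
      using mono[OF C(3)] subsum[of C n] by (intro ennreal_leI) linarith
    also have "\<dots> = (\<Sum>i<n. ennreal (m (C i)))"
      using nonneg by (simp add: sum_ennreal)
    also have "\<dots> \<le> (\<Sum>i<n. content_open m (U i))"
      using C by (intro sum_mono oI) auto
    also have "\<dots> \<le> (\<Sum>i. content_open m (U i))"
      by (intro sum_le_suminf) auto
    finally show "ennreal (m K) \<le> (\<Sum>i. content_open m (U i))" .
  qed
  have outer_le: "content_outer m A \<le> content_open m U" if "open U" "A \<subseteq> U" for A U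
    unfolding content_outer_def using that by (intro INF_lower) auto
  have outer_open: "content_outer m U = content_open m U" if "open U" for U
  proof (rule antisym[OF outer_le[OF that order_refl]])
    show "content_open m U \<le> content_outer m U"
      unfolding content_outer_def using omono by (intro INF_greatest) auto
  qed
  have o0: "content_open m {} = 0"
    unfolding content_open_def using m0 by (simp add: SUP_eq_const)
  have pos: "positive UNIV (content_outer m)"
    using outer_open[of "{}"] o0 by (simp add: positive_def)
  have outer_mono: "content_outer m A \<le> content_outer m B" if "A \<subseteq> B" for A B
    unfolding content_outer_def using that by (intro INF_superset_mono) auto
  have le1: "content_outer m A \<le> 1" for A
  proof -
    have "content_outer m A \<le> content_open m UNIV" by (rule outer_le) auto
    also have "\<dots> \<le> 1"
      unfolding content_open_def using mono[of _ UNIV] one by (intro SUP_least) simp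
    finally show ?thesis .
  qed
  have csub: "content_outer m (\<Union>i. A i) \<le> (\<Sum>i. content_outer m (A i))"
    for A :: "nat \<Rightarrow> 'a set"
  proof (rule ennreal_le_epsilon)
    fix e :: real assume e: "0 < e"
    have "\<exists>U. open U \<and> A i \<subseteq> U \<and> content_open m U \<le> content_outer m (A i) + e * (1/2)^Suc i" for i
    proof -
      have "content_outer m (A i) < content_outer m (A i) + ennreal (e * (1/2)^Suc i)"
        using le1[of "A i"] e by (metis ennreal_add_left_cancel_less ennreal_less_zero_iff add.right_neutral
            infinity_ennreal_def ennreal_one_neq_top mult_pos_pos top.not_eq_extremum order_le_less_trans
            zero_less_divide_1_iff zero_less_numeral zero_less_power)
      then obtain U where "open U" "A i \<subseteq> U"
        "content_open m U < content_outer m (A i) + ennreal (e * (1/2)^Suc i)"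
        unfolding content_outer_def[of m "A i"] INF_less_iff by auto
      then show ?thesis by (auto intro: less_imp_le)
    qed
    then obtain U where U: "\<And>i. open (U i)" "\<And>i. A i \<subseteq> U i"
      "\<And>i. content_open m (U i) \<le> content_outer m (A i) + e * (1/2)^Suc i" by metis
    have "content_outer m (\<Union>i. A i) \<le> content_open m (\<Union>i. U i)"
      using U by (intro outer_le) auto
    also have "\<dots> \<le> (\<Sum>i. content_open m (U i))" using U by (intro omsub)
    also have "\<dots> \<le> (\<Sum>i. content_outer m (A i) + e * (1/2)^Suc i)"
      using U by (intro suminf_le) auto
    also have "... = (\<Sum>n. content_outer m (A n)) + (\<Sum>n. ennreal e * ennreal ((1/2) ^ Suc n))"
      using e by (subst suminf_add[symmetric])
                       (auto simp del: ennreal_suminf_cmult simp add: ennreal_mult[symmetric])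
    also have "\<dots> = (\<Sum>n. content_outer m (A n)) + e"
      unfolding ennreal_suminf_cmult
      by (subst suminf_ennreal_eq[OF zero_le_power power_half_series]) auto
    finally show "content_outer m (\<Union>i. A i) \<le> (\<Sum>i. content_outer m (A i)) + ennreal e" .
  qed
  have oms: "outer_measure_space (Pow UNIV) (content_outer m)"
    unfolding outer_measure_space_def
    using pos outer_mono csub by (auto simp: increasing_def countably_subadditive_def positive_def)
  interpret Pow: sigma_algebra UNIV "Pow (UNIV :: 'a set)"
    by (rule sigma_algebra_Pow)
  define L where "L = lambda_system UNIV (Pow UNIV) (content_outer m)"
  have ms: "measure_space UNIV L (content_outer m)"
    unfolding L_def by (rule Pow.caratheodory_lemma[OF oms])
  have split_open: "content_outer m (V \<inter> U) + content_outer m (V - U) \<le> content_outer m V"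
    if U: "open U" and V: "open V" for U V
  proof -
    have "content_open m (V \<inter> U) + content_outer m (V - U) \<le> content_open m V"
      unfolding content_open_def[of m "V \<inter> U"]
    proof (subst ennreal_SUP_add_left[symmetric])
      show "{K. closed K \<and> K \<subseteq> V \<inter> U} \<noteq> {}" by blast
      show "(SUP K\<in>{K. closed K \<and> K \<subseteq> V \<inter> U}. ennreal (m K) + content_outer m (V - U)) \<le> content_open m V"
      proof (rule SUP_least)
        fix K1 assume "K1 \<in> {K. closed K \<and> K \<subseteq> V \<inter> U}"
        then have K1: "closed K1" "K1 \<subseteq> V \<inter> U" by auto
        have "content_outer m (V - U) \<le> content_open m (V - K1)"
          using K1 V by (intro outer_le) (auto intro: open_Diff)
        then have "ennreal (m K1) + content_outer m (V - U) \<le> ennreal (m K1) + content_open m (V - K1)"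
          by (rule add_left_mono)
        also have "\<dots> = (SUP K\<in>{K. closed K \<and> K \<subseteq> V - K1}. ennreal (m K1) + ennreal (m K))"
          unfolding content_open_def by (subst ennreal_SUP_add_right) auto
        also have "\<dots> \<le> content_open m V"
        proof (rule SUP_least)
          fix K2 assume "K2 \<in> {K. closed K \<and> K \<subseteq> V - K1}"
          then have K2: "closed K2" "K2 \<subseteq> V - K1" by auto
          then have K12: "K1 \<inter> K2 = {}" by auto
          have "ennreal (m K1) + ennreal (m K2) = ennreal (m (K1 \<union> K2))"
            using add[OF K12] nonneg by (simp flip: ennreal_plus)
          also have "\<dots> \<le> content_open m V" using K1 K2 by (intro oI) auto
          finally show "ennreal (m K1) + ennreal (m K2) \<le> content_open m V" .
        qed
        finally show "ennreal (m K1) + content_outer m (V - U) \<le> content_open m V" .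
      qed
    qed
    then show ?thesis using outer_open U V by (simp add: open_Int)
  qed
  have open_L: "U \<in> L" if U: "open U" for U
  proof -
    have "content_outer m (A \<inter> U) + content_outer m (A - U) = content_outer m A" for A
    proof (rule antisym)
      show "content_outer m (A \<inter> U) + content_outer m (A - U) \<le> content_outer m A"
        unfolding content_outer_def[of m A]
      proof (rule INF_greatest)
        fix V assume "V \<in> {V. open V \<and> A \<subseteq> V}"
        then have V: "open V" "A \<subseteq> V" by auto
        have "content_outer m (A \<inter> U) + content_outer m (A - U)
            \<le> content_outer m (V \<inter> U) + content_outer m (V - U)"
          using V by (intro add_mono outer_mono) auto
        also have "\<dots> \<le> content_outer m V" by (rule split_open[OF U V(1)])
        finally show "content_outer m (A \<inter> U) + content_outer m (A - U) \<le> content_open m V"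
          using outer_open[OF V(1)] by simp
      qed
    next
      define B where "B i = (if i = 0 then A \<inter> U else if i = 1 then A - U else {})" for i :: nat
      have "content_outer m A = content_outer m (\<Union>i. B i)"
        by (rule arg_cong[where f="content_outer m"]) (auto simp: B_def split: if_splits)
      also have "\<dots> \<le> (\<Sum>i. content_outer m (B i))" by (rule csub)
      also have "\<dots> = (\<Sum>i\<in>{0,1}. content_outer m (B i))"
        using pos by (intro suminf_finite) (auto simp: B_def positive_def)
      also have "\<dots> = content_outer m (A \<inter> U) + content_outer m (A - U)"
        by (simp add: B_def)
      finally show "content_outer m A \<le> content_outer m (A \<inter> U) + content_outer m (A - U)" .
    qed
    then show ?thesis unfolding L_def Pow.lambda_system_eq by (auto simp: Int_commute)
  qed
  have sL: "sigma_algebra UNIV L" using ms by (simp add: measure_space_def)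
  have bL: "sets borel \<subseteq> L"
    unfolding borel_def using open_L sL
    by (simp add: sigma_algebra.sigma_sets_subset image_subset_iff subset_eq[of "Collect open"])
  have sb: "sigma_algebra UNIV (sets (borel :: 'a measure))"
    using sets.sigma_algebra_axioms[of "borel :: 'a measure"] by simp
  have "countably_additive (sets borel) (content_outer m)"
    unfolding countably_additive_def
  proof (intro allI impI)
    fix A :: "nat \<Rightarrow> 'a set"
    assume A: "range A \<subseteq> sets borel" "disjoint_family A" "\<Union> (range A) \<in> sets borel"
    have "countably_additive L (content_outer m)" using ms by (simp add: measure_space_def)
    moreover have "range A \<subseteq> L" "\<Union> (range A) \<in> L" using A bL by auto
    ultimately show "(\<Sum>i. content_outer m (A i)) = content_outer m (\<Union> (range A))"
      using A(2) by (simp add: countably_additive_def)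
  qed
  then have ms2: "measure_space UNIV (sets borel) (content_outer m)"
    using sb pos by (simp add: measure_space_def positive_def)
  define \<nu> where "\<nu> = measure_of UNIV (sets borel) (content_outer m)"
  have sets_\<nu>: "sets \<nu> = sets borel"
    unfolding \<nu>_def by (simp add: sets_measure_of_conv) (metis sets.sigma_sets_eq space_borel)
  have em: "emeasure \<nu> A = content_outer m A" if "A \<in> sets borel" for A
    unfolding \<nu>_def
    using ms2 that by (intro emeasure_measure_of_sigma) (auto simp: measure_space_def)
  have "space \<nu> = UNIV" using sets_eq_imp_space_eq[OF sets_\<nu>] by simp
  moreover have "emeasure \<nu> UNIV = 1"
  proof -
    have "1 \<le> content_open m UNIV" using oI[of UNIV UNIV] one by simp
    then show ?thesis using em[of UNIV] le1[of UNIV] outer_open[of UNIV] by auto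
  qed
  ultimately have "prob_space \<nu>" by (intro prob_spaceI) simp
  then show thesis using that sets_\<nu> em by blast
qed

text \<open>
  Tychonoff's theorem for \<open>[0,1]\<^bsup>'b\<^esup>\<close>, phrased with a filter \<open>G\<close> finer than
  \<open>sequentially\<close>: along \<open>G\<close> all coordinates converge at once, although the index set is uncountable and
  no subsequence with this property need exist.
\<close>

lemma cluster_point_of_bounded_functionals:
  fixes F :: "nat \<Rightarrow> 'b \<Rightarrow> real"
  assumes "\<And>n b. 0 \<le> F n b" and "\<And>n b. F n b \<le> 1"
  obtains G m where "G \<noteq> bot" and "G \<le> sequentially" and "\<And>b. ((\<lambda>n. F n b) \<longlongrightarrow> m b) G"
proof -
  let ?K = "PiE UNIV (\<lambda>_. {0..1}) :: ('b \<Rightarrow> real) set"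
  have "compactin (product_topology (\<lambda>_. euclidean) UNIV) ?K"
    unfolding compactin_PiE by simp
  then have K: "compact ?K"
    by (simp add: euclidean_product_topology)
  let ?H = "filtermap F sequentially"
  have "?H \<noteq> bot" by (simp add: filtermap_bot_iff)
  moreover have "eventually (\<lambda>f. f \<in> ?K) ?H"
    using assms by (simp add: eventually_filtermap PiE_iff)
  ultimately obtain m where m: "inf (nhds m) ?H \<noteq> bot"
    using K unfolding compact_filter by blast
  define G where "G = inf sequentially (filtercomap F (nhds m))"
  show thesis
  proof (rule that)
    show "G \<noteq> bot"
    proof
      assume "G = bot"
      then have "eventually (\<lambda>_. False) G" by simp
      then obtain P Q where P: "eventually P sequentially" and Q: "eventually Q (filtercomap F (nhds m))"
        and PQ: "\<And>n. P n \<and> Q n \<longrightarrow> False"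
        unfolding G_def eventually_inf by auto
      from Q obtain R where R: "eventually R (nhds m)" "\<And>n. R (F n) \<Longrightarrow> Q n"
        unfolding eventually_filtercomap by auto
      have "eventually (\<lambda>f. \<not> R f) ?H"
        unfolding eventually_filtermap using P PQ R(2) by (auto elim!: eventually_mono)
      then have "eventually (\<lambda>_. False) (inf (nhds m) ?H)"
        unfolding eventually_inf using R(1) by blast
      then show False using m by (simp add: eventually_False)
    qed
    show "G \<le> sequentially" by (simp add: G_def)
    have lim: "filterlim F (nhds m) G"
      unfolding G_def by (rule filterlim_mono[OF filterlim_filtercomap order_refl inf.cobounded2])
    fix b
    show "((\<lambda>n. F n b) \<longlongrightarrow> m b) G"
      by (rule continuous_on_tendsto_compose[OF continuous_on_product_coordinates lim]) auto
  qed
qed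

text \<open>
  Layer-cake approximation: counting the levels \<open>k/N\<close> below \<open>t\<close> recovers \<open>t\<close> up to \<open>1/N\<close>. It replaces
  integration of a continuous function by the measures of its closed superlevel sets.
\<close>

lemma sum_layers_bounds:
  fixes t :: real and N :: nat
  assumes "0 \<le> t" "t < 1" "0 < N"
  shows "N * t \<le> (\<Sum>k<N. of_bool (real k / N \<le> t))"
    and "(\<Sum>k<N. of_bool (real k / N \<le> t)) \<le> N * t + 1"
proof -
  let ?q = "nat \<lfloor>N * t\<rfloor>"
  have "N * t < N" using assms by simp
  have "{k\<in>{..<N}. real k / N \<le> t} = {..?q}"
  proof (intro set_eqI iffI)
    fix k assume "k \<in> {k\<in>{..<N}. real k / N \<le> t}"
    then have "real k \<le> N * t" using assms by (simp add: field_simps)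
    then show "k \<in> {..?q}" by (simp add: le_nat_floor)
  next
    fix k assume "k \<in> {..?q}"
    then have "real k \<le> real ?q" by simp
    also have "\<dots> \<le> N * t" using assms by simp
    finally have "real k \<le> N * t" .
    moreover have "real k < N" using \<open>real k \<le> N * t\<close> \<open>N * t < N\<close> by linarith
    ultimately show "k \<in> {k\<in>{..<N}. real k / N \<le> t}" using assms by (simp add: field_simps)
  qed
  then have eq: "(\<Sum>k<N. of_bool (real k / N \<le> t)) = real ?q + 1"
    by (simp add: sum_of_bool_eq Int_def flip: Collect_conj_eq)
  have "real ?q \<le> N * t" "N * t \<le> real ?q + 1"
    using assms by (simp, linarith)
  with eq show "N * t \<le> (\<Sum>k<N. of_bool (real k / N \<le> t))"
    and "(\<Sum>k<N. of_bool (real k / N \<le> t)) \<le> N * t + 1" by auto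
qed

text \<open>
  One inequality suffices: a probability that does not increase under preimages is invariant, by
  passing to complements.
\<close>

lemma content_outer_vimage_le:
  assumes T: "homeomorphism UNIV UNIV T (inv T)"
    and inv: "\<And>A. m (T -` A) = m A"
  shows "content_outer m (T -` A) \<le> content_outer m A"
  unfolding content_outer_def[of m A]
proof (rule INF_greatest)
  fix U assume "U \<in> {U. open U \<and> A \<subseteq> U}"
  then have U: "open U" "A \<subseteq> U" by auto
  have cT: "continuous_on UNIV T" and cI: "continuous_on UNIV (inv T)"
    and TI: "\<And>x. T (inv T x) = x" and IT: "\<And>x. inv T (T x) = x"
    using T by (auto simp: homeomorphism_def)
  have "content_outer m (T -` A) \<le> content_open m (T -` U)"
    unfolding content_outer_def using U open_vimage[OF U(1) cT] by (intro INF_lower) auto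
  also have "\<dots> \<le> content_open m U"
    unfolding content_open_def
  proof (rule SUP_least)
    fix K assume "K \<in> {K. closed K \<and> K \<subseteq> T -` U}"
    then have K: "closed K" "K \<subseteq> T -` U" by auto
    have "closed (inv T -` K)" by (rule closed_vimage[OF K(1) cI])
    moreover have "inv T -` K \<subseteq> U" using K(2) TI by (metis subset_iff vimage_eq)
    moreover have "T -` (inv T -` K) = K" using IT by auto
    then have "m (inv T -` K) = m K" using inv[of "inv T -` K"] by simp
    ultimately show "ennreal (m K) \<le> (SUP K\<in>{K. closed K \<and> K \<subseteq> U}. ennreal (m K))"
      by (intro SUP_upper2[of "inv T -` K"]) auto
  qed
  finally show "content_outer m (T -` A) \<le> content_open m U" .
qed

text \<open>
  The bound on closed sets is the half of weak convergence that is used later: mass of \<open>m\<close> on a closed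
  set cannot be lost in the outer measure.
\<close>

lemma invariant_prob_of_content:
  fixes m :: "'a::metric_space set \<Rightarrow> real"
  assumes cpt: "compact (UNIV :: 'a set)"
    and T: "homeomorphism UNIV UNIV T (inv T)"
    and "\<And>A. 0 \<le> m A"
    and "\<And>A B. A \<inter> B = {} \<Longrightarrow> m (A \<union> B) = m A + m B"
    and "m UNIV = 1"
    and inv: "\<And>A. m (T -` A) = m A"
  obtains \<nu> where "invariant_prob T \<nu>" and "\<And>K. closed K \<Longrightarrow> m K \<le> measure \<nu> K"
proof -
  obtain \<nu> where \<nu>: "prob_space \<nu>" "sets \<nu> = sets borel"
    "\<And>A. A \<in> sets borel \<Longrightarrow> emeasure \<nu> A = content_outer m A"
    using measure_of_content[OF cpt assms(3-5)] by blast
  interpret prob_space \<nu> by fact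
  have sp: "space \<nu> = UNIV" using sets_eq_imp_space_eq[OF \<nu>(2)] by simp
  have cT: "continuous_on UNIV T" using T by (simp add: homeomorphism_def)
  have mT: "T \<in> measurable \<nu> \<nu>"
    using borel_measurable_continuous_onI[OF cT] measurable_cong_sets[OF \<nu>(2) \<nu>(2)] by simp
  have vim: "T -` A \<in> sets borel" if "A \<in> sets borel" for A
    using measurable_sets[OF mT, of A] that \<nu>(2) sp by simp
  have le: "measure \<nu> (T -` A) \<le> measure \<nu> A" if A: "A \<in> sets borel" for A
  proof -
    have "emeasure \<nu> (T -` A) \<le> emeasure \<nu> A"
      using A vim[OF A] \<nu>(3) content_outer_vimage_le[OF T, of m A] inv by simp
    then show ?thesis by (simp add: emeasure_eq_measure)
  qed
  have eq: "measure \<nu> (T -` A) = measure \<nu> A" if A: "A \<in> sets borel" for A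
  proof -
    have "measure \<nu> (T -` (- A)) \<le> measure \<nu> (- A)" using A by (intro le) auto
    moreover have "measure \<nu> (- A) = 1 - measure \<nu> A"
      using prob_compl[of A] A \<nu>(2) sp by (simp add: Compl_eq_Diff_UNIV)
    moreover have "measure \<nu> (- (T -` A)) = 1 - measure \<nu> (T -` A)"
      using prob_compl[of "T -` A"] vim[OF A] \<nu>(2) sp by (simp add: Compl_eq_Diff_UNIV)
    ultimately show ?thesis using le[OF A] by (simp add: vimage_Compl)
  qed
  have "distr \<nu> \<nu> T = \<nu>"
  proof (rule measure_eqI)
    fix A assume "A \<in> sets (distr \<nu> \<nu> T)"
    then show "emeasure (distr \<nu> \<nu> T) A = emeasure \<nu> A"
      using mT eq[of A] \<nu>(2) sp by (simp add: emeasure_distr emeasure_eq_measure)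
  qed simp
  then have "invariant_prob T \<nu>"
    using \<nu> mT by (simp add: invariant_prob_def)
  moreover have "m K \<le> measure \<nu> K" if K: "closed K" for K
  proof -
    have "ennreal (m K) \<le> content_outer m K"
      unfolding content_outer_def content_open_def using K
      by (intro INF_greatest SUP_upper) auto
    also have "\<dots> = emeasure \<nu> K" using \<nu>(3) K by simp
    finally show ?thesis by (simp add: emeasure_eq_measure)
  qed
  ultimately show thesis using that by blast
qed

section \<open>Unique ergodicity and uniform bounds for cocycles\<close>

definition birkhoff_sum :: "('a \<Rightarrow> 'a) \<Rightarrow> ('a \<Rightarrow> real) \<Rightarrow> nat \<Rightarrow> 'a \<Rightarrow> real" where
  "birkhoff_sum T f n x = (\<Sum>j<n. f ((T ^^ j) x))"

lemma continuous_real_bounded_on_compact_space: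
  fixes f :: "'a::topological_space \<Rightarrow> real"
  assumes "compact (UNIV :: 'a set)" "continuous_on UNIV f"
  obtains B where "\<And>x. \<bar>f x\<bar> \<le> B" "0 < B"
proof -
  have "bounded (range f)"
    using assms compact_continuous_image compact_imp_bounded by blast
  then obtain B where "0 < B" "\<forall>y\<in>range f. norm y \<le> B" unfolding bounded_pos by auto
  then show thesis using that[of B] by auto
qed

text \<open>
  If the bound failed for arbitrarily long orbit segments, the visit frequencies along them would
  accumulate at an invariant finitely additive probability \<open>m\<close>. The Borel measure that it induces is
  invariant, hence equal to \<open>\<mu>\<close>, and the superlevel sets of \<open>f\<close> show that its integral of \<open>f\<close> is at least
  \<open>\<Lambda>\<close>.
\<close>

lemma uniform_birkhoff_upper:
  fixes T :: "'a::metric_space \<Rightarrow> 'a" and f :: "'a \<Rightarrow> real"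
  assumes cpt: "compact (UNIV :: 'a set)"
    and T: "homeomorphism UNIV UNIV T (inv T)"
    and ue: "uniquely_ergodic T" and \<mu>: "invariant_prob T \<mu>"
    and f: "continuous_on UNIV f" and less: "(\<integral>x. f x \<partial>\<mu>) < \<Lambda>"
  shows "\<exists>n0. \<forall>n\<ge>n0. \<forall>x. birkhoff_sum T f n x \<le> \<Lambda> * real n"
proof (rule ccontr)
  assume "\<not> ?thesis"
  then have "\<forall>k. \<exists>n x. Suc k \<le> n \<and> \<Lambda> * real n < birkhoff_sum T f n x"
    by (meson not_le)
  then obtain n x where n: "\<And>k. Suc k \<le> n k" and big: "\<And>k. \<Lambda> * real (n k) < birkhoff_sum T f (n k) (x k)"
    by metis
  have npos: "0 < n k" for k using n[of k] by linarith
  define F where "F k A = (\<Sum>j<n k. indicator A ((T ^^ j) (x k))) / real (n k)" for k and A :: "'a set"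
  have F0: "0 \<le> F k A" for k A unfolding F_def by (intro divide_nonneg_nonneg sum_nonneg) auto
  have F1: "F k A \<le> 1" for k A
  proof -
    have "(\<Sum>j<n k. indicator A ((T ^^ j) (x k))) \<le> (\<Sum>j<n k. (1::real))"
      by (intro sum_mono) (auto simp: indicator_def)
    then show ?thesis unfolding F_def using npos[of k] by simp
  qed
  (* G refines sequentially, so error terms that vanish as k grows also vanish along G. *)
  obtain G m where G: "G \<noteq> bot" "G \<le> sequentially" and lim: "\<And>A. ((\<lambda>k. F k A) \<longlongrightarrow> m A) G"
    using cluster_point_of_bounded_functionals[of F] F0 F1 by blast
  have m_nonneg: "0 \<le> m A" for A
    using tendsto_lowerbound[OF lim _ G(1), of 0 A] F0 by simp
  have m_add: "m (A \<union> B) = m A + m B" if "A \<inter> B = {}" for A B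
  proof -
    have "F k (A \<union> B) = F k A + F k B" for k
      using that unfolding F_def
      by (simp add: indicator_add[symmetric] sum.distrib add_divide_distrib)
    then show ?thesis using lim[of "A \<union> B"] tendsto_add[OF lim[of A] lim[of B]] tendsto_unique[OF G(1)]
      by simp
  qed
  have m_one: "m UNIV = 1"
  proof -
    have "F k UNIV = 1" for k unfolding F_def using npos[of k] by simp
    then have "((\<lambda>k. F k UNIV) \<longlongrightarrow> 1) G" by simp
    then show ?thesis by (rule tendsto_unique[OF G(1) lim])
  qed
  have m_inv: "m (T -` A) = m A" for A
  proof -
    have bd: "norm (F k (T -` A) - F k A) \<le> inverse (real (Suc k))" for k
    proof -
      have "(\<Sum>j<n k. indicator (T -` A) ((T ^^ j) (x k))) = (\<Sum>j<n k. indicator A ((T ^^ Suc j) (x k)) :: real)"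
        by (intro sum.cong) (auto simp: indicator_def)
      also have "\<dots> - (\<Sum>j<n k. indicator A ((T ^^ j) (x k)))
          = indicator A ((T ^^ n k) (x k)) - indicator A ((T ^^ 0) (x k))"
        using sum_lessThan_telescope[of "\<lambda>j. indicat_real A ((T ^^ j) (x k))" "n k"]
        by (simp only: sum_subtractf)
      finally have "F k (T -` A) - F k A
          = (indicator A ((T ^^ n k) (x k)) - indicator A ((T ^^ 0) (x k))) / real (n k)"
        unfolding F_def by (simp add: diff_divide_distrib[symmetric])
      moreover have "\<bar>indicator A ((T ^^ n k) (x k)) - indicator A ((T ^^ 0) (x k)) :: real\<bar> \<le> 1"
        by (auto simp: indicator_def)
      ultimately have "norm (F k (T -` A) - F k A) \<le> 1 / real (n k)"
        using npos[of k] by (simp add: divide_le_cancel del: funpow.simps)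
      also have "\<dots> \<le> inverse (real (Suc k))"
        using n[of k] by (simp add: field_simps del: of_nat_Suc)
      finally show ?thesis .
    qed
    have "(\<lambda>k. F k (T -` A) - F k A) \<longlonglongrightarrow> 0"
      by (rule Lim_null_comparison[OF _ LIMSEQ_inverse_real_of_nat]) (rule always_eventually, intro allI, rule bd)
    then have "((\<lambda>k. F k (T -` A) - F k A) \<longlongrightarrow> 0) G"
      using G(2) by (rule tendsto_mono[rotated])
    then have "m (T -` A) - m A = 0"
      using tendsto_diff[OF lim lim] tendsto_unique[OF G(1)] by blast
    then show ?thesis by simp
  qed
  obtain \<nu> where \<nu>: "invariant_prob T \<nu>" "\<And>K. closed K \<Longrightarrow> m K \<le> measure \<nu> K"
    using invariant_prob_of_content[OF cpt T m_nonneg m_add m_one m_inv] by blast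
  have "\<nu> = \<mu>" using ue \<mu> \<nu>(1) unfolding uniquely_ergodic_def by blast
  with \<nu> have mK: "\<And>K. closed K \<Longrightarrow> m K \<le> measure \<mu> K" by simp
  interpret prob_space \<mu> using \<mu> by (simp add: invariant_prob_def)
  have sb: "sets \<mu> = sets borel" using \<mu> by (simp add: invariant_prob_def)
  have sp: "space \<mu> = UNIV" using sets_eq_imp_space_eq[OF sb] by simp
  obtain B where B: "\<And>x. \<bar>f x\<bar> \<le> B" "0 < B"
    using continuous_real_bounded_on_compact_space[OF cpt f] by blast
  (* Replace f by the affine image h with values in [0,1), to which the layer-cake bounds apply. *)
  define c where "c = 2 * B + 1"
  have c: "0 < c" using B(2) by (simp add: c_def)
  define h where "h y = (f y + B) / c" for y
  have h: "0 \<le> h y" "h y < 1" for y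
    unfolding h_def c_def using B(1)[of y] B(2) by (simp_all add: field_simps abs_le_iff)
  have hc: "continuous_on UNIV h"
    unfolding h_def by (intro continuous_intros f) (use c in simp)
  have fm: "f \<in> borel_measurable \<mu>"
    by (subst measurable_cong_sets[OF sb refl]) (rule borel_measurable_continuous_onI[OF f])
  have fint: "integrable \<mu> f"
    by (rule integrable_const_bound[of _ B]) (use B fm in auto)
  have hint: "integrable \<mu> h" unfolding h_def using fint by simp
  have inth: "(\<integral>x. h x \<partial>\<mu>) = ((\<integral>x. f x \<partial>\<mu>) + B) / c"
    unfolding h_def using fint by (simp add: prob_space)
  have key: "(\<Lambda> + B) / c \<le> (\<integral>x. h x \<partial>\<mu>) + 1 / real N" if N: "0 < N" for N :: nat
  proof -
    (* The closed superlevel sets: m of a closed set is at most its measure. *)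
    define K where "K i = {y. real i / N \<le> h y}" for i
    have Kc: "closed (K i)" for i
      unfolding K_def by (intro closed_Collect_le hc continuous_on_const)
    have "(\<Lambda> + B) / c \<le> (1 / N) * (\<Sum>i<N. F k (K i))" for k
    proof -
      have "(\<Lambda> + B) / c * n k \<le> (birkhoff_sum T f (n k) (x k) + B * n k) / c"
        using big[of k] c by (simp add: divide_right_mono ring_distribs)
      also have "\<dots> = (\<Sum>j<n k. h ((T ^^ j) (x k)))"
        unfolding birkhoff_sum_def h_def by (simp add: sum.distrib sum_divide_distrib[symmetric])
      also have "\<dots> \<le> (\<Sum>j<n k. (1 / N) * (\<Sum>i<N. indicator (K i) ((T ^^ j) (x k))))"
      proof (rule sum_mono)
        fix j
        show "h ((T ^^ j) (x k)) \<le> (1 / N) * (\<Sum>i<N. indicator (K i) ((T ^^ j) (x k)))"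
          using sum_layers_bounds(1)[OF h N, of "(T ^^ j) (x k)"] N
          by (simp add: K_def indicator_def of_bool_def field_simps)
      qed
      also have "\<dots> = (1 / N) * (\<Sum>i<N. F k (K i)) * n k"
        unfolding F_def sum_distrib_left[symmetric]
        by (subst sum.swap) (use npos[of k] in \<open>simp add: sum_divide_distrib[symmetric]\<close>)
      finally show ?thesis
        by (rule mult_right_le_imp_le) (use npos[of k] in simp)
    qed
    moreover have "((\<lambda>k. (1 / N) * (\<Sum>i<N. F k (K i))) \<longlongrightarrow> (1 / N) * (\<Sum>i<N. m (K i))) G"
      by (intro tendsto_intros lim)
    ultimately have "(\<Lambda> + B) / c \<le> (1 / N) * (\<Sum>i<N. m (K i))"
      using tendsto_lowerbound[OF _ _ G(1)] by (metis (mono_tags, lifting) always_eventually)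
    also have "\<dots> \<le> (1 / N) * (\<Sum>i<N. measure \<mu> (K i))"
      using Kc mK by (intro mult_left_mono sum_mono) auto
    also have "\<dots> = (\<integral>y. (1 / N) * (\<Sum>i<N. indicator (K i) y) \<partial>\<mu>)"
      using Kc sb sp by (simp add: integrable_indicator_iff less_top[symmetric] emeasure_eq_measure)
    also have "\<dots> \<le> (\<integral>y. h y + 1 / N \<partial>\<mu>)"
    proof (rule integral_mono)
      show "integrable \<mu> (\<lambda>y. (1 / N) * (\<Sum>i<N. indicator (K i) y))"
        using Kc sb by (intro integrable_mult_right integrable_sum)
          (simp add: integrable_indicator_iff less_top[symmetric] emeasure_eq_measure)
      show "integrable \<mu> (\<lambda>y. h y + 1 / N)" using hint by simp
      fix y
      show "(1 / N) * (\<Sum>i<N. indicator (K i) y) \<le> h y + 1 / N"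
        using sum_layers_bounds(2)[OF h N, of y] N
        by (simp add: K_def indicator_def of_bool_def field_simps)
    qed
    also have "\<dots> = (\<integral>x. h x \<partial>\<mu>) + 1 / real N" using hint by (simp add: prob_space)
    finally show ?thesis .
  qed
  have "(\<Lambda> + B) / c \<le> (\<integral>x. h x \<partial>\<mu>)"
  proof (rule field_le_epsilon)
    fix e :: real assume "0 < e"
    then obtain N :: nat where "0 < N" "1 / real N < e"
      by (metis nat_approx_posE zero_less_Suc)
    then show "(\<Lambda> + B) / c \<le> (\<integral>x. h x \<partial>\<mu>) + e" using key[of N] by linarith
  qed
  then show False unfolding inth using less c by (simp add: divide_le_cancel)
qed

lemma sum_shift_difference:
  fixes a :: "nat \<Rightarrow> real"
  shows "(\<Sum>j<n. a (j + N) - a j) = (\<Sum>i<N. a (n + i) - a i)"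
proof (induction n)
  case (Suc n)
  have "(\<Sum>i<N. a (Suc n + i)) - (\<Sum>i<N. a (n + i)) = a (n + N) - a n"
    using sum_lessThan_telescope[of "\<lambda>i. a (n + i)" N] by (simp add: sum_subtractf)
  with Suc show ?case by (simp add: sum_subtractf add.commute)
qed simp

text \<open>
  The uniform upper bound in the subadditive ergodic theorem. Instead of cutting an orbit segment into
  blocks of length \<open>N\<close>, the inequalities \<open>f (j + N) - f j \<le> f N \<circ> T\<^bsup>j\<^esup>\<close> are summed over \<open>j < n\<close>: the left side
  telescopes to a sum of \<open>N\<close> terms close to \<open>f n\<close>, the right side is a Birkhoff sum. The hypothesis on
  single steps bounds the error of replacing \<open>f (n + i)\<close> by \<open>f n\<close>.
\<close>

lemma subadditive_cocycle_uniform_bound: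
  fixes T :: "'a::metric_space \<Rightarrow> 'a" and f :: "nat \<Rightarrow> 'a \<Rightarrow> real"
  assumes cpt: "compact (UNIV :: 'a set)"
    and T: "homeomorphism UNIV UNIV T (inv T)"
    and ue: "uniquely_ergodic T" and \<mu>: "invariant_prob T \<mu>"
    and cont: "\<And>n. continuous_on UNIV (f n)"
    and sub: "\<And>n k x. f (n + k) x \<le> f n x + f k ((T ^^ n) x)"
    and step: "\<And>n x. f n x \<le> f (Suc n) x + B"
    and N: "0 < N" and less: "(\<integral>x. f N x \<partial>\<mu>) < \<Lambda> * real N"
  shows "\<exists>C. \<forall>n x. f n x \<le> \<Lambda> * real n + C"
proof -
  obtain n0 where n0: "\<And>n x. n0 \<le> n \<Longrightarrow> birkhoff_sum T (f N) n x \<le> \<Lambda> * real N * real n"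
    using uniform_birkhoff_upper[OF cpt T ue \<mu> cont less] by blast
  have "\<exists>b. \<forall>x. \<bar>f n x\<bar> \<le> b" for n
    using continuous_real_bounded_on_compact_space[OF cpt cont[of n]] by metis
  then obtain b where b: "\<And>n x. \<bar>f n x\<bar> \<le> b n" by metis
  have b0: "0 \<le> b n" for n using b[of n] abs_ge_zero order_trans by blast
  have steps: "f n x \<le> f (n + i) x + real i * B" for n i x
  proof (induction i)
    case (Suc i)
    then show ?case using step[of "n + i" x] by (simp add: ring_distribs)
  qed simp
  define D where "D = (\<Sum>i<N. real i * B) + (\<Sum>i<N. b i)"
  have large: "f n x \<le> \<Lambda> * real n + D / N" if n: "n0 \<le> n" for n x
  proof -
    have "real N * f n x = (\<Sum>i<N. f n x)" by simp
    also have "\<dots> \<le> (\<Sum>i<N. (f (n + i) x - f i x) + (real i * B + b i))"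
    proof (rule sum_mono)
      fix i show "f n x \<le> (f (n + i) x - f i x) + (real i * B + b i)"
        using steps[of n x i] b[of i x] by linarith
    qed
    also have "\<dots> = (\<Sum>j<n. f (j + N) x - f j x) + D"
      unfolding D_def sum_shift_difference[of "\<lambda>i. f i x"] by (simp add: sum.distrib)
    also have "\<dots> \<le> birkhoff_sum T (f N) n x + D"
    proof -
      have "f (j + N) x - f j x \<le> f N ((T ^^ j) x)" for j
        using sub[of j N x] by linarith
      then show ?thesis unfolding birkhoff_sum_def by (intro add_right_mono sum_mono) auto
    qed
    also have "\<dots> \<le> \<Lambda> * real N * real n + D" using n0[OF n] by simp
    finally show ?thesis using N by (simp add: field_simps)
  qed
  (* The N-step bound holds at once for n >= n0; the finitely many smaller n are absorbed into C. *)
  define C where "C = \<bar>D / N\<bar> + (\<Sum>n<n0. b n + \<bar>\<Lambda>\<bar> * real n)"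
  have "f n x \<le> \<Lambda> * real n + C" for n x
  proof (cases "n0 \<le> n")
    case True
    have "0 \<le> (\<Sum>n<n0. b n + \<bar>\<Lambda>\<bar> * real n)" using b0 by (intro sum_nonneg) simp
    then show ?thesis using large[OF True, of x] unfolding C_def by linarith
  next
    case False
    have "b n + \<bar>\<Lambda>\<bar> * real n \<le> (\<Sum>n<n0. b n + \<bar>\<Lambda>\<bar> * real n)"
      using False b0 by (intro member_le_sum) auto
    moreover have "- (\<bar>\<Lambda>\<bar> * real n) \<le> \<Lambda> * real n"
      by (metis abs_ge_minus_self abs_mult abs_of_nat minus_le_iff)
    ultimately show ?thesis using b[of n x] unfolding C_def by linarith
  qed
  then show ?thesis by blast
qed

section \<open>Fundamental solutions as polynomials in the energy\<close>

text \<open>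
  The solution with initial data \<open>0, 1\<close> for a potential on a half line; \<open>fundsol r E (Suc n)\<close> is the
  characteristic polynomial, up to sign, of the Dirichlet restriction to the first \<open>n\<close> sites.
\<close>

fun fundsol :: "(nat \<Rightarrow> real) \<Rightarrow> complex \<Rightarrow> nat \<Rightarrow> complex" where
  "fundsol r E 0 = 0"
| "fundsol r E (Suc 0) = 1"
| "fundsol r E (Suc (Suc k)) = (of_real (r k) - E) * fundsol r E (Suc k) - fundsol r E k"

text \<open>
  The imaginary part of \<open>P\<^sub>n\<^sub>+\<^sub>1\<close> times the conjugate of \<open>P\<^sub>n\<close> equals \<open>- Im E\<close> times a sum of squares. This is
  the self-adjointness of the Dirichlet restriction in a form that needs no matrices.
\<close>

lemma fundsol_nonzero_nonreal:
  assumes "Im E \<noteq> 0"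
  shows "fundsol r E (Suc n) \<noteq> 0"
proof -
  let ?J = "\<lambda>n. Im (fundsol r E (Suc n) * cnj (fundsol r E n))"
  have J: "?J n = - Im E * (\<Sum>k<n. (cmod (fundsol r E (Suc k)))\<^sup>2)" for n
  proof (induction n)
    case (Suc n)
    have "?J (Suc n) = Im ((of_real (r n) - E) * (fundsol r E (Suc n) * cnj (fundsol r E (Suc n))))
        - Im (fundsol r E n * cnj (fundsol r E (Suc n)))"
      by (simp add: algebra_simps)
    also have "\<dots> = - Im E * (cmod (fundsol r E (Suc n)))\<^sup>2 + ?J n"
      by (simp add: complex_norm_square[symmetric] flip: of_real_power)
    finally show ?case unfolding Suc by (simp add: algebra_simps)
  qed simp
  show ?thesis
  proof
    assume z: "fundsol r E (Suc n) = 0"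
    have "0 < (\<Sum>k<n. (cmod (fundsol r E (Suc k)))\<^sup>2)"
    proof (rule sum_pos2[of _ 0])
      show "0 \<in> {..<n}" using z by (cases n) auto
    qed auto
    moreover have "?J n = 0" using z by simp
    ultimately show False using J[of n] assms by simp
  qed
qed

lemma fundsol_nonzero_large:
  assumes "\<And>k. \<bar>r k\<bar> \<le> M" and "M + 2 < cmod E"
  shows "fundsol r E (Suc n) \<noteq> 0"
proof -
  have "cmod (fundsol r E n) \<le> cmod (fundsol r E (Suc n)) \<and> 0 < cmod (fundsol r E (Suc n))"
  proof (induction n)
    case (Suc n)
    have "2 \<le> cmod (of_real (r n) - E)"
      using norm_triangle_ineq2[of E "of_real (r n)"] assms(1)[of n] assms(2)
      by (simp add: norm_minus_commute)
    then have "2 * cmod (fundsol r E (Suc n)) \<le> cmod ((of_real (r n) - E) * fundsol r E (Suc n))"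
      unfolding norm_mult by (intro mult_right_mono) auto
    also have "\<dots> \<le> cmod (fundsol r E (Suc (Suc n))) + cmod (fundsol r E n)"
      using norm_triangle_ineq[of "fundsol r E (Suc (Suc n))" "fundsol r E n"] by simp
    finally show ?case using Suc by linarith
  qed simp
  then show ?thesis by auto
qed

fun fundpoly :: "(nat \<Rightarrow> real) \<Rightarrow> nat \<Rightarrow> complex poly" where
  "fundpoly r 0 = 0"
| "fundpoly r (Suc 0) = 1"
| "fundpoly r (Suc (Suc k)) = [:of_real (r k), -1:] * fundpoly r (Suc k) - fundpoly r k"

lemma poly_fundpoly: "poly (fundpoly r n) E = fundsol r E n"
  by (induction r n rule: fundpoly.induct) (auto simp: algebra_simps)

lemma degree_fundpoly:
  "degree (fundpoly r (Suc n)) = n \<and> cmod (lead_coeff (fundpoly r (Suc n))) = 1 \<and> degree (fundpoly r n) \<le> n"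
proof (induction n)
  case (Suc n)
  let ?p = "[:of_real (r n), -1:] * fundpoly r (Suc n)"
  have nz: "fundpoly r (Suc n) \<noteq> 0" using Suc by auto
  have dp: "degree ?p = Suc n" using Suc nz by (simp add: degree_mult_eq del: mult_pCons_left)
  have lt: "degree (- fundpoly r n) < degree ?p" unfolding dp using Suc by simp
  have "degree (?p + - fundpoly r n) = Suc n" using degree_add_eq_left[OF lt] dp by simp
  moreover have "lead_coeff (?p + - fundpoly r n) = lead_coeff ?p"
    using lead_coeff_add_le[of ?p "- fundpoly r n"] lt by (metis add.commute lead_coeff_add_le)
  moreover have "cmod (lead_coeff ?p) = 1"
    unfolding lead_coeff_mult norm_mult using conjunct1[OF conjunct2[OF Suc]] by simp
  ultimately show ?case using Suc by (simp del: mult_pCons_left)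
qed simp

text \<open>
  All zeros are real and lie in \<open>[- M - 2, M + 2]\<close>, so the modulus is a product of distances to points
  of this interval. Every later comparison of two energies is done factor by factor.
\<close>

lemma fundsol_factorization:
  assumes M: "\<And>k. \<bar>r k\<bar> \<le> M"
  obtains A :: "real multiset" where "size A = n" and "\<forall>t\<in>#A. \<bar>t\<bar> \<le> M + 2"
    and "\<forall>E. cmod (fundsol r E (Suc n)) = (\<Prod>t\<in>#A. cmod (E - of_real t))"
proof -
  let ?p = "fundpoly r (Suc n)"
  have deg: "degree ?p = n" "cmod (lead_coeff ?p) = 1" using degree_fundpoly[of r n] by auto
  then have "?p \<noteq> 0" by auto
  then obtain B where B: "size B = n" "?p = smult (lead_coeff ?p) (\<Prod>x\<in>#B. [:-x, 1:])"
    using alg_closed_imp_factorization[of ?p] deg by metis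
  have ev: "fundsol r E (Suc n) = lead_coeff ?p * (\<Prod>x\<in>#B. E - x)" for E
  proof -
    have "poly (\<Prod>x\<in>#B. [:-x, 1:]) E = (\<Prod>x\<in>#B. E - x)" by (induction B) (auto simp: algebra_simps)
    then show ?thesis using B(2) by (metis poly_fundpoly poly_smult)
  qed
  have root: "Im x = 0 \<and> \<bar>Re x\<bar> \<le> M + 2" if "x \<in># B" for x
  proof -
    have "fundsol r x (Suc n) = 0" unfolding ev using that by (auto intro: image_eqI[of _ _ x])
    then have "Im x = 0" "cmod x \<le> M + 2"
      using fundsol_nonzero_nonreal fundsol_nonzero_large[OF M] by (blast, meson not_le)
    then show ?thesis using abs_Re_le_cmod[of x] by auto
  qed
  show thesis
  proof (rule that[of "image_mset Re B"])
    show "size (image_mset Re B) = n" using B by simp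
    show "\<forall>t\<in>#image_mset Re B. \<bar>t\<bar> \<le> M + 2" using root by auto
    show "\<forall>E. cmod (fundsol r E (Suc n)) = (\<Prod>t\<in>#image_mset Re B. cmod (E - of_real t))"
    proof
      fix E
      have "cmod (fundsol r E (Suc n)) = (\<Prod>x\<in>#B. cmod (E - x))"
      proof -
        have "cmod (\<Prod>x\<in>#B. E - x) = (\<Prod>x\<in>#B. cmod (E - x))"
          by (induction B) (auto simp: norm_mult)
        then show ?thesis unfolding ev norm_mult deg(2) by simp
      qed
      also have "\<dots> = (\<Prod>x\<in>#B. cmod (E - of_real (Re x)))"
      proof (rule arg_cong[where f=prod_mset], rule image_mset_cong)
        fix x assume "x \<in># B"
        then have "complex_of_real (Re x) = x" using root by (simp add: complex_eq_iff)
        then show "cmod (E - x) = cmod (E - of_real (Re x))" by simp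
      qed
      finally show "cmod (fundsol r E (Suc n)) = (\<Prod>t\<in>#image_mset Re B. cmod (E - of_real t))"
        by (simp add: image_mset.compositionality o_def)
    qed
  qed
qed

lemma fundsol_compare:
  assumes M: "\<And>k. \<bar>r k\<bar> \<le> M" and c: "0 \<le> c"
    and le: "\<And>t. \<bar>t\<bar> \<le> M + 2 \<Longrightarrow> c * cmod (z - of_real t) \<le> cmod (w - of_real t)"
  shows "c ^ n * cmod (fundsol r z (Suc n)) \<le> cmod (fundsol r w (Suc n))"
proof -
  obtain A where A: "size A = n" "\<forall>t\<in>#A. \<bar>t\<bar> \<le> M + 2"
    "\<forall>E. cmod (fundsol r E (Suc n)) = (\<Prod>t\<in>#A. cmod (E - of_real t))"
    using fundsol_factorization[of r M n] M by blast
  have "c ^ size A * (\<Prod>t\<in>#A. cmod (z - of_real t)) \<le> (\<Prod>t\<in>#A. cmod (w - of_real t))"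
    using A(2)
  proof (induction A)
    case (add t A)
    have nn: "0 \<le> (\<Prod>t\<in>#A. cmod (z - of_real t))" by (induction A) auto
    have "c ^ size (add_mset t A) * (\<Prod>t\<in>#add_mset t A. cmod (z - of_real t))
        = (c * cmod (z - of_real t)) * (c ^ size A * (\<Prod>t\<in>#A. cmod (z - of_real t)))" by simp
    also have "\<dots> \<le> cmod (w - of_real t) * (\<Prod>t\<in>#A. cmod (w - of_real t))"
    proof (rule mult_mono)
      show "c * cmod (z - of_real t) \<le> cmod (w - of_real t)" using add.prems by (intro le) simp
      show "c ^ size A * (\<Prod>t\<in>#A. cmod (z - of_real t)) \<le> (\<Prod>t\<in>#A. cmod (w - of_real t))"
        using add.prems by (intro add.IH) simp
      show "0 \<le> c ^ size A * (\<Prod>t\<in>#A. cmod (z - of_real t))"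
        using nn c by simp
    qed simp
    finally show ?case by simp
  qed simp
  then show ?thesis using A by simp
qed

lemma fundsol_lower:
  assumes M: "\<And>k. \<bar>r k\<bar> \<le> M" and c: "0 \<le> c"
    and le: "\<And>t. \<bar>t\<bar> \<le> M + 2 \<Longrightarrow> c \<le> cmod (w - of_real t)"
  shows "c ^ n \<le> cmod (fundsol r w (Suc n))"
proof -
  obtain A where A: "size A = n" "\<forall>t\<in>#A. \<bar>t\<bar> \<le> M + 2"
    "\<forall>E. cmod (fundsol r E (Suc n)) = (\<Prod>t\<in>#A. cmod (E - of_real t))"
    using fundsol_factorization[of r M n] M by blast
  have "c ^ size A \<le> (\<Prod>t\<in>#A. cmod (w - of_real t))"
    using A(2)
  proof (induction A)
    case (add t A)
    have "c ^ size (add_mset t A) = c * c ^ size A" by simp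
    also have "\<dots> \<le> cmod (w - of_real t) * (\<Prod>t\<in>#A. cmod (w - of_real t))"
    proof (rule mult_mono)
      show "c \<le> cmod (w - of_real t)" using add.prems by (intro le) simp
      show "c ^ size A \<le> (\<Prod>t\<in>#A. cmod (w - of_real t))"
        using add.prems by (intro add.IH) simp
    qed (use c in auto)
    finally show ?case by simp
  qed simp
  then show ?thesis using A by simp
qed

text \<open>
  The recurrence obtained by expanding at the left end of the interval; it makes the one-sided kernel
  solve the equation in its first variable too.
\<close>

lemma fundsol_row_recurrence:
  "fundsol r E (Suc (Suc k)) = (of_real (r 0) - E) * fundsol (\<lambda>j. r (Suc j)) E (Suc k)
     - fundsol (\<lambda>j. r (Suc (Suc j))) E k"
proof (induction k rule: induct_nat_012)
  case (ge2 n)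
  show ?case
    unfolding fundsol.simps(3)[of r E "Suc (Suc n)"] ge2 
    by (simp add: algebra_simps)
qed (auto simp: algebra_simps)

section \<open>Norms of transfer matrices\<close>

abbreviation matnorm :: "complex ^ 2 ^ 2 \<Rightarrow> real" where
  "matnorm A \<equiv> onorm ((*v) A)"

lemma bounded_linear_matrix_vector_mult:
  fixes A :: "complex ^ 2 ^ 2"
  shows "bounded_linear ((*v) A)"
proof -
  have "linear ((*v) A)"
  proof (rule linearI)
    show "A *v (x + y) = A *v x + A *v y" for x y by (rule matrix_vector_right_distrib)
    show "A *v (c *\<^sub>R x) = c *\<^sub>R (A *v x)" for c x
      by (simp add: vec_eq_iff matrix_vector_mult_def scaleR_sum_right)
  qed
  then show ?thesis by (simp add: linear_conv_bounded_linear)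
qed

lemma norm_mult_vec_le_matnorm: "norm (A *v x) \<le> matnorm A * norm x"
  by (rule onorm[OF bounded_linear_matrix_vector_mult])

lemma entry_le_matnorm: "cmod (A $ i $ j) \<le> matnorm A"
proof -
  have "cmod (A $ i $ j) = cmod ((A *v axis j 1) $ i)"
    by (simp add: matrix_vector_mult_def axis_def if_distrib cong: if_cong)
  also have "\<dots> \<le> norm (A *v axis j 1)" by (rule Finite_Cartesian_Product.norm_nth_le)
  also have "\<dots> \<le> matnorm A * norm (axis j 1 :: complex ^ 2)" by (rule norm_mult_vec_le_matnorm)
  finally show ?thesis by simp
qed

lemma matnorm_le_sum_entries:
  "matnorm A \<le> cmod (A $ 1 $ 1) + cmod (A $ 1 $ 2) + cmod (A $ 2 $ 1) + cmod (A $ 2 $ 2)"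
proof (rule onorm_le)
  fix x
  have row: "cmod ((A *v x) $ i) \<le> (cmod (A $ i $ 1) + cmod (A $ i $ 2)) * norm x" for i
  proof -
    have "cmod ((A *v x) $ i) \<le> cmod (A $ i $ 1 * x $ 1) + cmod (A $ i $ 2 * x $ 2)"
      by (simp add: matrix_vector_mult_def sum_2 norm_triangle_ineq)
    also have "\<dots> \<le> cmod (A $ i $ 1) * norm x + cmod (A $ i $ 2) * norm x"
      unfolding norm_mult
      by (intro add_mono mult_left_mono Finite_Cartesian_Product.norm_nth_le) auto
    finally show ?thesis by (simp add: ring_distribs)
  qed
  have "norm (A *v x) \<le> (\<Sum>i\<in>UNIV. cmod ((A *v x) $ i))"
    unfolding norm_vec_def by (rule L2_set_le_sum) simp
  also have "\<dots> \<le> (cmod (A $ 1 $ 1) + cmod (A $ 1 $ 2)) * norm x + (cmod (A $ 2 $ 1) + cmod (A $ 2 $ 2)) * norm x"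
    unfolding sum_2 by (intro add_mono row)
  finally show "norm (A *v x) \<le> (cmod (A $ 1 $ 1) + cmod (A $ 1 $ 2) + cmod (A $ 2 $ 1) + cmod (A $ 2 $ 2)) * norm x"
    by (simp add: algebra_simps)
qed

lemma matnorm_mult: "matnorm (A ** B) \<le> matnorm A * matnorm B"
proof -
  have "(*v) (A ** B) = (*v) A \<circ> (*v) B"
    by (simp add: fun_eq_iff matrix_vector_mul_assoc)
  then show ?thesis
    using onorm_compose[OF bounded_linear_matrix_vector_mult bounded_linear_matrix_vector_mult] by simp
qed

lemma matnorm_diff: "\<bar>matnorm A - matnorm B\<bar> \<le> matnorm (A - B)"
proof -
  have *: "matnorm A \<le> matnorm B + matnorm (A - B)" for A B
  proof -
    have "(*v) A = (\<lambda>x. B *v x + (A - B) *v x)"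
      by (simp add: fun_eq_iff matrix_vector_mult_diff_rdistrib)
    then show ?thesis
      using onorm_triangle[OF bounded_linear_matrix_vector_mult[of B] bounded_linear_matrix_vector_mult[of "A - B"]]
      by simp
  qed
  have "matnorm (B - A) = matnorm (A - B)"
  proof -
    have "(*v) (B - A) = (\<lambda>x. - ((A - B) *v x))"
      by (simp add: fun_eq_iff matrix_vector_mult_diff_rdistrib)
    then show ?thesis by (simp add: onorm_neg)
  qed
  then show ?thesis using *[of A B] *[of B A] by simp
qed

lemma tendsto_matnorm:
  assumes "\<And>i j. ((\<lambda>p. A p $ i $ j) \<longlongrightarrow> B $ i $ j) F"
  shows "((\<lambda>p. matnorm (A p)) \<longlongrightarrow> matnorm B) F"
proof -
  let ?e = "\<lambda>p i j. cmod (A p $ i $ j - B $ i $ j)"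
  have "((\<lambda>p. matnorm (A p) - matnorm B) \<longlongrightarrow> 0) F"
  proof (rule Lim_null_comparison[where g = "\<lambda>p. ?e p 1 1 + ?e p 1 2 + ?e p 2 1 + ?e p 2 2"])
    show "\<forall>\<^sub>F p in F. norm (matnorm (A p) - matnorm B) \<le> ?e p 1 1 + ?e p 1 2 + ?e p 2 1 + ?e p 2 2"
      using matnorm_diff matnorm_le_sum_entries order_trans
      by (intro always_eventually allI) (fastforce simp: real_norm_def)
    have "((\<lambda>p. ?e p i j) \<longlongrightarrow> 0) F" for i j
      using assms[of i j] by (simp add: tendsto_norm_zero Lim_null[symmetric])
    then show "((\<lambda>p. ?e p 1 1 + ?e p 1 2 + ?e p 2 1 + ?e p 2 2) \<longlongrightarrow> 0) F"
      by (intro tendsto_add_zero) auto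
  qed
  then show ?thesis by (simp add: Lim_null[symmetric])
qed

lemma transfer_matrix_add:
  "transfer_matrix T v E (n + m) x = transfer_matrix T v E n ((T ^^ m) x) ** transfer_matrix T v E m x"
  by (induction n) (simp_all add: funpow_add matrix_mul_assoc)

text \<open>
  The second column starts one site later and carries a sign, since the data \<open>(0, 1)\<close> become \<open>(-1, 0)\<close> after
  one step.
\<close>

lemma transfer_matrix_entries:
  fixes T :: "'a \<Rightarrow> 'a" and v :: "'a \<Rightarrow> real" and x :: 'a
  defines "r \<equiv> \<lambda>j. v ((T ^^ j) x)" and "r' \<equiv> \<lambda>j. v ((T ^^ j) (T x))"
  shows "transfer_matrix T v E (Suc k) x $ 1 $ 1 = fundsol r E (Suc (Suc k))"
    "transfer_matrix T v E (Suc k) x $ 1 $ 2 = - fundsol r' E (Suc k)"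
    "transfer_matrix T v E (Suc k) x $ 2 $ 1 = fundsol r E (Suc k)"
    "transfer_matrix T v E (Suc k) x $ 2 $ 2 = - fundsol r' E k"
proof (induction k)
  case 0
  { case 1 show ?case by (simp add: schrodinger_matrix_def r_def) }
  { case 2 show ?case by (simp add: schrodinger_matrix_def) }
  { case 3 show ?case by (simp add: schrodinger_matrix_def) }
  { case 4 show ?case by (simp add: schrodinger_matrix_def) }
next
  case (Suc k)
  have step: "transfer_matrix T v E (Suc (Suc k)) x $ i $ j
      = schrodinger_matrix v E ((T ^^ Suc k) x) $ i $ 1 * transfer_matrix T v E (Suc k) x $ 1 $ j
      + schrodinger_matrix v E ((T ^^ Suc k) x) $ i $ 2 * transfer_matrix T v E (Suc k) x $ 2 $ j" for i j
    unfolding transfer_matrix.simps(2)[of T v E "Suc k"] matrix_matrix_mult_def[of "schrodinger_matrix v E ((T ^^ Suc k) x)"]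
    by (simp add: sum_2)
  have rr: "v (T ((T ^^ k) x)) = r (Suc k)" "r' k = r (Suc k)"
    by (simp_all add: r_def r'_def funpow_swap1)
  { case 1 show ?case unfolding step by (simp add: Suc schrodinger_matrix_def rr del: transfer_matrix.simps(2)) }
  { case 2 show ?case unfolding step by (simp add: Suc schrodinger_matrix_def rr del: transfer_matrix.simps(2)) }
  { case 3 show ?case unfolding step by (simp add: Suc schrodinger_matrix_def rr del: transfer_matrix.simps(2)) }
  { case 4 show ?case unfolding step by (simp add: Suc schrodinger_matrix_def rr del: transfer_matrix.simps(2)) }
qed

lemma det_transfer_matrix: "det (transfer_matrix T v E n x) = 1"
proof (induction n)
  case (Suc n)
  have "det (schrodinger_matrix v E y) = 1" for y
    by (simp add: det_2 schrodinger_matrix_def)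
  with Suc show ?case by (simp add: det_mul)
qed simp

definition growth :: "('a \<Rightarrow> 'a) \<Rightarrow> ('a \<Rightarrow> real) \<Rightarrow> complex \<Rightarrow> nat \<Rightarrow> 'a \<Rightarrow> real" where
  "growth T v E n x = matnorm (transfer_matrix T v E n x)"

text \<open>
  Determinant one keeps the norm away from zero, so its logarithm is bounded below.
\<close>

lemma growth_ge_half: "1/2 \<le> growth T v E n x"
proof -
  let ?A = "transfer_matrix T v E n x"
  have m0: "0 \<le> matnorm ?A" by (rule onorm_pos_le[OF bounded_linear_matrix_vector_mult])
  have "1 = cmod (?A $ 1 $ 1 * ?A $ 2 $ 2 - ?A $ 1 $ 2 * ?A $ 2 $ 1)"
    using det_transfer_matrix[of T v E n x] by (simp add: det_2)
  also have "\<dots> \<le> cmod (?A $ 1 $ 1) * cmod (?A $ 2 $ 2) + cmod (?A $ 1 $ 2) * cmod (?A $ 2 $ 1)"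
    unfolding norm_mult[symmetric] by (rule norm_triangle_ineq4)
  also have "\<dots> \<le> matnorm ?A * matnorm ?A + matnorm ?A * matnorm ?A"
    using m0 by (intro add_mono mult_mono entry_le_matnorm) auto
  finally have sq: "1 \<le> 2 * (matnorm ?A * matnorm ?A)" by simp
  show ?thesis
  proof (rule ccontr)
    assume "\<not> ?thesis"
    then have "matnorm ?A * matnorm ?A \<le> (1/2) * (1/2)"
      unfolding growth_def using m0 by (intro mult_mono) auto
    then show False using sq by simp
  qed
qed

lemma growth_pos: "0 < growth T v E n x"
  using growth_ge_half[of T v E n x] by linarith

lemma growth_submult: "growth T v E (n + m) x \<le> growth T v E n ((T ^^ m) x) * growth T v E m x"
  unfolding growth_def transfer_matrix_add by (rule matnorm_mult)

lemma growth_0: "growth T v E 0 x \<le> 2"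
  using matnorm_le_sum_entries[of "mat 1"] by (simp add: growth_def mat_def)

lemma growth_1:
  assumes "\<And>x. \<bar>v x\<bar> \<le> M"
  shows "growth T v E (Suc 0) x \<le> M + cmod E + 2"
proof -
  have "growth T v E (Suc 0) x \<le> cmod (of_real (v x) - E) + 2"
    using matnorm_le_sum_entries[of "schrodinger_matrix v E x"] by (simp add: growth_def schrodinger_matrix_def)
  also have "cmod (of_real (v x) - E) \<le> M + cmod E"
    using norm_triangle_ineq4[of "of_real (v x)" E] assms[of x] by simp
  finally show ?thesis by simp
qed

lemma growth_le_power:
  assumes "\<And>x. \<bar>v x\<bar> \<le> M"
  shows "growth T v E n x \<le> 2 * (M + cmod E + 2) ^ n"
proof (induction n)
  case (Suc n)
  have "growth T v E (Suc n) x \<le> growth T v E (Suc 0) ((T ^^ n) x) * growth T v E n x"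
    using growth_submult[of T v E "Suc 0" n x] by simp
  also have "\<dots> \<le> (M + cmod E + 2) * (2 * (M + cmod E + 2) ^ n)"
  proof (rule mult_mono)
    show "growth T v E (Suc 0) ((T ^^ n) x) \<le> M + cmod E + 2" by (rule growth_1[OF assms])
    then show "0 \<le> M + cmod E + 2"
      using growth_pos[of T v E "Suc 0" "(T ^^ n) x"] by linarith
  qed (use Suc growth_pos[of T v E n x] in auto)
  finally show ?case by simp
qed (use growth_0 in auto)

text \<open>
  The inverse of a one-step matrix is bounded, so the logarithm of the norm drops by a bounded amount
  per step, as \<open>subadditive_cocycle_uniform_bound\<close> requires.
\<close>

lemma growth_step_down:
  assumes "\<And>x. \<bar>v x\<bar> \<le> M"
  shows "growth T v E n x \<le> (M + cmod E + 2) * growth T v E (Suc n) x"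
proof -
  let ?y = "(T ^^ n) x"
  define S where "S = (vector [vector [0, 1], vector [-1, of_real (v ?y) - E]] :: complex ^ 2 ^ 2)"
  have inv: "S ** schrodinger_matrix v E ?y = mat 1"
    by (simp add: S_def schrodinger_matrix_def vec_eq_iff forall_2 matrix_matrix_mult_def sum_2 mat_def)
  have "transfer_matrix T v E n x = S ** transfer_matrix T v E (Suc n) x"
    by (simp add: matrix_mul_assoc inv)
  then have "growth T v E n x \<le> matnorm S * growth T v E (Suc n) x"
    unfolding growth_def using matnorm_mult by metis
  also have "matnorm S \<le> M + cmod E + 2"
  proof -
    have "matnorm S \<le> cmod (of_real (v ?y) - E) + 2"
      using matnorm_le_sum_entries[of S] by (simp add: S_def)
    also have "cmod (of_real (v ?y) - E) \<le> M + cmod E"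
      using norm_triangle_ineq4[of "of_real (v ?y)" E] assms[of ?y] by simp
    finally show ?thesis by simp
  qed
  finally show ?thesis using growth_pos[of T v E "Suc n" x] by (simp add: mult_right_mono)
qed

lemma fundsol_le_growth:
  "cmod (fundsol (\<lambda>j. v ((T ^^ j) x)) E (Suc k)) \<le> growth T v E k x"
  "cmod (fundsol (\<lambda>j. v ((T ^^ j) x)) E (Suc k)) \<le> growth T v E (Suc k) x"
  "cmod (fundsol (\<lambda>j. v ((T ^^ j) (T x))) E (Suc k)) \<le> growth T v E (Suc k) x"
  "cmod (fundsol (\<lambda>j. v ((T ^^ j) (T x))) E k) \<le> growth T v E (Suc k) x"
proof -
  show "cmod (fundsol (\<lambda>j. v ((T ^^ j) x)) E (Suc k)) \<le> growth T v E k x"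
  proof (cases k)
    case 0
    then show ?thesis
      using entry_le_matnorm[of "mat 1" 1 1] by (simp add: growth_def mat_def)
  next
    case (Suc n)
    then show ?thesis
      unfolding growth_def using entry_le_matnorm[of "transfer_matrix T v E (Suc n) x" 1 1]
      by (simp only: transfer_matrix_entries)
  qed
  show "cmod (fundsol (\<lambda>j. v ((T ^^ j) x)) E (Suc k)) \<le> growth T v E (Suc k) x"
    unfolding growth_def using entry_le_matnorm[of "transfer_matrix T v E (Suc k) x" 2 1]
    by (simp only: transfer_matrix_entries)
  show "cmod (fundsol (\<lambda>j. v ((T ^^ j) (T x))) E (Suc k)) \<le> growth T v E (Suc k) x"
    unfolding growth_def using entry_le_matnorm[of "transfer_matrix T v E (Suc k) x" 1 2]
    by (simp only: transfer_matrix_entries norm_minus_cancel)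
  show "cmod (fundsol (\<lambda>j. v ((T ^^ j) (T x))) E k) \<le> growth T v E (Suc k) x"
    unfolding growth_def using entry_le_matnorm[of "transfer_matrix T v E (Suc k) x" 2 2]
    by (simp only: transfer_matrix_entries norm_minus_cancel)
qed

lemma growth_le_fundsol:
  "growth T v E (Suc k) x \<le> cmod (fundsol (\<lambda>j. v ((T ^^ j) x)) E (Suc (Suc k)))
     + cmod (fundsol (\<lambda>j. v ((T ^^ j) (T x))) E (Suc k))
     + cmod (fundsol (\<lambda>j. v ((T ^^ j) x)) E (Suc k))
     + cmod (fundsol (\<lambda>j. v ((T ^^ j) (T x))) E k)"
  unfolding growth_def using matnorm_le_sum_entries[of "transfer_matrix T v E (Suc k) x"]
  by (simp only: transfer_matrix_entries norm_minus_cancel)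

text \<open>
  The entries of the matrix are fundamental solutions of lengths \<open>n - 2\<close> to \<open>n\<close>, so the factorwise
  comparison loses at most two factors \<open>c\<close>.
\<close>

lemma growth_compare:
  assumes M: "\<And>x. \<bar>v x\<bar> \<le> M" and c: "0 < c"
    and le: "\<And>t. \<bar>t\<bar> \<le> M + 2 \<Longrightarrow> c * cmod (z - of_real t) \<le> cmod (w - of_real t)"
  shows "c ^ n * growth T v z n x \<le> 4 * max 1 (c\<^sup>2) * growth T v w n x"
proof (cases n)
  case 0
  have "growth T v z 0 x \<le> 4 * (1/2)" using growth_0[of T v z x] by simp
  also have "\<dots> \<le> 4 * (max 1 (c\<^sup>2) * growth T v w 0 x)"
  proof -
    have "1 * (1/2) \<le> max 1 (c\<^sup>2) * growth T v w 0 x"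
      using growth_ge_half[of T v w 0 x] by (intro mult_mono) (auto simp: le_max_iff_disj)
    then show ?thesis by linarith
  qed
  finally show ?thesis using 0 by simp
next
  case (Suc k)
  let ?r = "\<lambda>j. v ((T ^^ j) x)" and ?r' = "\<lambda>j. v ((T ^^ j) (T x))"
  let ?K = "max 1 (c\<^sup>2)" and ?g = "growth T v w (Suc k) x"
  have cmp: "c ^ m * cmod (fundsol s z (Suc m)) \<le> cmod (fundsol s w (Suc m))"
    if "s = ?r \<or> s = ?r'" for s m
    using that M c le by (intro fundsol_compare[of s M]) auto
  have g0: "0 \<le> ?g" using growth_pos[of T v w "Suc k" x] by linarith
  have cK: "c \<le> ?K"
  proof (cases "c \<le> 1")
    case False
    then have "c \<le> c * c" using c by simp
    then show ?thesis by (simp add: power2_eq_square le_max_iff_disj)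
  qed simp
  have K1: "1 \<le> ?K" "c\<^sup>2 \<le> ?K" by auto
  have sc: "a * y \<le> ?K * ?g" if "0 \<le> a" "a \<le> ?K" "y \<le> ?g" for a y
  proof -
    have "a * y \<le> a * ?g" using that by (intro mult_left_mono) auto
    also have "\<dots> \<le> ?K * ?g" using that g0 by (intro mult_right_mono) auto
    finally show ?thesis .
  qed
  have 1: "c ^ Suc k * cmod (fundsol ?r z (Suc (Suc k))) \<le> ?K * ?g"
    using cmp[of ?r "Suc k"] sc[of 1 "cmod (fundsol ?r w (Suc (Suc k)))"] K1
      fundsol_le_growth(1)[of v T x w "Suc k"] by simp
  have 2: "c ^ Suc k * cmod (fundsol ?r' z (Suc k)) \<le> ?K * ?g"
  proof -
    have "c ^ Suc k * cmod (fundsol ?r' z (Suc k)) \<le> c * cmod (fundsol ?r' w (Suc k))"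
      using mult_left_mono[OF cmp[of ?r' k], of c] c by (simp add: mult.assoc)
    also have "\<dots> \<le> ?K * ?g" using c cK fundsol_le_growth(3)[of v T x w k] by (intro sc) auto
    finally show ?thesis .
  qed
  have 3: "c ^ Suc k * cmod (fundsol ?r z (Suc k)) \<le> ?K * ?g"
  proof -
    have "c ^ Suc k * cmod (fundsol ?r z (Suc k)) \<le> c * cmod (fundsol ?r w (Suc k))"
      using mult_left_mono[OF cmp[of ?r k], of c] c by (simp add: mult.assoc)
    also have "\<dots> \<le> ?K * ?g" using c cK fundsol_le_growth(2)[of v T x w k] by (intro sc) auto
    finally show ?thesis .
  qed
  have 4: "c ^ Suc k * cmod (fundsol ?r' z k) \<le> ?K * ?g"
  proof (cases k)
    case 0
    then show ?thesis using g0 K1 by simp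
  next
    case (Suc l)
    have "c ^ Suc k * cmod (fundsol ?r' z k) \<le> c\<^sup>2 * cmod (fundsol ?r' w k)"
      using mult_left_mono[OF cmp[of ?r' l], of "c\<^sup>2"] c Suc by (simp add: mult.assoc power2_eq_square)
    also have "\<dots> \<le> ?K * ?g" using c fundsol_le_growth(4)[of v T x w k] by (intro sc) auto
    finally show ?thesis .
  qed
  have "c ^ Suc k * growth T v z (Suc k) x \<le> c ^ Suc k * (cmod (fundsol ?r z (Suc (Suc k)))
     + cmod (fundsol ?r' z (Suc k)) + cmod (fundsol ?r z (Suc k)) + cmod (fundsol ?r' z k))"
    using c by (intro mult_left_mono growth_le_fundsol) auto
  also have "\<dots> \<le> 4 * ?K * ?g" using 1 2 3 4 by (simp only: ring_distribs)
  finally show ?thesis using Suc by simp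
qed

lemmas growth_simps [simp] = growth_pos less_imp_le[OF growth_pos] less_imp_neq[OF growth_pos, symmetric]

section \<open>The Lyapunov exponent\<close>

locale ergodic_schrodinger =
  fixes T :: "'a::metric_space \<Rightarrow> 'a" and v :: "'a \<Rightarrow> real" and \<mu> :: "'a measure"
  assumes compact_X: "compact (UNIV :: 'a set)"
    and homeo: "homeomorphism UNIV UNIV T (inv T)"
    and strict: "strictly_ergodic T"
    and inv_\<mu>: "invariant_prob T \<mu>"
    and cont_v: "continuous_on UNIV v"
begin

lemma uniquely_ergodic_T: "uniquely_ergodic T" and minimal_T: "minimal_map T"
  using strict by (auto simp: strictly_ergodic_def)

lemma prob_\<mu>: "prob_space \<mu>" and sets_\<mu>: "sets \<mu> = sets borel"
  using inv_\<mu> by (auto simp: invariant_prob_def)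

lemma cont_T: "continuous_on UNIV T" and cont_inv_T: "continuous_on UNIV (inv T)"
  and T_inv_T: "T (inv T x) = x" and inv_T_T: "inv T (T x) = x"
  using homeo by (auto simp: homeomorphism_def)

lemma cont_funpow: "continuous_on UNIV (T ^^ n)"
proof (induction n)
  case (Suc n)
  then show ?case
    using continuous_on_compose[OF Suc continuous_on_subset[OF cont_T]] by (simp add: o_def)
qed (simp add: continuous_on_id id_def)

lemma v_bounded: "\<exists>M>0. \<forall>x. \<bar>v x\<bar> \<le> M"
  using continuous_real_bounded_on_compact_space[OF compact_X cont_v] by metis

abbreviation "normA \<equiv> growth T v"
abbreviation "L \<equiv> lyapunov T v \<mu>"

lemma continuous_transfer_entry:
  "continuous_on UNIV (\<lambda>x. transfer_matrix T v E n x $ i $ j)"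
proof (induction n arbitrary: i j)
  case (Suc n)
  have v: "continuous_on UNIV (\<lambda>x. v ((T ^^ n) x))"
    using continuous_on_compose[OF cont_funpow continuous_on_subset[OF cont_v]] by (simp add: o_def)
  have "continuous_on UNIV (\<lambda>x. schrodinger_matrix v E ((T ^^ n) x) $ i $ k)" for i k
    using exhaust_2[of i] exhaust_2[of k]
    by (auto simp: schrodinger_matrix_def intro!: continuous_on_diff continuous_on_of_real continuous_on_const v)
  then show ?case
    using Suc by (simp add: matrix_matrix_mult_def sum_2 continuous_on_add continuous_on_mult)
qed simp

lemma continuous_growth: "continuous_on UNIV (normA E n)"
  unfolding growth_def continuous_on_def
  by (intro ballI tendsto_matnorm continuous_transfer_entry[unfolded continuous_on_def, rule_format]) auto

lemma continuous_ln_growth: "continuous_on UNIV (\<lambda>x. ln (normA E n x))"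
  by (intro continuous_on_ln continuous_growth) (simp add: less_imp_neq[OF growth_pos, symmetric])

lemma measurable_continuous: "continuous_on UNIV f \<Longrightarrow> f \<in> borel_measurable \<mu>"
  for f :: "'a \<Rightarrow> real"
  by (subst measurable_cong_sets[OF sets_\<mu> refl]) (rule borel_measurable_continuous_onI)

lemma integrable_continuous:
  fixes f :: "'a \<Rightarrow> real"
  assumes "continuous_on UNIV f"
  shows "integrable \<mu> f"
proof -
  interpret prob_space \<mu> by (rule prob_\<mu>)
  obtain B where "\<And>x. \<bar>f x\<bar> \<le> B"
    using continuous_real_bounded_on_compact_space[OF compact_X assms] by metis
  then show ?thesis
    using measurable_continuous[OF assms] by (intro integrable_const_bound[of _ B]) auto
qed

lemma integral_le_const:
  fixes f :: "'a \<Rightarrow> real"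
  assumes "continuous_on UNIV f" "\<And>x. f x \<le> c"
  shows "(\<integral>x. f x \<partial>\<mu>) \<le> c"
proof -
  interpret prob_space \<mu> by (rule prob_\<mu>)
  have "(\<integral>x. f x \<partial>\<mu>) \<le> (\<integral>x. c \<partial>\<mu>)"
    using assms integrable_continuous by (intro integral_mono) auto
  then show ?thesis by (simp add: prob_space)
qed

lemma integral_ge_const:
  fixes f :: "'a \<Rightarrow> real"
  assumes "continuous_on UNIV f" "\<And>x. c \<le> f x"
  shows "c \<le> (\<integral>x. f x \<partial>\<mu>)"
proof -
  have "(\<integral>x. - f x \<partial>\<mu>) \<le> - c"
    using assms by (intro integral_le_const continuous_intros) auto
  then show ?thesis by simp
qed

definition mean_log_growth :: "complex \<Rightarrow> nat \<Rightarrow> real" where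
  "mean_log_growth E n = (\<integral>x. ln (normA E n x) \<partial>\<mu>)"

text \<open>
  A bound on one mean already controls the norms at every point and every time; this is where unique
  ergodicity enters the upper bounds.
\<close>

lemma growth_exp_bound_of_mean:
  assumes N: "0 < N" and less: "mean_log_growth E N < \<Lambda> * real N"
  shows "\<exists>C>0. \<forall>n x. normA E n x \<le> C * exp (\<Lambda> * real n)"
proof -
  obtain M where M: "\<And>x. \<bar>v x\<bar> \<le> M" "0 < M" using v_bounded by blast
  have K: "0 < M + cmod E + 2" using M(2) norm_ge_zero[of E] by linarith
  have "\<exists>C. \<forall>n x. ln (normA E n x) \<le> \<Lambda> * real n + C"
  proof (rule subadditive_cocycle_uniform_bound[OF compact_X homeo uniquely_ergodic_T inv_\<mu> continuous_ln_growth])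
    show "ln (normA E (n + k) x) \<le> ln (normA E n x) + ln (normA E k ((T ^^ n) x))" for n k x
    proof -
      have "normA E (n + k) x \<le> normA E k ((T ^^ n) x) * normA E n x"
        using growth_submult[of T v E k n x] by (simp add: add.commute)
      then have "ln (normA E (n + k) x) \<le> ln (normA E k ((T ^^ n) x) * normA E n x)"
        using growth_pos by (intro ln_mono) auto
      then show ?thesis using growth_pos by (simp add: ln_mult_pos add.commute)
    qed
    show "ln (normA E n x) \<le> ln (normA E (Suc n) x) + ln (M + cmod E + 2)" for n x
    proof -
      have "ln (normA E n x) \<le> ln ((M + cmod E + 2) * normA E (Suc n) x)"
        using growth_pos by (intro ln_mono growth_step_down M(1)) auto
      then show ?thesis unfolding ln_mult_pos[OF K growth_pos] by simp
    qed
    show "0 < N" by fact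
    show "(\<integral>x. ln (normA E N x) \<partial>\<mu>) < \<Lambda> * real N" using less by (simp add: mean_log_growth_def)
  qed
  then obtain C where C: "\<And>n x. ln (normA E n x) \<le> \<Lambda> * real n + C" by blast
  have "normA E n x \<le> exp C * exp (\<Lambda> * real n)" for n x
    using C[of n x] growth_pos[of T v E n x] by (metis exp_add exp_le_cancel_iff exp_ln mult.commute)
  then show ?thesis by (intro exI[of _ "exp C"]) simp
qed

lemma mean_log_growth_bound:
  assumes "0 < C" and "\<And>x. normA E n x \<le> C * exp (\<Lambda> * real n)"
  shows "mean_log_growth E n \<le> \<Lambda> * real n + ln C"
  unfolding mean_log_growth_def
proof (rule integral_le_const[OF continuous_ln_growth])
  fix x
  have "ln (normA E n x) \<le> ln (C * exp (\<Lambda> * real n))"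
    using growth_pos assms(2) by (intro ln_mono) auto
  then show "ln (normA E n x) \<le> \<Lambda> * real n + ln C" using assms(1) by (simp add: ln_mult_pos add.commute)
qed

lemma mean_log_growth_lower:
  assumes "0 < C" and "\<And>x. C * exp (\<Lambda> * real n) \<le> normA E n x"
  shows "\<Lambda> * real n + ln C \<le> mean_log_growth E n"
  unfolding mean_log_growth_def
proof (rule integral_ge_const[OF continuous_ln_growth])
  fix x
  have "ln (C * exp (\<Lambda> * real n)) \<le> ln (normA E n x)"
    using assms by (intro ln_mono) auto
  then show "\<Lambda> * real n + ln C \<le> ln (normA E n x)" using assms(1) by (simp add: ln_mult_pos add.commute)
qed

text \<open>
  Existence of the limit as an infimum. The uniform bound coming from a nearly optimal \<open>N\<close> bounds all
  later means, which takes the place of Fekete's lemma.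
\<close>

lemma lyapunov_converges: "(\<lambda>n. mean_log_growth E n / real n) \<longlonglongrightarrow> L E"
  and lyapunov_le_mean: "0 < n \<Longrightarrow> L E \<le> mean_log_growth E n / real n"
proof -
  let ?a = "\<lambda>n. mean_log_growth E n / real n"
  define l where "l = (INF n\<in>{0<..}. ?a n)"
  have lower: "- ln 2 \<le> ?a n" if "0 < n" for n
  proof -
    have "- ln 2 \<le> ln (normA E n x)" for x
      using ln_mono[of "1/2" "normA E n x"] growth_ge_half[of T v E n x] growth_pos[of T v E n x] by (simp add: ln_div)
    then have "- ln 2 \<le> mean_log_growth E n"
      unfolding mean_log_growth_def by (intro integral_ge_const continuous_ln_growth)
    moreover have "ln 2 * 1 \<le> ln (2::real) * real n" using that by (intro mult_left_mono) auto
    ultimately have "- (ln 2 * real n) \<le> mean_log_growth E n" by linarith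
    then show ?thesis using that by (simp add: pos_le_divide_eq)
  qed
  have bdd: "bdd_below (?a ` {0<..})" using lower by (intro bdd_belowI[of _ "- ln 2"]) auto
  have l_le: "l \<le> ?a n" if "0 < n" for n unfolding l_def using that bdd by (intro cINF_lower) auto
  have lim: "?a \<longlonglongrightarrow> l"
  proof (rule LIMSEQ_I)
    fix e :: real assume e: "0 < e"
    have "\<exists>N\<in>{0<..}. ?a N < l + e / 2"
      using cINF_less_iff[OF _ bdd, of "l + e/2"] e unfolding l_def by (simp add: greaterThan_def) (metis gt_ex)
    then obtain N where N: "0 < N" "?a N < l + e / 2" by auto
    then have "mean_log_growth E N < (l + e / 2) * real N" by (simp add: field_simps)
    then obtain C where C: "0 < C" "\<And>n x. normA E n x \<le> C * exp ((l + e / 2) * real n)"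
      using growth_exp_bound_of_mean[OF N(1)] by blast
    have up: "?a n \<le> l + e / 2 + \<bar>ln C\<bar> / real n" if "0 < n" for n
    proof -
      have "mean_log_growth E n \<le> (l + e / 2) * real n + \<bar>ln C\<bar>"
        using mean_log_growth_bound[OF C, of n] by linarith
      then show ?thesis using that by (simp add: field_simps)
    qed
    obtain n0 :: nat where n0: "2 * \<bar>ln C\<bar> / e < real n0" using reals_Archimedean2 by blast
    show "\<exists>no. \<forall>n\<ge>no. norm (?a n - l) < e"
    proof (intro exI[of _ "Suc n0"] allI impI)
      fix n assume n: "Suc n0 \<le> n"
      then have n': "0 < n" "2 * \<bar>ln C\<bar> / e < real n" using n0 by linarith+
      then have "\<bar>ln C\<bar> / real n < e / 2" using e by (simp add: field_simps)
      then show "norm (?a n - l) < e"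
        unfolding real_norm_def abs_less_iff using up[OF n'(1)] l_le[OF n'(1)] e by linarith
    qed
  qed
  have "L E = l"
  proof -
    have "(\<lambda>n. \<integral>x. 1 / real n * ln (onorm ((*v) (transfer_matrix T v E n x))) \<partial>\<mu>) = ?a"
      by (simp add: mean_log_growth_def growth_def fun_eq_iff)
    then show ?thesis unfolding lyapunov_def using limI[OF lim] by simp
  qed
  with lim l_le show "?a \<longlonglongrightarrow> L E" and "0 < n \<Longrightarrow> L E \<le> ?a n" by auto
qed

lemma growth_upper:
  assumes "L E < \<Lambda>"
  obtains C where "0 < C" and "\<And>n x. normA E n x \<le> C * exp (\<Lambda> * real n)"
proof -
  have "eventually (\<lambda>n. mean_log_growth E n / real n < \<Lambda> \<and> 0 < n) sequentially"
    using order_tendstoD(2)[OF lyapunov_converges assms] eventually_gt_at_top[of 0]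
    by (rule eventually_conj)
  then obtain N where N: "0 < N" "mean_log_growth E N / real N < \<Lambda>"
    by (auto simp: eventually_sequentially)
  then have "mean_log_growth E N < \<Lambda> * real N" by (simp add: field_simps)
  from growth_exp_bound_of_mean[OF N(1) this] show thesis using that by blast
qed

lemma tendsto_affine_over_n: "(\<lambda>n. (\<Lambda> * real n + c) / real n) \<longlonglongrightarrow> \<Lambda>"
proof -
  have "(\<lambda>n. \<Lambda> + c * inverse (real n)) \<longlonglongrightarrow> \<Lambda> + c * 0"
    by (intro tendsto_intros lim_inverse_n)
  moreover have "eventually (\<lambda>n. \<Lambda> + c * inverse (real n) = (\<Lambda> * real n + c) / real n) sequentially"
    using eventually_gt_at_top[of 0] by eventually_elim (simp add: field_simps)
  ultimately show ?thesis using tendsto_cong by fastforce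
qed

lemma lyapunov_leI:
  assumes "0 < C" and "\<And>n x. normA E n x \<le> C * exp (\<Lambda> * real n)"
  shows "L E \<le> \<Lambda>"
  by (rule LIMSEQ_le[OF lyapunov_converges tendsto_affine_over_n[of \<Lambda> "ln C"]])
    (use mean_log_growth_bound[OF assms] in \<open>auto intro!: divide_right_mono\<close>)

lemma lyapunov_geI:
  assumes "0 < C" and "\<And>n x. C * exp (\<Lambda> * real n) \<le> normA E n x"
  shows "\<Lambda> \<le> L E"
  by (rule LIMSEQ_le[OF tendsto_affine_over_n[of \<Lambda> "ln C"] lyapunov_converges])
    (use mean_log_growth_lower[OF assms] in \<open>auto intro!: divide_right_mono\<close>)

lemma lyapunov_nonneg: "0 \<le> L E"
  by (rule lyapunov_geI[of "1/2"]) (use growth_ge_half in auto)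

text \<open>
  If the norms are supermultiplicative up to a constant, then \<open>- ln (c \<parallel>A\<^sub>n\<parallel>)\<close> is again subadditive and the
  uniform upper bound for it is a uniform lower bound for the norms.
\<close>

lemma growth_lower:
  assumes c: "0 < c" and super: "\<And>n k x. c * normA E n x * normA E k ((T ^^ n) x) \<le> normA E (n + k) x"
    and less: "\<Lambda> < L E"
  obtains C where "0 < C" and "\<And>n x. C * exp (\<Lambda> * real n) \<le> normA E n x"
proof -
  obtain M where M: "\<And>x. \<bar>v x\<bar> \<le> M" "0 < M" using v_bounded by blast
  define K where "K = M + cmod E + 2"
  have K: "0 < K" unfolding K_def using M(2) norm_ge_zero[of E] by linarith
  define f where "f n x = - ln c - ln (normA E n x)" for n x
  have "(\<lambda>n. (\<Lambda> * real n + - ln c) / real n) \<longlonglongrightarrow> \<Lambda>" by (rule tendsto_affine_over_n)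
  then have "(\<lambda>n. mean_log_growth E n / real n - (\<Lambda> * real n + - ln c) / real n) \<longlonglongrightarrow> L E - \<Lambda>"
    by (intro tendsto_diff lyapunov_converges)
  then have "eventually (\<lambda>n. 0 < mean_log_growth E n / real n - (\<Lambda> * real n + - ln c) / real n) sequentially"
    using less by (intro order_tendstoD(1)[where y = "L E - \<Lambda>"]) auto
  then have "eventually (\<lambda>n. 0 < mean_log_growth E n / real n - (\<Lambda> * real n + - ln c) / real n \<and> 0 < n) sequentially"
    using eventually_gt_at_top[of 0] by (rule eventually_conj)
  then obtain N where N: "0 < N" "0 < mean_log_growth E N / real N - (\<Lambda> * real N + - ln c) / real N"
    by (auto simp: eventually_sequentially)
  then have N2: "- ln c - mean_log_growth E N < - \<Lambda> * real N" by (simp add: field_simps)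
  interpret prob_space \<mu> by (rule prob_\<mu>)
  have cf: "continuous_on UNIV (f n)" for n
    unfolding f_def by (intro continuous_intros continuous_ln_growth)
  have "\<exists>D. \<forall>n x. f n x \<le> - \<Lambda> * real n + D"
  proof (rule subadditive_cocycle_uniform_bound[OF compact_X homeo uniquely_ergodic_T inv_\<mu> cf])
    fix n k x
    have "ln (c * normA E n x * normA E k ((T ^^ n) x)) \<le> ln (normA E (n + k) x)"
      using c growth_pos by (intro ln_mono super) auto
    then show "f (n + k) x \<le> f n x + f k ((T ^^ n) x)"
      unfolding f_def using c growth_pos by (simp add: ln_mult_pos)
  next
    fix n x
    have "normA E (Suc n) x \<le> K * normA E n x"
    proof -
      have "normA E (Suc n) x \<le> normA E (Suc 0) ((T ^^ n) x) * normA E n x"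
        using growth_submult[of T v E "Suc 0" n x] by simp
      also have "\<dots> \<le> K * normA E n x"
        unfolding K_def using growth_pos less_imp_le by (intro mult_right_mono growth_1 M) auto
      finally show ?thesis .
    qed
    then have "ln (normA E (Suc n) x) \<le> ln (K * normA E n x)" using growth_pos by (intro ln_mono) auto
    then show "f n x \<le> f (Suc n) x + ln K"
      unfolding f_def using K growth_pos by (simp add: ln_mult_pos)
  next
    show "0 < N" by fact
    show "(\<integral>x. f N x \<partial>\<mu>) < - \<Lambda> * real N"
      using N2 integrable_continuous[OF continuous_ln_growth]
      unfolding f_def mean_log_growth_def by (simp add: prob_space)
  qed
  then obtain D where D: "\<And>n x. f n x \<le> - \<Lambda> * real n + D" by blast
  show thesis
  proof (rule that[of "exp (- D - ln c)"])
    fix n x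
    have "\<Lambda> * real n + (- D - ln c) \<le> ln (normA E n x)" using D[of n x] unfolding f_def by simp
    then show "exp (- D - ln c) * exp (\<Lambda> * real n) \<le> normA E n x"
      using growth_pos[of T v E n x] by (metis add.commute exp_add exp_le_cancel_iff exp_ln)
  qed simp
qed

text \<open>
  The constant \<open>C\<close> may depend on the point: by dominated convergence the mean of the positive part of
  \<open>ln \<parallel>A\<^sub>n\<parallel> / n - \<Lambda>\<close> tends to zero.
\<close>

lemma lyapunov_le_of_pointwise:
  assumes pw: "\<And>x. \<exists>C. \<forall>n. normA E n x \<le> C * exp (\<Lambda> * real n)"
  shows "L E \<le> \<Lambda>"
proof -
  interpret prob_space \<mu> by (rule prob_\<mu>)
  obtain M where M: "\<And>x. \<bar>v x\<bar> \<le> M" "0 < M" using v_bounded by blast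
  define K where "K = M + cmod E + 2"
  have K: "1 \<le> K" unfolding K_def using M(2) norm_ge_zero[of E] by linarith
  define f where "f n x = max 0 (ln (normA E n x) / real n - \<Lambda>)" for n x
  have cf: "continuous_on UNIV (f n)" for n
    unfolding f_def by (cases "n = 0") (auto intro!: continuous_intros continuous_ln_growth)
  have lim: "(\<lambda>n. \<integral>x. f n x \<partial>\<mu>) \<longlonglongrightarrow> (\<integral>x. 0 \<partial>\<mu>)"
  proof (rule integral_dominated_convergence[where w = "\<lambda>_. ln 2 + ln K + \<bar>\<Lambda>\<bar>"])
    show "(\<lambda>x. 0) \<in> borel_measurable \<mu>" by simp
    show "f n \<in> borel_measurable \<mu>" for n by (rule measurable_continuous[OF cf])
    show "integrable \<mu> (\<lambda>_. ln 2 + ln K + \<bar>\<Lambda>\<bar>)" by simp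
    show "AE x in \<mu>. (\<lambda>n. f n x) \<longlonglongrightarrow> 0"
    proof (rule AE_I2)
      fix x
      obtain C where C: "\<And>n. normA E n x \<le> C * exp (\<Lambda> * real n)" using pw by blast
      have "0 < C" using C[of 0] growth_pos[of T v E 0 x] by (simp del: growth_simps)
      have b: "f n x \<le> \<bar>ln C\<bar> * inverse (real n)" if "0 < n" for n
      proof -
        have "ln (normA E n x) \<le> ln (C * exp (\<Lambda> * real n))" using C growth_pos by (intro ln_mono) auto
        also have "\<dots> = ln C + \<Lambda> * real n" using \<open>0 < C\<close> by (simp add: ln_mult_pos)
        finally have "ln (normA E n x) \<le> (\<bar>ln C\<bar> * inverse (real n) + \<Lambda>) * real n"
          using that abs_ge_self[of "ln C"] by (simp add: ring_distribs mult.assoc)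
        then have "ln (normA E n x) / real n \<le> \<bar>ln C\<bar> * inverse (real n) + \<Lambda>"
          using that by (simp only: pos_divide_le_eq of_nat_0_less_iff)
        then have "ln (normA E n x) / real n - \<Lambda> \<le> \<bar>ln C\<bar> * inverse (real n)" by linarith
        then show ?thesis unfolding f_def by simp
      qed
      have z: "(\<lambda>n. \<bar>ln C\<bar> * inverse (real n)) \<longlonglongrightarrow> 0"
        using tendsto_mult_right_zero[OF lim_inverse_n] by blast
      show "(\<lambda>n. f n x) \<longlonglongrightarrow> 0"
      proof (rule tendsto_sandwich[OF _ _ tendsto_const z])
        show "\<forall>\<^sub>F n in sequentially. 0 \<le> f n x" by (simp add: f_def)
        show "\<forall>\<^sub>F n in sequentially. f n x \<le> \<bar>ln C\<bar> * inverse (real n)"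
          using eventually_gt_at_top[of 0] by eventually_elim (rule b)
      qed
    qed
    show "AE x in \<mu>. norm (f n x) \<le> ln 2 + ln K + \<bar>\<Lambda>\<bar>" for n
    proof (rule AE_I2)
      fix x
      have "ln (normA E n x) / real n \<le> ln 2 + ln K"
      proof (cases "n = 0")
        case False
        have "ln (normA E n x) \<le> ln (2 * K ^ n)"
          using growth_pos growth_le_power[of v M T E n x] M(1) by (intro ln_mono) (auto simp: K_def)
        also have "\<dots> = ln 2 + real n * ln K" using K by (simp add: ln_mult_pos ln_realpow)
        also have "\<dots> \<le> (ln 2 + ln K) * real n"
          using False K ln_gt_zero[of "2::real"] by (simp add: ring_distribs)
        finally show ?thesis using False by (simp add: field_simps)
      qed (use K in simp)
      then show "norm (f n x) \<le> ln 2 + ln K + \<bar>\<Lambda>\<bar>" unfolding f_def using K by auto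
    qed
  qed
  have le: "mean_log_growth E n / real n \<le> (\<integral>x. f n x \<partial>\<mu>) + \<Lambda>" if "0 < n" for n
  proof -
    have "mean_log_growth E n / real n = (\<integral>x. ln (normA E n x) / real n \<partial>\<mu>)"
      by (simp add: mean_log_growth_def)
    also have "\<dots> \<le> (\<integral>x. f n x + \<Lambda> \<partial>\<mu>)"
      using that by (intro integral_mono integrable_continuous continuous_intros cf continuous_ln_growth)
        (auto simp: f_def)
    also have "\<dots> = (\<integral>x. f n x \<partial>\<mu>) + \<Lambda>"
      using integrable_continuous[OF cf] by (simp add: prob_space)
    finally show ?thesis .
  qed
  have "(\<lambda>n. (\<integral>x. f n x \<partial>\<mu>) + \<Lambda>) \<longlonglongrightarrow> 0 + \<Lambda>"
    using lim by (intro tendsto_intros) simp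
  then show ?thesis
    using LIMSEQ_le[OF lyapunov_converges, of "\<lambda>n. (\<integral>x. f n x \<partial>\<mu>) + \<Lambda>" "0 + \<Lambda>"] le
    by (metis add_0 less_le_trans zero_less_one)
qed

text \<open>
  Only real \<open>t\<close> in the interval that contains the zeros matter, so inequalities between distances
  to this interval become inequalities for \<open>L\<close>. The next three lemmas insert particular energies.
\<close>

lemma lyapunov_compare:
  assumes M: "\<And>x. \<bar>v x\<bar> \<le> M" and c: "0 < c"
    and le: "\<And>t. \<bar>t\<bar> \<le> M + 2 \<Longrightarrow> c * cmod (z - of_real t) \<le> cmod (w - of_real t)"
  shows "L z + ln c \<le> L w"
proof (rule field_le_epsilon)
  fix e :: real assume "0 < e"
  then have "L w < L w + e" by simp
  then obtain C where C: "0 < C" "\<And>n x. normA w n x \<le> C * exp ((L w + e) * real n)"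
    using growth_upper by blast
  let ?D = "4 * max 1 (c\<^sup>2) * C"
  have "normA z n x \<le> ?D * exp ((L w + e - ln c) * real n)" for n x
  proof -
    have cn: "c ^ n = exp (ln c * real n)" using c by (simp add: exp_of_nat2_mult)
    have "c ^ n * normA z n x \<le> 4 * max 1 (c\<^sup>2) * normA w n x"
      by (rule growth_compare[OF M c le])
    also have "\<dots> \<le> 4 * max 1 (c\<^sup>2) * (C * exp ((L w + e) * real n))"
      using C(2) by (intro mult_left_mono) auto
    also have "\<dots> = c ^ n * (?D * exp ((L w + e - ln c) * real n))"
      by (simp add: cn algebra_simps exp_add[symmetric] exp_diff)
    finally show ?thesis using c by simp
  qed
  then have "L z \<le> L w + e - ln c"
    using C(1) by (intro lyapunov_leI[of ?D]) (auto intro: mult_pos_pos)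
  then show "L z + ln c \<le> L w + e" by simp
qed

lemma lyapunov_mono_imaginary:
  assumes "\<bar>b\<bar> \<le> \<bar>b'\<bar>"
  shows "L (Complex a b) \<le> L (Complex a b')"
proof -
  obtain M where M: "\<And>x. \<bar>v x\<bar> \<le> M" "0 < M" using v_bounded by blast
  have "L (Complex a b) + ln 1 \<le> L (Complex a b')"
    using assms by (intro lyapunov_compare[OF M(1)])
      (auto simp: cmod_def abs_le_square_iff)
  then show ?thesis by simp
qed

lemma lyapunov_strict_imaginary:
  assumes M: "\<And>x. \<bar>v x\<bar> \<le> M" and R: "0 < R" "\<bar>a\<bar> + M + 2 \<le> R" and d: "0 \<le> d" "d \<le> \<bar>b\<bar>"
  shows "L (of_real a) + ln (sqrt (1 + d\<^sup>2 / R\<^sup>2)) \<le> L (Complex a b)"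
proof (rule lyapunov_compare[OF M])
  show "0 < sqrt (1 + d\<^sup>2 / R\<^sup>2)" by (simp add: add_pos_nonneg)
  fix t :: real assume t: "\<bar>t\<bar> \<le> M + 2"
  have "\<bar>a - t\<bar> \<le> \<bar>R\<bar>" using t R by linarith
  then have "(a - t)\<^sup>2 \<le> R\<^sup>2" by (simp add: abs_le_square_iff)
  moreover have "d\<^sup>2 \<le> b\<^sup>2" using d by (simp add: abs_le_square_iff[symmetric])
  ultimately have "(a - t)\<^sup>2 * d\<^sup>2 \<le> R\<^sup>2 * b\<^sup>2" by (intro mult_mono) auto
  then have "(1 + d\<^sup>2 / R\<^sup>2) * (a - t)\<^sup>2 \<le> (a - t)\<^sup>2 + b\<^sup>2"
    using R by (simp add: field_simps)
  moreover have "cmod (of_real a - of_real t) = sqrt ((a - t)\<^sup>2)"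
    by (simp flip: of_real_diff)
  ultimately show "sqrt (1 + d\<^sup>2 / R\<^sup>2) * cmod (of_real a - of_real t) \<le> cmod (Complex a b - of_real t)"
    by (simp add: cmod_def real_sqrt_mult[symmetric] del: real_sqrt_abs)
qed

lemma lyapunov_ratio_imaginary:
  assumes "0 < b'" "b' \<le> b"
  shows "L (Complex a b) \<le> L (Complex a b') + ln (b / b')"
proof -
  obtain M where M: "\<And>x. \<bar>v x\<bar> \<le> M" "0 < M" using v_bounded by blast
  have "L (Complex a b) + ln (b' / b) \<le> L (Complex a b')"
  proof (rule lyapunov_compare[OF M(1)])
    show "0 < b' / b" using assms by simp
    fix t :: real
    have "b'\<^sup>2 \<le> b\<^sup>2" using assms by simp
    then have "b'\<^sup>2 * ((a - t)\<^sup>2 + b\<^sup>2) \<le> b\<^sup>2 * ((a - t)\<^sup>2 + b'\<^sup>2)"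
      by (simp add: ring_distribs mult_right_mono)
    then have "sqrt (b'\<^sup>2 * ((a - t)\<^sup>2 + b\<^sup>2)) \<le> sqrt (b\<^sup>2 * ((a - t)\<^sup>2 + b'\<^sup>2))"
      by (rule real_sqrt_le_mono)
    then have "b' * sqrt ((a - t)\<^sup>2 + b\<^sup>2) \<le> b * sqrt ((a - t)\<^sup>2 + b'\<^sup>2)"
      using assms by (simp add: real_sqrt_mult)
    then show "b' / b * cmod (Complex a b - of_real t) \<le> cmod (Complex a b' - of_real t)"
      using assms by (simp add: cmod_def field_simps)
  qed
  moreover have "ln (b' / b) = - ln (b / b')" using assms by (simp add: ln_div)
  ultimately show ?thesis by simp
qed

lemma lyapunov_ge_ln_imaginary:
  assumes "1 \<le> b"
  shows "ln b \<le> L (Complex a b)"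
proof (rule lyapunov_geI[of 1])
  obtain M where M: "\<And>x. \<bar>v x\<bar> \<le> M" "0 < M" using v_bounded by blast
  fix n x
  have "b ^ n \<le> cmod (fundsol (\<lambda>j. v ((T ^^ j) x)) (Complex a b) (Suc n))"
    using assms abs_Im_le_cmod[of "Complex a b - of_real _"] by (intro fundsol_lower[of _ M] M) auto
  also have "\<dots> \<le> normA (Complex a b) n x" by (rule fundsol_le_growth)
  finally show "1 * exp (ln b * real n) \<le> normA (Complex a b) n x"
    using assms by (simp add: exp_of_nat2_mult)
qed simp

lemma lyapunov_le_ln_bound:
  assumes M: "\<And>x. \<bar>v x\<bar> \<le> M"
  shows "L E \<le> ln (M + cmod E + 2)"
proof (rule lyapunov_leI[of 2])
  fix n x
  have "0 < M + cmod E + 2" using M[of x] norm_ge_zero[of E] by linarith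
  then show "normA E n x \<le> 2 * exp (ln (M + cmod E + 2) * real n)"
    using growth_le_power[of v M T E n x] M by (simp add: exp_of_nat2_mult)
qed simp

text \<open>
  Each \<open>mean_log_growth E n / n\<close> is continuous in \<open>E\<close> and bounds \<open>L\<close> from above.
\<close>

lemma lyapunov_upper_semicontinuous:
  assumes "E \<longlonglongrightarrow> E0" and "L E0 < g"
  shows "\<forall>\<^sub>F k in sequentially. L (E k) < g"
proof -
  interpret prob_space \<mu> by (rule prob_\<mu>)
  obtain M where M: "\<And>x. \<bar>v x\<bar> \<le> M" "0 < M" using v_bounded by blast
  have "eventually (\<lambda>n. mean_log_growth E0 n / real n < g \<and> 0 < n) sequentially"
    using order_tendstoD(2)[OF lyapunov_converges assms(2)] eventually_gt_at_top[of 0]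
    by (rule eventually_conj)
  then obtain N where N: "0 < N" "mean_log_growth E0 N / real N < g"
    by (auto simp: eventually_sequentially)
  obtain B where B: "\<And>k. cmod (E k) \<le> B" "0 < B"
    using convergent_imp_Bseq[of E] assms(1) unfolding Bseq_def convergent_def by blast
  define K where "K = M + B + 2"
  have entry: "(\<lambda>k. transfer_matrix T v (E k) n x $ i $ j) \<longlonglongrightarrow> transfer_matrix T v E0 n x $ i $ j" for n x i j
  proof (induction n arbitrary: i j)
    case (Suc n)
    have "(\<lambda>k. schrodinger_matrix v (E k) y $ i $ l) \<longlonglongrightarrow> schrodinger_matrix v E0 y $ i $ l" for i l y
      using exhaust_2[of i] exhaust_2[of l]
      by (auto simp: schrodinger_matrix_def intro!: tendsto_diff tendsto_const assms(1))
    then show ?case using Suc by (simp add: matrix_matrix_mult_def sum_2 tendsto_add tendsto_mult)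
  qed simp
  have "(\<lambda>k. mean_log_growth (E k) N) \<longlonglongrightarrow> mean_log_growth E0 N"
    unfolding mean_log_growth_def
  proof (rule integral_dominated_convergence[where w = "\<lambda>_. ln 2 + \<bar>ln (2 * K ^ N)\<bar>"])
    show "AE x in \<mu>. (\<lambda>k. ln (normA (E k) N x)) \<longlonglongrightarrow> ln (normA E0 N x)"
    proof (rule AE_I2, rule tendsto_ln)
      fix x
      show "(\<lambda>k. normA (E k) N x) \<longlonglongrightarrow> normA E0 N x" unfolding growth_def by (intro tendsto_matnorm entry)
      show "normA E0 N x \<noteq> 0" using growth_pos[of T v E0 N x] by simp
    qed
    show "AE x in \<mu>. norm (ln (normA (E k) N x)) \<le> ln 2 + \<bar>ln (2 * K ^ N)\<bar>" for k
    proof (rule AE_I2)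
      fix x
      have "normA (E k) N x \<le> 2 * (M + cmod (E k) + 2) ^ N" by (rule growth_le_power[OF M(1)])
      also have "\<dots> \<le> 2 * K ^ N"
        unfolding K_def using M(2) B(1)[of k] by (intro mult_left_mono power_mono) auto
      finally have "ln (normA (E k) N x) \<le> ln (2 * K ^ N)" using growth_pos by (intro ln_mono) auto
      moreover have "- ln 2 \<le> ln (normA (E k) N x)"
        using ln_mono[of "1/2" "normA (E k) N x"] growth_ge_half[of T v "E k" N x] growth_pos[of T v "E k" N x]
        by (simp add: ln_div)
      moreover have "0 < ln (2::real)" by (rule ln_gt_zero) simp
      ultimately show "norm (ln (normA (E k) N x)) \<le> ln 2 + \<bar>ln (2 * K ^ N)\<bar>"
        unfolding real_norm_def by linarith
    qed
  qed (auto intro: measurable_continuous continuous_ln_growth)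
  then have "(\<lambda>k. mean_log_growth (E k) N / real N) \<longlonglongrightarrow> mean_log_growth E0 N / real N"
    using N by (intro tendsto_intros) auto
  then have "\<forall>\<^sub>F k in sequentially. mean_log_growth (E k) N / real N < g"
    using N(2) by (rule order_tendstoD(2))
  then show ?thesis
    by (rule eventually_mono) (use lyapunov_le_mean[OF N(1)] le_less_trans in blast)
qed

end

section \<open>Square-summable sequences and the Combes--Thomas estimate\<close>

text \<open>
  Membership and norm bounds are proved on finite sets, where \<open>L2_set\<close> provides Minkowski's inequality.
\<close>

lemma l2I:
  assumes "\<And>F. finite F \<Longrightarrow> L2_set (\<lambda>n. cmod (u n)) F \<le> c" and "0 \<le> c"
  shows "u \<in> l2" and "l2_norm u \<le> c"
proof -
  have le: "(\<Sum>n\<in>F. (cmod (u n))\<^sup>2) \<le> c\<^sup>2" if "finite F" for F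
  proof -
    have "(L2_set (\<lambda>n. cmod (u n)) F)\<^sup>2 \<le> c\<^sup>2"
      using assms that by (intro power_mono L2_set_nonneg) auto
    then show ?thesis by (simp add: L2_set_def sum_nonneg)
  qed
  have "(\<lambda>n. (cmod (u n))\<^sup>2) summable_on UNIV"
    using le by (intro nonneg_bdd_above_summable_on bdd_aboveI2[of _ _ "c\<^sup>2"]) auto
  then show "u \<in> l2" by (simp add: l2_def)
  then have "(\<Sum>\<^sub>\<infinity>n. (cmod (u n))\<^sup>2) \<le> c\<^sup>2"
    using le by (intro infsum_le_finite_sums) (auto simp: l2_def)
  then show "l2_norm u \<le> c"
    unfolding l2_norm_def using assms(2) by (simp add: real_le_lsqrt infsum_nonneg)
qed

lemma L2_set_le_l2_norm:
  assumes "u \<in> l2" "finite F"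
  shows "L2_set (\<lambda>n. cmod (u n)) F \<le> l2_norm u"
  unfolding L2_set_def l2_norm_def
  using assms by (intro real_sqrt_le_mono finite_sum_le_infsum) (auto simp: l2_def)

lemma l2_norm_nonneg: "0 \<le> l2_norm u"
  unfolding l2_norm_def by (simp add: infsum_nonneg)

lemma cmod_le_l2_norm: "u \<in> l2 \<Longrightarrow> cmod (u n) \<le> l2_norm u"
  using L2_set_le_l2_norm[of u "{n}"] by simp

lemma l2_add:
  assumes "u \<in> l2" "w \<in> l2"
  shows "(\<lambda>n. u n + w n) \<in> l2" and "l2_norm (\<lambda>n. u n + w n) \<le> l2_norm u + l2_norm w"
proof -
  have *: "L2_set (\<lambda>n. cmod (u n + w n)) F \<le> l2_norm u + l2_norm w" if F: "finite F" for F
  proof -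
    have "L2_set (\<lambda>n. cmod (u n + w n)) F \<le> L2_set (\<lambda>n. cmod (u n) + cmod (w n)) F"
      by (intro L2_set_mono norm_triangle_ineq) auto
    also have "\<dots> \<le> L2_set (\<lambda>n. cmod (u n)) F + L2_set (\<lambda>n. cmod (w n)) F"
      by (rule L2_set_triangle_ineq)
    finally show ?thesis using L2_set_le_l2_norm[OF assms(1) F] L2_set_le_l2_norm[OF assms(2) F] by linarith
  qed
  show "(\<lambda>n. u n + w n) \<in> l2" "l2_norm (\<lambda>n. u n + w n) \<le> l2_norm u + l2_norm w"
    using l2I[of "\<lambda>n. u n + w n", OF *] l2_norm_nonneg[of u] l2_norm_nonneg[of w] by auto
qed

lemma l2_mult:
  assumes "u \<in> l2" "\<And>n. cmod (b n) \<le> B"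
  shows "(\<lambda>n. b n * u n) \<in> l2" and "l2_norm (\<lambda>n. b n * u n) \<le> B * l2_norm u"
proof -
  have B: "0 \<le> B" using assms(2)[of 0] norm_ge_zero order_trans by blast
  have *: "L2_set (\<lambda>n. cmod (b n * u n)) F \<le> B * l2_norm u" if F: "finite F" for F
  proof -
    have "L2_set (\<lambda>n. cmod (b n * u n)) F \<le> L2_set (\<lambda>n. B * cmod (u n)) F"
      unfolding norm_mult by (intro L2_set_mono mult_right_mono assms(2)) auto
    also have "\<dots> = B * L2_set (\<lambda>n. cmod (u n)) F" by (simp add: L2_set_right_distrib B)
    also have "\<dots> \<le> B * l2_norm u" by (intro mult_left_mono L2_set_le_l2_norm assms(1) F B)
    finally show ?thesis .
  qed
  show "(\<lambda>n. b n * u n) \<in> l2" "l2_norm (\<lambda>n. b n * u n) \<le> B * l2_norm u"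
    using l2I[of "\<lambda>n. b n * u n", OF *] l2_norm_nonneg[of u] B by auto
qed

lemma l2_scale:
  assumes "u \<in> l2"
  shows "(\<lambda>n. a * u n) \<in> l2" and "l2_norm (\<lambda>n. a * u n) \<le> cmod a * l2_norm u"
  using l2_mult[OF assms, of "\<lambda>_. a" "cmod a"] by auto

lemma l2_shift:
  assumes "u \<in> l2"
  shows "(\<lambda>n. u (n + k)) \<in> l2" and "l2_norm (\<lambda>n. u (n + k)) \<le> l2_norm u"
proof -
  have *: "L2_set (\<lambda>n. cmod (u (n + k))) F \<le> l2_norm u" if F: "finite F" for F
  proof -
    have "L2_set (\<lambda>n. cmod (u (n + k))) F = L2_set (\<lambda>n. cmod (u n)) ((\<lambda>n. n + k) ` F)"
      unfolding L2_set_def by (subst sum.reindex) auto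
    then show ?thesis using L2_set_le_l2_norm[OF assms, of "(\<lambda>n. n + k) ` F"] F by simp
  qed
  show "(\<lambda>n. u (n + k)) \<in> l2" "l2_norm (\<lambda>n. u (n + k)) \<le> l2_norm u"
    using l2I[of "\<lambda>n. u (n + k)", OF *] l2_norm_nonneg[of u] by auto
qed

lemma l2_mult_shift:
  assumes "u \<in> l2" "\<And>n. cmod (b n) \<le> B" "l2_norm u \<le> c"
  shows "(\<lambda>n. b n * u (n + k)) \<in> l2" and "l2_norm (\<lambda>n. b n * u (n + k)) \<le> B * c"
proof -
  have B: "0 \<le> B" using assms(2)[of 0] norm_ge_zero order_trans by blast
  show "(\<lambda>n. b n * u (n + k)) \<in> l2" by (intro l2_mult(1)[OF l2_shift(1)[OF assms(1)] assms(2)])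
  have "l2_norm (\<lambda>n. b n * u (n + k)) \<le> B * l2_norm (\<lambda>n. u (n + k))"
    by (intro l2_mult(2)[OF l2_shift(1)[OF assms(1)] assms(2)])
  also have "\<dots> \<le> B * c"
    by (intro mult_left_mono order_trans[OF l2_shift(2)[OF assms(1)] assms(3)] B)
  finally show "l2_norm (\<lambda>n. b n * u (n + k)) \<le> B * c" .
qed

definition delta :: "int \<Rightarrow> int \<Rightarrow> complex" where
  "delta m n = of_bool (n = m)"

lemma l2_delta: "delta m \<in> l2" and l2_norm_delta: "l2_norm (delta m) \<le> 1"
proof -
  have *: "L2_set (\<lambda>n. cmod (delta m n)) F \<le> 1" if "finite F" for F
  proof -
    have "(\<Sum>n\<in>F. (cmod (delta m n))\<^sup>2) = (\<Sum>n\<in>F. if n = m then 1 else 0)"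
      by (intro sum.cong) (auto simp: delta_def)
    also have "\<dots> \<le> 1" using that by simp
    finally show ?thesis by (simp add: L2_set_def)
  qed
  show "delta m \<in> l2" "l2_norm (delta m) \<le> 1" using l2I[of "delta m", OF *] by auto
qed

lemma sum_power_le_geometric:
  fixes r :: real
  assumes "0 \<le> r" "r < 1" "finite F"
  shows "(\<Sum>k\<in>F. r ^ k) \<le> 1 / (1 - r)"
  using sum_le_suminf[OF summable_geometric[of r] assms(3)] assms suminf_geometric[of r] by simp

lemma sum_exp_abs_le:
  fixes F :: "int set" and \<kappa> :: real
  assumes \<kappa>: "0 < \<kappa>" and F: "finite F"
  shows "(\<Sum>n\<in>F. exp (- \<kappa> * \<bar>real_of_int (n - m)\<bar>)) \<le> 2 / (1 - exp (- \<kappa>))"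
proof -
  let ?f = "\<lambda>n. exp (- \<kappa> * \<bar>real_of_int (n - m)\<bar>)" and ?r = "exp (- \<kappa>)"
  have r: "0 \<le> ?r" "?r < 1" using \<kappa> by auto
  let ?P = "{n\<in>F. m \<le> n}" and ?N = "{n\<in>F. n < m}"
  have pw: "?f n = ?r ^ nat \<bar>n - m\<bar>" for n
    by (simp add: exp_of_nat_mult[symmetric] mult.commute)
  have P: "(\<Sum>n\<in>?P. ?f n) \<le> 1 / (1 - ?r)"
  proof -
    have "inj_on (\<lambda>n. nat \<bar>n - m\<bar>) ?P" by (auto simp: inj_on_def)
    then have "(\<Sum>n\<in>?P. ?f n) = (\<Sum>k\<in>(\<lambda>n. nat \<bar>n - m\<bar>) ` ?P. ?r ^ k)"
      unfolding pw by (subst sum.reindex) auto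
    also have "\<dots> \<le> 1 / (1 - ?r)" using F by (intro sum_power_le_geometric r) auto
    finally show ?thesis .
  qed
  have N: "(\<Sum>n\<in>?N. ?f n) \<le> 1 / (1 - ?r)"
  proof -
    have "inj_on (\<lambda>n. nat \<bar>n - m\<bar>) ?N" by (auto simp: inj_on_def)
    then have "(\<Sum>n\<in>?N. ?f n) = (\<Sum>k\<in>(\<lambda>n. nat \<bar>n - m\<bar>) ` ?N. ?r ^ k)"
      unfolding pw by (subst sum.reindex) auto
    also have "\<dots> \<le> 1 / (1 - ?r)" using F by (intro sum_power_le_geometric r) auto
    finally show ?thesis .
  qed
  have "F = ?P \<union> ?N" by auto
  then have "(\<Sum>n\<in>F. ?f n) = (\<Sum>n\<in>?P \<union> ?N. ?f n)" by simp
  also have "\<dots> = (\<Sum>n\<in>?P. ?f n) + (\<Sum>n\<in>?N. ?f n)"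
    using F by (intro sum.union_disjoint) auto
  finally show ?thesis using P N by simp
qed

lemma l2_of_exp_decay:
  assumes "0 < \<kappa>" and dec: "\<And>n. cmod (u n) \<le> C * exp (- \<kappa> * \<bar>real_of_int (n - m)\<bar>)"
  shows "u \<in> l2"
proof -
  let ?S = "2 / (1 - exp (- \<kappa>))"
  have C: "0 \<le> C" using order_trans[OF norm_ge_zero dec[of m]] by simp
  have S: "0 \<le> ?S" using assms(1) by simp
  have "L2_set (\<lambda>n. cmod (u n)) F \<le> C * ?S" if F: "finite F" for F
  proof -
    have "L2_set (\<lambda>n. cmod (u n)) F \<le> (\<Sum>n\<in>F. cmod (u n))" by (rule L2_set_le_sum) simp
    also have "\<dots> \<le> (\<Sum>n\<in>F. C * exp (- \<kappa> * \<bar>real_of_int (n - m)\<bar>))" by (intro sum_mono dec)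
    also have "\<dots> \<le> C * ?S"
      unfolding sum_distrib_left[symmetric] by (intro mult_left_mono sum_exp_abs_le assms(1) F C)
    finally show ?thesis .
  qed
  then show ?thesis using C S by (intro l2I[of u "C * ?S"]) auto
qed

text \<open>
  The operator \<open>H(g) - E\<close> for an arbitrary potential on the integers.
\<close>

definition hn_op :: "real \<Rightarrow> (int \<Rightarrow> real) \<Rightarrow> complex \<Rightarrow> (int \<Rightarrow> complex) \<Rightarrow> (int \<Rightarrow> complex)" where
  "hn_op g q E u = (\<lambda>n. - of_real (exp g) * u (n + 1) - of_real (exp (- g)) * u (n - 1)
     + (of_real (q n) - E) * u n)"

lemma hn_op_l2:
  assumes q: "\<And>n. \<bar>q n\<bar> \<le> M" and u: "u \<in> l2"
  shows "hn_op g q E u \<in> l2"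
    and "l2_norm (hn_op g q E u) \<le> (exp g + exp (- g) + M + cmod E) * l2_norm u"
proof -
  have 1: "(\<lambda>n. - of_real (exp g) * u (n + 1)) \<in> l2"
    "l2_norm (\<lambda>n. - of_real (exp g) * u (n + 1)) \<le> exp g * l2_norm u"
    using l2_mult_shift[OF u, of "\<lambda>_. - of_real (exp g)" "exp g" "l2_norm u" 1] by auto
  have 2: "(\<lambda>n. - of_real (exp (- g)) * u (n - 1)) \<in> l2"
    "l2_norm (\<lambda>n. - of_real (exp (- g)) * u (n - 1)) \<le> exp (- g) * l2_norm u"
    using l2_mult_shift[OF u, of "\<lambda>_. - of_real (exp (- g))" "exp (- g)" "l2_norm u" "-1"] by auto
  have "cmod (of_real (q n) - E) \<le> M + cmod E" for n
    using norm_triangle_ineq4[of "of_real (q n)" E] q[of n] by simp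
  then have 3: "(\<lambda>n. (of_real (q n) - E) * u n) \<in> l2"
    "l2_norm (\<lambda>n. (of_real (q n) - E) * u n) \<le> (M + cmod E) * l2_norm u"
    using l2_mult[OF u, of "\<lambda>n. of_real (q n) - E" "M + cmod E"] by auto
  have eq: "hn_op g q E u = (\<lambda>n. (- of_real (exp g) * u (n + 1) + - of_real (exp (- g)) * u (n - 1))
      + (of_real (q n) - E) * u n)"
    by (simp add: hn_op_def fun_eq_iff)
  show "hn_op g q E u \<in> l2" unfolding eq by (intro l2_add 1 2 3)
  have "l2_norm (hn_op g q E u) \<le> (l2_norm (\<lambda>n. - of_real (exp g) * u (n + 1))
      + l2_norm (\<lambda>n. - of_real (exp (- g)) * u (n - 1))) + l2_norm (\<lambda>n. (of_real (q n) - E) * u n)"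
    unfolding eq by (intro order_trans[OF l2_add(2)] add_right_mono l2_add 1 2 3)
  then show "l2_norm (hn_op g q E u) \<le> (exp g + exp (- g) + M + cmod E) * l2_norm u"
    using 1(2) 2(2) 3(2) by (simp add: ring_distribs)
qed

text \<open>
  Bounded from below with constant \<open>1/C\<close>. For the self-adjoint case \<open>g = 0\<close> this already gives
  invertibility, see \<open>green_kernel_of_coercive\<close> below.
\<close>

definition coercive :: "real \<Rightarrow> (int \<Rightarrow> real) \<Rightarrow> complex \<Rightarrow> real \<Rightarrow> bool" where
  "coercive g q E C \<longleftrightarrow> 0 < C \<and> (\<forall>u\<in>l2. l2_norm u \<le> C * l2_norm (hn_op g q E u))"

lemma coercive_perturb:
  assumes C: "coercive g q E C" and q: "\<And>n. \<bar>q n\<bar> \<le> M" and close: "C * cmod (E - E') \<le> 1/2"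
  shows "coercive g q E' (2 * C)"
  unfolding coercive_def
proof (intro conjI ballI)
  show "0 < 2 * C" using C by (simp add: coercive_def)
  fix u assume u: "u \<in> l2"
  have "hn_op g q E u = (\<lambda>n. hn_op g q E' u n + (E' - E) * u n)"
    by (simp add: hn_op_def fun_eq_iff algebra_simps)
  then have "l2_norm (hn_op g q E u) \<le> l2_norm (hn_op g q E' u) + cmod (E - E') * l2_norm u"
    using l2_add(2)[OF hn_op_l2(1)[of q M u g E', OF q u] l2_scale(1)[OF u, of "E' - E"]]
      l2_scale(2)[OF u, of "E' - E"] by (simp add: norm_minus_commute)
  then have "C * l2_norm (hn_op g q E u) \<le> C * l2_norm (hn_op g q E' u) + C * cmod (E - E') * l2_norm u"
    using C mult_left_mono[of "l2_norm (hn_op g q E u)" "l2_norm (hn_op g q E' u) + cmod (E - E') * l2_norm u" C]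
    by (simp add: coercive_def distrib_left mult.assoc)
  moreover have "C * cmod (E - E') * l2_norm u \<le> 1/2 * l2_norm u"
    using close l2_norm_nonneg by (intro mult_right_mono)
  moreover have "l2_norm u \<le> C * l2_norm (hn_op g q E u)" using C u by (simp add: coercive_def)
  ultimately show "l2_norm u \<le> 2 * C * l2_norm (hn_op g q E' u)" by linarith
qed

text \<open>
  Conjugating by the weight \<open>exp (\<kappa> min |j - m| N)\<close> perturbs the operator by a term of norm at most
  \<open>(exp \<kappa> - 1) (exp g + exp (- g))\<close>, which the lower bound absorbs. The truncation at \<open>N\<close> keeps the weight
  bounded, so that the weighted sequence is square-summable; the estimate does not depend on \<open>N\<close>.
\<close>

lemma combes_thomas:
  assumes C: "coercive g q E C" and q: "\<And>n. \<bar>q n\<bar> \<le> M"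
    and \<kappa>: "0 < \<kappa>" "C * ((exp \<kappa> - 1) * (exp g + exp (- g))) \<le> 1/2"
    and u: "u \<in> l2" "hn_op g q E u = delta m"
  shows "cmod (u n) \<le> 2 * C * exp (- \<kappa> * \<bar>real_of_int (n - m)\<bar>)"
proof -
  (* The truncation level is the distance of the site n at which the bound is claimed. *)
  define N where "N = \<bar>real_of_int (n - m)\<bar>"
  define \<rho> where "\<rho> j = exp (\<kappa> * min \<bar>real_of_int (j - m)\<bar> N)" for j
  have C0: "0 < C" using C by (simp add: coercive_def)
  have \<rho>pos: "0 < \<rho> j" for j by (simp add: \<rho>_def)
  have \<rho>bd: "\<rho> j \<le> exp (\<kappa> * N)" for j unfolding \<rho>_def using \<kappa> by simp
  have step: "\<bar>\<rho> j - \<rho> i\<bar> \<le> (exp \<kappa> - 1) * \<rho> j" if "\<bar>i - j\<bar> = 1" for i j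
  proof -
    let ?a = "\<kappa> * min \<bar>real_of_int (i - m)\<bar> N" and ?b = "\<kappa> * min \<bar>real_of_int (j - m)\<bar> N"
    have "\<bar>real_of_int (i - j)\<bar> = 1" using that by (metis of_int_1 of_int_abs)
    then have "\<bar>min \<bar>real_of_int (i - m)\<bar> N - min \<bar>real_of_int (j - m)\<bar> N\<bar> \<le> 1"
      by (simp add: min_def) linarith
    then have "\<kappa> * \<bar>min \<bar>real_of_int (i - m)\<bar> N - min \<bar>real_of_int (j - m)\<bar> N\<bar> \<le> \<kappa> * 1"
      using \<kappa> by (intro mult_left_mono) auto
    then have d: "\<bar>?a - ?b\<bar> \<le> \<kappa>"
      using \<kappa> by (simp add: abs_mult flip: right_diff_distrib)
    have "exp (?a - ?b) \<le> exp \<kappa>" using d by simp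
    moreover have "1 - exp (?a - ?b) \<le> exp \<kappa> - 1"
    proof -
      have "2 \<le> exp (?a - ?b) + exp \<kappa>"
        using exp_ge_add_one_self[of "?a - ?b"] exp_ge_add_one_self[of \<kappa>] d by linarith
      then show ?thesis by simp
    qed
    ultimately have "\<bar>1 - exp (?a - ?b)\<bar> \<le> exp \<kappa> - 1" by linarith
    then have "\<rho> j * \<bar>1 - exp (?a - ?b)\<bar> \<le> \<rho> j * (exp \<kappa> - 1)"
      using \<rho>pos[of j] by (intro mult_left_mono) auto
    moreover have "\<rho> j * \<bar>1 - exp (?a - ?b)\<bar> = \<bar>\<rho> j - \<rho> i\<bar>"
    proof -
      have "\<rho> j * exp (?a - ?b) = \<rho> i" unfolding \<rho>_def by (simp flip: exp_add)
      then have "\<rho> j * (1 - exp (?a - ?b)) = \<rho> j - \<rho> i" by (simp add: algebra_simps)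
      then show ?thesis using \<rho>pos[of j] by (metis abs_mult abs_of_pos)
    qed
    ultimately show ?thesis by (simp add: mult.commute)
  qed
  define w where "w j = of_real (\<rho> j) * u j" for j
  have wl2: "w \<in> l2"
    unfolding w_def using \<rho>pos \<rho>bd less_imp_le by (intro l2_mult(1)[OF u(1), of _ "exp (\<kappa> * N)"]) (simp add: abs_of_pos)
  (* Relative increments of the weight, so that the commutator acts on the weighted sequence w itself. *)
  define c1 c2 :: "int \<Rightarrow> complex"
    where "c1 j = of_real ((\<rho> (j + 1) - \<rho> j) / \<rho> (j + 1))" and "c2 j = of_real ((\<rho> (j - 1) - \<rho> j) / \<rho> (j - 1))" for j
  have c1: "cmod (c1 j) \<le> exp \<kappa> - 1" for j
    unfolding c1_def norm_of_real abs_divide using step[of j "j + 1"] \<rho>pos[of "j + 1"]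
    by (simp add: divide_le_eq)
  have c2: "cmod (c2 j) \<le> exp \<kappa> - 1" for j
    unfolding c2_def norm_of_real abs_divide using step[of j "j - 1"] \<rho>pos[of "j - 1"]
    by (simp add: divide_le_eq)
  define e where "e j = - of_real (exp g) * (c1 j * w (j + 1)) + - of_real (exp (- g)) * (c2 j * w (j + -1))" for j
  have 1: "(\<lambda>j. c1 j * w (j + 1)) \<in> l2" "l2_norm (\<lambda>j. c1 j * w (j + 1)) \<le> (exp \<kappa> - 1) * l2_norm w"
    using l2_mult_shift[of w c1 "exp \<kappa> - 1" "l2_norm w" 1, OF wl2 c1 order_refl] by auto
  have 2: "(\<lambda>j. c2 j * w (j + -1)) \<in> l2" "l2_norm (\<lambda>j. c2 j * w (j + -1)) \<le> (exp \<kappa> - 1) * l2_norm w"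
    using l2_mult_shift[of w c2 "exp \<kappa> - 1" "l2_norm w" "-1", OF wl2 c2 order_refl] by auto
  have e1: "(\<lambda>j. - of_real (exp g) * (c1 j * w (j + 1))) \<in> l2"
    "l2_norm (\<lambda>j. - of_real (exp g) * (c1 j * w (j + 1))) \<le> exp g * ((exp \<kappa> - 1) * l2_norm w)"
    using l2_mult_shift[where b = "\<lambda>_. - of_real (exp g)" and B = "exp g" and k = 0, OF 1(1) _ 1(2)] by auto
  have e2: "(\<lambda>j. - of_real (exp (- g)) * (c2 j * w (j + -1))) \<in> l2"
    "l2_norm (\<lambda>j. - of_real (exp (- g)) * (c2 j * w (j + -1))) \<le> exp (- g) * ((exp \<kappa> - 1) * l2_norm w)"
    using l2_mult_shift[where b = "\<lambda>_. - of_real (exp (- g))" and B = "exp (- g)" and k = 0, OF 2(1) _ 2(2)] by auto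
  have el2: "e \<in> l2" "l2_norm e \<le> ((exp \<kappa> - 1) * (exp g + exp (- g))) * l2_norm w"
    unfolding e_def using l2_add[OF e1(1) e2(1)] e1(2) e2(2) by (auto simp: algebra_simps)
  have eq: "hn_op g q E w = (\<lambda>j. delta m j + e j)"
  proof
    fix j
    have w1: "c1 j * w (j + 1) = of_real (\<rho> (j + 1) - \<rho> j) * u (j + 1)"
      using \<rho>pos[of "j + 1"] by (simp add: c1_def w_def)
    have w2: "c2 j * w (j + -1) = of_real (\<rho> (j - 1) - \<rho> j) * u (j - 1)"
      using \<rho>pos[of "j - 1"] by (simp add: c2_def w_def)
    have "hn_op g q E w j = of_real (\<rho> j) * hn_op g q E u j + e j"
      unfolding e_def w1 w2 by (simp add: hn_op_def w_def algebra_simps)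
    also have "of_real (\<rho> j) * hn_op g q E u j = delta m j"
      unfolding u(2) by (cases "j = m") (auto simp: delta_def \<rho>_def N_def)
    finally show "hn_op g q E w j = delta m j + e j" .
  qed
  have "l2_norm w \<le> C * l2_norm (hn_op g q E w)" using C wl2 by (simp add: coercive_def)
  also have "\<dots> \<le> C * (1 + ((exp \<kappa> - 1) * (exp g + exp (- g))) * l2_norm w)"
    unfolding eq using C0 l2_add(2)[OF l2_delta el2(1), of m] l2_norm_delta[of m] el2(2)
    by (intro mult_left_mono) auto
  also have "\<dots> = C + (C * ((exp \<kappa> - 1) * (exp g + exp (- g)))) * l2_norm w"
    by (simp add: algebra_simps)
  also have "\<dots> \<le> C + 1/2 * l2_norm w"
    using \<kappa>(2) l2_norm_nonneg by (intro add_left_mono mult_right_mono)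
  finally have "l2_norm w \<le> 2 * C" by simp
  then have "\<rho> n * cmod (u n) \<le> 2 * C"
    using cmod_le_l2_norm[OF wl2, of n] \<rho>pos[of n] by (simp add: w_def norm_mult)
  moreover have "\<rho> n = exp (\<kappa> * \<bar>real_of_int (n - m)\<bar>)" by (simp add: \<rho>_def N_def)
  ultimately show ?thesis by (simp add: exp_minus field_simps)
qed

lemma combes_thomas_rate_exists:
  fixes C g :: real
  assumes "0 < C"
  obtains \<kappa> where "0 < \<kappa>" and "C * ((exp \<kappa> - 1) * (exp g + exp (- g))) \<le> 1/2"
proof -
  have "((\<lambda>\<kappa>::real. C * ((exp \<kappa> - 1) * (exp g + exp (- g)))) \<longlongrightarrow> C * ((exp 0 - 1) * (exp g + exp (- g)))) (at_right 0)"
    by (intro tendsto_intros)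
  then have "eventually (\<lambda>\<kappa>. C * ((exp \<kappa> - 1) * (exp g + exp (- g))) < 1/2) (at_right 0)"
    by (rule order_tendstoD(2)) simp
  then obtain b :: real where b: "0 < b" "\<And>\<kappa>. 0 < \<kappa> \<Longrightarrow> \<kappa> < b \<Longrightarrow> C * ((exp \<kappa> - 1) * (exp g + exp (- g))) < 1/2"
    unfolding eventually_at_right_field by auto
  show thesis using that[of "b/2"] b(2)[of "b/2"] b(1) by auto
qed

section \<open>Green kernels and bounded inverses\<close>

definition l2_inverse :: "real \<Rightarrow> (int \<Rightarrow> real) \<Rightarrow> complex \<Rightarrow> ((int \<Rightarrow> complex) \<Rightarrow> (int \<Rightarrow> complex)) \<Rightarrow> bool" where
  "l2_inverse g q E R \<longleftrightarrow> l2_bounded_operator R \<and> (\<forall>u\<in>l2. R (hn_op g q E u) = u \<and> hn_op g q E (R u) = u)"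

text \<open>
  The gauge is removed: \<open>W\<close> inverts the operator with \<open>g = 0\<close> in either variable, and \<open>g\<close> appears in the
  growth bound only. For \<open>g > 0\<close> the bound forces decay to the left and allows growth to the right.
\<close>

definition green_kernel :: "real \<Rightarrow> (int \<Rightarrow> real) \<Rightarrow> complex \<Rightarrow> (int \<Rightarrow> int \<Rightarrow> complex) \<Rightarrow> real \<Rightarrow> real \<Rightarrow> bool" where
  "green_kernel g q E W C \<kappa> \<longleftrightarrow> 0 < C \<and> 0 < \<kappa> \<and>
     (\<forall>m n. - W m (n + 1) - W m (n - 1) + (of_real (q n) - E) * W m n = delta m n) \<and>
     (\<forall>m n. - W (m + 1) n - W (m - 1) n + (of_real (q m) - E) * W m n = delta m n) \<and>
     (\<forall>m n. cmod (W m n) \<le> C * exp (g * real_of_int (n - m) - \<kappa> * \<bar>real_of_int (n - m)\<bar>))"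

text \<open>
  Restores the gauge: the matrix of the resolvent of \<open>H(g)\<close>.
\<close>

definition tilt :: "real \<Rightarrow> (int \<Rightarrow> int \<Rightarrow> complex) \<Rightarrow> int \<Rightarrow> int \<Rightarrow> complex" where
  "tilt g W m n = of_real (exp (- g * real_of_int (n - m))) * W m n"

lemma tilt_shift:
  fixes g :: real and W :: "int \<Rightarrow> int \<Rightarrow> complex"
  defines "e m n \<equiv> of_real (exp (- g * real_of_int (n - m))) :: complex"
  shows "tilt g W m (n + 1) = of_real (exp (- g)) * e m n * W m (n + 1)"
    and "tilt g W m (n - 1) = of_real (exp g) * e m n * W m (n - 1)"
    and "tilt g W (m - 1) n = of_real (exp (- g)) * e m n * W (m - 1) n"
    and "tilt g W (m + 1) n = of_real (exp g) * e m n * W (m + 1) n"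
    and "tilt g W m n = e m n * W m n"
proof -
  have "exp (- g * real_of_int (n + 1 - m)) = exp (- g) * exp (- g * real_of_int (n - m))"
    "exp (- g * real_of_int (n - 1 - m)) = exp g * exp (- g * real_of_int (n - m))"
    "exp (- g * real_of_int (n - (m - 1))) = exp (- g) * exp (- g * real_of_int (n - m))"
    "exp (- g * real_of_int (n - (m + 1))) = exp g * exp (- g * real_of_int (n - m))"
    by (simp_all add: algebra_simps flip: exp_add)
  then show "tilt g W m (n + 1) = of_real (exp (- g)) * e m n * W m (n + 1)"
    "tilt g W m (n - 1) = of_real (exp g) * e m n * W m (n - 1)"
    "tilt g W (m - 1) n = of_real (exp (- g)) * e m n * W (m - 1) n"
    "tilt g W (m + 1) n = of_real (exp g) * e m n * W (m + 1) n"
    "tilt g W m n = e m n * W m n"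
    unfolding tilt_def e_def by (simp_all only: of_real_mult)
qed

lemma tilt_algebra:
  fixes a b e x y z d :: complex
  assumes "a * b = 1"
  shows "- a * (b * e * x) - b * (a * e * y) + d * (e * z) = e * (- x - y + d * z)"
  using assms by algebra

lemma exp_tilt_inverse: "of_real (exp g) * of_real (exp (- g)) = (1 :: complex)"
  by (simp flip: of_real_mult exp_add)

lemma hn_op_tilt: "hn_op g q E (tilt g W m) n
   = of_real (exp (- g * real_of_int (n - m))) * (- W m (n + 1) - W m (n - 1) + (of_real (q n) - E) * W m n)"
  unfolding hn_op_def tilt_shift(1,2) unfolding tilt_shift(5) by (rule tilt_algebra[OF exp_tilt_inverse])

lemma row_tilt: "- of_real (exp g) * tilt g W (m - 1) n - of_real (exp (- g)) * tilt g W (m + 1) n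
       + d * tilt g W m n
   = of_real (exp (- g * real_of_int (n - m))) * (- W (m + 1) n - W (m - 1) n + d * W m n)"
  unfolding tilt_shift(3,4) unfolding tilt_shift(5) tilt_algebra[OF exp_tilt_inverse] by simp

lemma green_kernel_tilt:
  assumes "green_kernel g q E W C \<kappa>"
  shows "hn_op g q E (tilt g W m) = delta m"
    and "- of_real (exp g) * tilt g W (m - 1) n - of_real (exp (- g)) * tilt g W (m + 1) n
       + (of_real (q m) - E) * tilt g W m n = delta m n"
    and "cmod (tilt g W m n) \<le> C * exp (- \<kappa> * \<bar>real_of_int (n - m)\<bar>)"
    and "tilt g W m \<in> l2"
proof -
  have G: "- W m (n + 1) - W m (n - 1) + (of_real (q n) - E) * W m n = delta m n"
    "- W (m + 1) n - W (m - 1) n + (of_real (q m) - E) * W m n = delta m n"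
    "cmod (W m n) \<le> C * exp (g * real_of_int (n - m) - \<kappa> * \<bar>real_of_int (n - m)\<bar>)" "0 < \<kappa>" for m n
    using assms by (auto simp: green_kernel_def)
  have d: "of_real (exp (- g * real_of_int (n - m))) * delta m n = delta m n" for m n
    by (cases "n = m") (auto simp: delta_def)
  show "hn_op g q E (tilt g W m) = delta m"
    unfolding fun_eq_iff hn_op_tilt G d by simp
  have "- of_real (exp g) * tilt g W (m - 1) n - of_real (exp (- g)) * tilt g W (m + 1) n
       + (of_real (q m) - E) * tilt g W m n
      = of_real (exp (- g * real_of_int (n - m))) * (- W (m + 1) n - W (m - 1) n + (of_real (q m) - E) * W m n)"
    by (rule row_tilt)
  then show "- of_real (exp g) * tilt g W (m - 1) n - of_real (exp (- g)) * tilt g W (m + 1) n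
       + (of_real (q m) - E) * tilt g W m n = delta m n" unfolding G d .
  show dec: "cmod (tilt g W m n) \<le> C * exp (- \<kappa> * \<bar>real_of_int (n - m)\<bar>)" for n
  proof -
    have "cmod (tilt g W m n) = exp (- g * real_of_int (n - m)) * cmod (W m n)"
      by (simp add: tilt_def norm_mult)
    also have "\<dots> \<le> exp (- g * real_of_int (n - m)) * (C * exp (g * real_of_int (n - m) - \<kappa> * \<bar>real_of_int (n - m)\<bar>))"
      by (intro mult_left_mono G) auto
    also have "\<dots> = C * (exp (- g * real_of_int (n - m)) * exp (g * real_of_int (n - m) - \<kappa> * \<bar>real_of_int (n - m)\<bar>))"
      by simp
    also have "\<dots> = C * exp (- \<kappa> * \<bar>real_of_int (n - m)\<bar>)" unfolding exp_add[symmetric] by simp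
    finally show ?thesis .
  qed
  show "tilt g W m \<in> l2" by (rule l2_of_exp_decay[OF G(4) dec])
qed

lemma l2_bounded_operatorD:
  assumes "l2_bounded_operator R"
  shows "u \<in> l2 \<Longrightarrow> R u \<in> l2"
    and "u \<in> l2 \<Longrightarrow> w \<in> l2 \<Longrightarrow> R (\<lambda>n. a * u n + b * w n) = (\<lambda>n. a * R u n + b * R w n)"
    and "\<exists>C>0. \<forall>u\<in>l2. l2_norm (R u) \<le> C * l2_norm u"
proof -
  show "u \<in> l2 \<Longrightarrow> R u \<in> l2"
    "u \<in> l2 \<Longrightarrow> w \<in> l2 \<Longrightarrow> R (\<lambda>n. a * u n + b * w n) = (\<lambda>n. a * R u n + b * R w n)"
    using assms by (auto simp: l2_bounded_operator_def)
  obtain C where C: "\<forall>u\<in>l2. l2_norm (R u) \<le> C * l2_norm u"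
    using assms by (auto simp: l2_bounded_operator_def)
  have "l2_norm (R u) \<le> max C 1 * l2_norm u" if "u \<in> l2" for u
  proof -
    have "l2_norm (R u) \<le> C * l2_norm u" using C that by blast
    also have "\<dots> \<le> max C 1 * l2_norm u" by (intro mult_right_mono l2_norm_nonneg) auto
    finally show ?thesis .
  qed
  then show "\<exists>C>0. \<forall>u\<in>l2. l2_norm (R u) \<le> C * l2_norm u"
    by (intro exI[of _ "max C 1"]) auto
qed

lemma coercive_of_inverse:
  assumes R: "l2_inverse g q E R" and q: "\<And>n. \<bar>q n\<bar> \<le> M"
  shows "\<exists>C. coercive g q E C"
proof -
  obtain C where C: "0 < C" "\<forall>u\<in>l2. l2_norm (R u) \<le> C * l2_norm u"
    using l2_bounded_operatorD(3) R unfolding l2_inverse_def by blast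
  have "l2_norm u \<le> C * l2_norm (hn_op g q E u)" if u: "u \<in> l2" for u
  proof -
    have "l2_norm (R (hn_op g q E u)) \<le> C * l2_norm (hn_op g q E u)"
      using C(2) hn_op_l2(1)[of q M u g E, OF q u] by blast
    then show ?thesis using R u by (simp add: l2_inverse_def)
  qed
  with C show ?thesis unfolding coercive_def by blast
qed

lemma hn_op_delta: "hn_op g q E (delta m)
   = (\<lambda>n. - of_real (exp g) * delta (m - 1) n + 1 * (- of_real (exp (- g)) * delta (m + 1) n + (of_real (q m) - E) * delta m n))"
  by (auto simp: hn_op_def delta_def fun_eq_iff algebra_simps)

text \<open>
  The columns of the inverse decay by the Combes--Thomas estimate. The equation in the first variable
  expresses that the inverse is also a left inverse, tested on unit vectors.
\<close>

lemma green_kernel_of_inverse: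
  assumes R: "l2_inverse g q E R" and q: "\<And>n. \<bar>q n\<bar> \<le> M"
  shows "\<exists>W C \<kappa>. green_kernel g q E W C \<kappa> \<and> (\<forall>m. tilt g W m = R (delta m))"
proof -
  have bo: "l2_bounded_operator R" using R by (simp add: l2_inverse_def)
  obtain C where C: "coercive g q E C" using coercive_of_inverse[OF R q] by blast
  then have "0 < C" by (simp add: coercive_def)
  then obtain \<kappa> where \<kappa>: "0 < \<kappa>" "C * ((exp \<kappa> - 1) * (exp g + exp (- g))) \<le> 1/2"
    using combes_thomas_rate_exists by blast
  have RK: "R (delta m) \<in> l2" "hn_op g q E (R (delta m)) = delta m" for m
    using l2_bounded_operatorD(1)[OF bo l2_delta] R l2_delta by (auto simp: l2_inverse_def)
  have dec: "cmod (R (delta m) n) \<le> 2 * C * exp (- \<kappa> * \<bar>real_of_int (n - m)\<bar>)" for m n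
    by (rule combes_thomas[OF C q \<kappa> RK])
  have row: "- of_real (exp g) * R (delta (m - 1)) n - of_real (exp (- g)) * R (delta (m + 1)) n
       + (of_real (q m) - E) * R (delta m) n = delta m n" for m n
  proof -
    have in2: "(\<lambda>n. - of_real (exp (- g)) * delta (m + 1) n + (of_real (q m) - E) * delta m n) \<in> l2"
      by (intro l2_add l2_scale l2_delta)
    have "R (hn_op g q E (delta m)) = delta m" using R l2_delta by (simp add: l2_inverse_def)
    then have "delta m n = R (\<lambda>n. - of_real (exp g) * delta (m - 1) n
        + 1 * (- of_real (exp (- g)) * delta (m + 1) n + (of_real (q m) - E) * delta m n)) n"
      unfolding hn_op_delta by metis
    also have "\<dots> = - of_real (exp g) * R (delta (m - 1)) n
        + 1 * (- of_real (exp (- g)) * R (delta (m + 1)) n + (of_real (q m) - E) * R (delta m) n)"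
      using l2_bounded_operatorD(2)[OF bo l2_delta in2] l2_bounded_operatorD(2)[OF bo l2_delta l2_delta] by metis
    finally show ?thesis by (simp add: algebra_simps)
  qed
  define W where "W m n = of_real (exp (g * real_of_int (n - m))) * R (delta m) n" for m n
  have tilt: "tilt g W m n = R (delta m) n" for m n
    unfolding tilt_def W_def by (simp flip: mult.assoc of_real_mult exp_add)
  have "green_kernel g q E W (2 * C) \<kappa>"
    unfolding green_kernel_def
  proof (intro conjI allI)
    fix m n
    let ?e = "of_real (exp (- g * real_of_int (n - m))) :: complex"
    have e: "?e \<noteq> 0" by simp
    have d: "?e * delta m n = delta m n" by (cases "n = m") (auto simp: delta_def)
    have "?e * (- W m (n + 1) - W m (n - 1) + (of_real (q n) - E) * W m n) = hn_op g q E (tilt g W m) n"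
      by (rule hn_op_tilt[symmetric])
    also have "tilt g W m = R (delta m)" using tilt by (simp add: fun_eq_iff)
    also have "hn_op g q E (R (delta m)) n = ?e * delta m n" using RK d by simp
    finally show "- W m (n + 1) - W m (n - 1) + (of_real (q n) - E) * W m n = delta m n"
      using e by simp
    have "?e * (- W (m + 1) n - W (m - 1) n + (of_real (q m) - E) * W m n)
       = - of_real (exp g) * tilt g W (m - 1) n - of_real (exp (- g)) * tilt g W (m + 1) n
       + (of_real (q m) - E) * tilt g W m n"
      by (rule row_tilt[symmetric])
    also have "\<dots> = ?e * delta m n" unfolding tilt row d ..
    finally show "- W (m + 1) n - W (m - 1) n + (of_real (q m) - E) * W m n = delta m n"
      using e by simp
    have "cmod (W m n) = exp (g * real_of_int (n - m)) * cmod (R (delta m) n)"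
      by (simp add: W_def norm_mult)
    also have "\<dots> \<le> exp (g * real_of_int (n - m)) * (2 * C * exp (- \<kappa> * \<bar>real_of_int (n - m)\<bar>))"
      by (intro mult_left_mono dec) auto
    also have "\<dots> = 2 * C * exp (g * real_of_int (n - m) - \<kappa> * \<bar>real_of_int (n - m)\<bar>)"
    proof -
      have "exp (g * real_of_int (n - m)) * exp (- \<kappa> * \<bar>real_of_int (n - m)\<bar>)
          = exp (g * real_of_int (n - m) - \<kappa> * \<bar>real_of_int (n - m)\<bar>)"
        unfolding exp_add[symmetric] by simp
      then show ?thesis by (simp add: mult.left_commute)
    qed
    finally show "cmod (W m n) \<le> 2 * C * exp (g * real_of_int (n - m) - \<kappa> * \<bar>real_of_int (n - m)\<bar>)" .
  qed (use \<open>0 < C\<close> \<kappa> in auto)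
  with tilt show ?thesis by (metis ext)
qed

text \<open>
  Schur's test: Cauchy--Schwarz with weight \<open>k m n\<close> bounds finite truncations of the integral operator
  by \<open>(C S)\<^sup>2\<close>, and the bound passes to the limit. The two kernel equations give the right and the left
  inverse after shifting the summation index.
\<close>

lemma schur_inverse:
  assumes G: "green_kernel g q E W C \<kappa>" and q: "\<And>n. \<bar>q n\<bar> \<le> M"
  shows "\<exists>R. l2_inverse g q E R"
proof -
  define K where "K = tilt g W"
  have col: "hn_op g q E (K m) = delta m"
    and row: "- of_real (exp g) * K (m - 1) n - of_real (exp (- g)) * K (m + 1) n + (of_real (q m) - E) * K m n = delta m n"
    and dec: "cmod (K m n) \<le> C * exp (- \<kappa> * \<bar>real_of_int (n - m)\<bar>)" for m n
    unfolding K_def using green_kernel_tilt[OF G] by auto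
  have C: "0 < C" and \<kappa>: "0 < \<kappa>" using G by (auto simp: green_kernel_def)
  define S where "S = 2 / (1 - exp (- \<kappa>))"
  have S0: "0 \<le> S" using \<kappa> by (simp add: S_def)
  define k where "k m n = C * exp (- \<kappa> * \<bar>real_of_int (n - m)\<bar>)" for m n
  have k0: "0 \<le> k m n" for m n unfolding k_def using C by simp
  have kF: "(\<Sum>n\<in>F. k m n) \<le> C * S" if "finite F" for F m
    unfolding k_def sum_distrib_left[symmetric] S_def using C \<kappa> that by (intro mult_left_mono sum_exp_abs_le) auto
  have kF': "(\<Sum>m\<in>F. k m n) \<le> C * S" if "finite F" for F n
  proof -
    have "k m n = k n m" for m n
      unfolding k_def of_int_diff by (simp only: abs_minus_commute)
    then show ?thesis using kF[OF that, of n] by simp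
  qed
  have summ: "(\<lambda>m. K (m + i) n * u m) summable_on UNIV" if u: "u \<in> l2" for u n i
  proof -
    have "(\<lambda>m. norm (K (m + i) n * u m)) summable_on UNIV"
    proof (rule nonneg_bdd_above_summable_on)
      show "bdd_above (sum (\<lambda>m. norm (K (m + i) n * u m)) ` {F. F \<subseteq> UNIV \<and> finite F})"
      proof (rule bdd_aboveI2)
        fix F :: "int set" assume "F \<in> {F. F \<subseteq> UNIV \<and> finite F}"
        then have F: "finite F" by simp
        have "(\<Sum>m\<in>F. norm (K (m + i) n * u m)) \<le> (\<Sum>m\<in>F. k (m + i) n * l2_norm u)"
          unfolding norm_mult k_def using C
          by (intro sum_mono mult_mono dec cmod_le_l2_norm u) auto
        also have "\<dots> = (\<Sum>m\<in>(\<lambda>m. m + i) ` F. k m n) * l2_norm u"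
          by (simp add: sum.reindex sum_distrib_right)
        also have "\<dots> \<le> C * S * l2_norm u"
          using F by (intro mult_right_mono kF' l2_norm_nonneg) auto
        finally show "(\<Sum>m\<in>F. norm (K (m + i) n * u m)) \<le> C * S * l2_norm u" .
      qed
    qed auto
    then show ?thesis by (rule abs_summable_summable)
  qed
  define R where "R u n = (\<Sum>\<^sub>\<infinity>m. K m n * u m)" for u n
  have bound: "L2_set (\<lambda>n. cmod (R u n)) F \<le> C * S * l2_norm u" if u: "u \<in> l2" and F: "finite F" for u F
  proof -
    have fin: "(\<Sum>n\<in>F. (cmod (\<Sum>m\<in>G. K m n * u m))\<^sup>2) \<le> (C * S * l2_norm u)\<^sup>2" if Gf: "finite G" for G
    proof -
      have "(cmod (\<Sum>m\<in>G. K m n * u m))\<^sup>2 \<le> C * S * (\<Sum>m\<in>G. k m n * (cmod (u m))\<^sup>2)" for n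
      proof -
        (* Square roots of the weight k split the sum for the Cauchy-Schwarz inequality. *)
        have "cmod (\<Sum>m\<in>G. K m n * u m) \<le> (\<Sum>m\<in>G. sqrt (k m n) * (sqrt (k m n) * cmod (u m)))"
        proof (rule order_trans[OF norm_sum], rule sum_mono)
          fix m
          have "norm (K m n * u m) \<le> k m n * cmod (u m)"
            unfolding norm_mult k_def by (intro mult_right_mono dec) auto
          then show "norm (K m n * u m) \<le> sqrt (k m n) * (sqrt (k m n) * cmod (u m))"
            using k0[of m n] by (simp flip: mult.assoc)
        qed
        also have "\<dots> \<le> L2_set (\<lambda>m. sqrt (k m n)) G * L2_set (\<lambda>m. sqrt (k m n) * cmod (u m)) G"
          using L2_set_mult_ineq[of "\<lambda>m. sqrt (k m n)" "\<lambda>m. sqrt (k m n) * cmod (u m)" G] k0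
          by simp
        finally have "(cmod (\<Sum>m\<in>G. K m n * u m))\<^sup>2
            \<le> (L2_set (\<lambda>m. sqrt (k m n)) G * L2_set (\<lambda>m. sqrt (k m n) * cmod (u m)) G)\<^sup>2"
          by (intro power_mono) auto
        also have "\<dots> = (\<Sum>m\<in>G. k m n) * (\<Sum>m\<in>G. k m n * (cmod (u m))\<^sup>2)"
          using k0 by (simp add: L2_set_def power_mult_distrib sum_nonneg)
        also have "\<dots> \<le> C * S * (\<Sum>m\<in>G. k m n * (cmod (u m))\<^sup>2)"
          using k0 by (intro mult_right_mono kF' Gf sum_nonneg) auto
        finally show ?thesis .
      qed
      then have "(\<Sum>n\<in>F. (cmod (\<Sum>m\<in>G. K m n * u m))\<^sup>2) \<le> (\<Sum>n\<in>F. C * S * (\<Sum>m\<in>G. k m n * (cmod (u m))\<^sup>2))"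
        by (intro sum_mono)
      also have "\<dots> = C * S * (\<Sum>m\<in>G. (\<Sum>n\<in>F. k m n) * (cmod (u m))\<^sup>2)"
        unfolding sum_distrib_left[symmetric] by (subst sum.swap) (simp add: sum_distrib_right)
      also have "\<dots> \<le> C * S * (\<Sum>m\<in>G. C * S * (cmod (u m))\<^sup>2)"
        using C S0 by (intro mult_left_mono sum_mono mult_right_mono kF F) auto
      also have "\<dots> = (C * S)\<^sup>2 * (\<Sum>m\<in>G. (cmod (u m))\<^sup>2)"
        by (simp add: sum_distrib_left power2_eq_square mult_ac)
      also have "\<dots> \<le> (C * S)\<^sup>2 * (l2_norm u)\<^sup>2"
      proof (rule mult_left_mono)
        have "(L2_set (\<lambda>m. cmod (u m)) G)\<^sup>2 \<le> (l2_norm u)\<^sup>2"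
          by (intro power_mono L2_set_le_l2_norm u Gf L2_set_nonneg)
        then show "(\<Sum>m\<in>G. (cmod (u m))\<^sup>2) \<le> (l2_norm u)\<^sup>2" by (simp add: L2_set_def sum_nonneg)
      qed simp
      finally show ?thesis by (simp only: power_mult_distrib)
    qed
    have lim: "((\<lambda>G. \<Sum>m\<in>G. K m n * u m) \<longlongrightarrow> R u n) (finite_subsets_at_top UNIV)" for n
      unfolding R_def using infsum_tendsto[OF summ[OF u, of 0 n]] by simp
    have "((\<lambda>G. \<Sum>n\<in>F. (cmod (\<Sum>m\<in>G. K m n * u m))\<^sup>2) \<longlongrightarrow> (\<Sum>n\<in>F. (cmod (R u n))\<^sup>2)) (finite_subsets_at_top UNIV)"
      by (intro tendsto_intros lim)
    then have "(\<Sum>n\<in>F. (cmod (R u n))\<^sup>2) \<le> (C * S * l2_norm u)\<^sup>2"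
    proof (rule tendsto_upperbound)
      show "\<forall>\<^sub>F G in finite_subsets_at_top UNIV. (\<Sum>n\<in>F. (cmod (\<Sum>m\<in>G. K m n * u m))\<^sup>2) \<le> (C * S * l2_norm u)\<^sup>2"
        by (intro eventually_finite_subsets_at_top_weakI fin)
    qed simp
    then show ?thesis
      unfolding L2_set_def using C S0 l2_norm_nonneg[of u] by (intro real_le_lsqrt) auto
  qed
  have nn: "0 \<le> C * S * l2_norm u" for u using C S0 l2_norm_nonneg[of u] by simp
  have Rl2: "R u \<in> l2" "l2_norm (R u) \<le> C * S * l2_norm u" if "u \<in> l2" for u
    using l2I[of "R u", OF bound[OF that] nn] by auto
  have lin: "R (\<lambda>n. a * u n + b * w n) = (\<lambda>n. a * R u n + b * R w n)" if u: "u \<in> l2" and w: "w \<in> l2" for u w a b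
  proof
    fix n
    have s: "(\<lambda>m. K m n * u m) summable_on UNIV" "(\<lambda>m. K m n * w m) summable_on UNIV"
      using summ[OF u, of 0 n] summ[OF w, of 0 n] by auto
    have "R (\<lambda>n. a * u n + b * w n) n = (\<Sum>\<^sub>\<infinity>m. a * (K m n * u m) + b * (K m n * w m))"
      unfolding R_def by (intro infsum_cong) (simp add: algebra_simps)
    also have "\<dots> = a * R u n + b * R w n"
      unfolding R_def using s by (subst infsum_add) (auto intro: summable_on_cmult_right simp: infsum_cmult_right)
    finally show "R (\<lambda>n. a * u n + b * w n) n = a * R u n + b * R w n" .
  qed
  have bo: "l2_bounded_operator R"
    unfolding l2_bounded_operator_def using Rl2 lin by blast
  have pick: "(\<Sum>\<^sub>\<infinity>m. delta m n * u m) = u n" for u n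
  proof -
    have "(\<Sum>\<^sub>\<infinity>m. delta m n * u m) = (\<Sum>\<^sub>\<infinity>m\<in>{n}. delta m n * u m)"
      by (intro infsum_cong_neutral) (auto simp: delta_def)
    then show ?thesis by (simp add: delta_def)
  qed
  have right: "hn_op g q E (R u) = u" if u: "u \<in> l2" for u
  proof
    fix n
    have s: "(\<lambda>m. K m i * u m) summable_on UNIV" for i using summ[OF u, of 0 i] by simp
    have "hn_op g q E (R u) n = (\<Sum>\<^sub>\<infinity>m. - of_real (exp g) * (K m (n + 1) * u m))
        + ((\<Sum>\<^sub>\<infinity>m. - of_real (exp (- g)) * (K m (n - 1) * u m)) + (\<Sum>\<^sub>\<infinity>m. (of_real (q n) - E) * (K m n * u m)))"
      unfolding hn_op_def R_def infsum_cmult_right[OF s] by simp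
    also have "\<dots> = (\<Sum>\<^sub>\<infinity>m. - of_real (exp g) * (K m (n + 1) * u m)
        + (- of_real (exp (- g)) * (K m (n - 1) * u m) + (of_real (q n) - E) * (K m n * u m)))"
      using s by (subst infsum_add[symmetric], (intro summable_on_cmult_right s)+)
        (subst infsum_add[symmetric], (intro summable_on_add summable_on_cmult_right s)+, simp)
    also have "\<dots> = (\<Sum>\<^sub>\<infinity>m. delta m n * u m)"
      by (intro infsum_cong) (simp add: col[symmetric] hn_op_def algebra_simps)
    also have "\<dots> = u n" by (rule pick)
    finally show "hn_op g q E (R u) n = u n" .
  qed
  have shift: "(\<Sum>\<^sub>\<infinity>m. K m n * u (m + i)) = (\<Sum>\<^sub>\<infinity>m. K (m - i) n * u m)" for u n i
  proof -
    have "bij_betw (\<lambda>m. m + i) UNIV (UNIV :: int set)"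
      by (rule bij_betwI[of _ _ _ "\<lambda>m. m - i"]) auto
    from infsum_reindex_bij_betw[OF this, of "\<lambda>m. K (m - i) n * u m"] show ?thesis by simp
  qed
  have left: "R (hn_op g q E u) = u" if u: "u \<in> l2" for u
  proof
    fix n
    have s: "(\<lambda>m. K (m + i) n * u m) summable_on UNIV" for i by (rule summ[OF u])
    have sm: "(\<lambda>m. K (m - 1) n * u m) summable_on UNIV" using s[of "-1"] by simp
    have s0: "(\<lambda>m. K m n * (of_real (q m) - E) * u m) summable_on UNIV"
    proof -
      have "(\<lambda>m. K (m + 0) n * ((of_real (q m) - E) * u m)) summable_on UNIV"
      proof (rule summ)
        have "cmod (of_real (q n) - E) \<le> M + cmod E" for n
          using norm_triangle_ineq4[of "of_real (q n)" E] q[of n] by simp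
        then show "(\<lambda>m. (of_real (q m) - E) * u m) \<in> l2" by (rule l2_mult(1)[OF u])
      qed
      then show ?thesis by (simp add: mult.assoc)
    qed
    have s1: "(\<lambda>m. K m n * u (m + i)) summable_on UNIV" for i
      using summ[OF l2_shift(1)[OF u, of i], of 0 n] by simp
    have s1m: "(\<lambda>m. K m n * u (m - 1)) summable_on UNIV" using s1[of "-1"] by simp
    have "R (hn_op g q E u) n = (\<Sum>\<^sub>\<infinity>m. - of_real (exp g) * (K m n * u (m + 1))
        + (- of_real (exp (- g)) * (K m n * u (m - 1)) + K m n * (of_real (q m) - E) * u m))"
      unfolding R_def hn_op_def by (intro infsum_cong) (simp add: algebra_simps)
    also have "\<dots> = - of_real (exp g) * (\<Sum>\<^sub>\<infinity>m. K m n * u (m + 1))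
        + (- of_real (exp (- g)) * (\<Sum>\<^sub>\<infinity>m. K m n * u (m - 1)) + (\<Sum>\<^sub>\<infinity>m. K m n * (of_real (q m) - E) * u m))"
      using infsum_add[OF summable_on_cmult_right[OF s1[of 1], of "- of_real (exp g)"]
          summable_on_add[OF summable_on_cmult_right[OF s1m, of "- of_real (exp (- g))"] s0]]
        infsum_add[OF summable_on_cmult_right[OF s1m, of "- of_real (exp (- g))"] s0]
        infsum_cmult_right[OF s1[of 1], of "- of_real (exp g)"] infsum_cmult_right[OF s1m, of "- of_real (exp (- g))"]
      by simp
    also have "(\<Sum>\<^sub>\<infinity>m. K m n * u (m + 1)) = (\<Sum>\<^sub>\<infinity>m. K (m - 1) n * u m)" by (rule shift)
    also have "(\<Sum>\<^sub>\<infinity>m. K m n * u (m - 1)) = (\<Sum>\<^sub>\<infinity>m. K (m + 1) n * u m)" using shift[of n u "-1"] by simp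
    also have "- of_real (exp g) * (\<Sum>\<^sub>\<infinity>m. K (m - 1) n * u m)
        + (- of_real (exp (- g)) * (\<Sum>\<^sub>\<infinity>m. K (m + 1) n * u m) + (\<Sum>\<^sub>\<infinity>m. K m n * (of_real (q m) - E) * u m))
      = (\<Sum>\<^sub>\<infinity>m. - of_real (exp g) * (K (m - 1) n * u m)
        + (- of_real (exp (- g)) * (K (m + 1) n * u m) + K m n * (of_real (q m) - E) * u m))"
      using infsum_add[OF summable_on_cmult_right[OF sm, of "- of_real (exp g)"]
          summable_on_add[OF summable_on_cmult_right[OF s[of 1], of "- of_real (exp (- g))"] s0]]
        infsum_add[OF summable_on_cmult_right[OF s[of 1], of "- of_real (exp (- g))"] s0]
        infsum_cmult_right[OF sm, of "- of_real (exp g)"] infsum_cmult_right[OF s[of 1], of "- of_real (exp (- g))"]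
      by simp
    also have "\<dots> = (\<Sum>\<^sub>\<infinity>m. delta m n * u m)"
      by (intro infsum_cong) (simp add: row[symmetric] algebra_simps)
    also have "\<dots> = u n" by (rule pick)
    finally show "R (hn_op g q E u) n = u n" .
  qed
  show ?thesis using bo right left unfolding l2_inverse_def by blast
qed

section \<open>Solutions of the difference equation and existence of Green kernels\<close>

definition solution :: "(int \<Rightarrow> real) \<Rightarrow> complex \<Rightarrow> (int \<Rightarrow> complex) \<Rightarrow> bool" where
  "solution q E w \<longleftrightarrow> (\<forall>n. w (n + 1) = (of_real (q n) - E) * w n - w (n - 1))"

lemma solution_step: "solution q E w \<Longrightarrow> w (n + 1) = (of_real (q n) - E) * w n - w (n - 1)"
  by (simp add: solution_def)

lemma solution_step_back: "solution q E w \<Longrightarrow> w (n - 1) = (of_real (q n) - E) * w n - w (n + 1)"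
  using solution_step[of q E w n] by simp

text \<open>
  Pairs of consecutive values, propagated from the sites \<open>0\<close> and \<open>1\<close> to the right and to the left; they
  only serve to construct solutions on all of the integers.
\<close>

primrec forward_pair :: "(int \<Rightarrow> real) \<Rightarrow> complex \<Rightarrow> complex \<times> complex \<Rightarrow> nat \<Rightarrow> complex \<times> complex" where
  "forward_pair q E p 0 = p"
| "forward_pair q E p (Suc k) = (snd (forward_pair q E p k), (of_real (q (int k + 1)) - E) * snd (forward_pair q E p k) - fst (forward_pair q E p k))"

primrec backward_pair :: "(int \<Rightarrow> real) \<Rightarrow> complex \<Rightarrow> complex \<times> complex \<Rightarrow> nat \<Rightarrow> complex \<times> complex" where
  "backward_pair q E p 0 = p"
| "backward_pair q E p (Suc k) = ((of_real (q (- int k)) - E) * fst (backward_pair q E p k) - snd (backward_pair q E p k), fst (backward_pair q E p k))"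

lemma solution_exists: "\<exists>w. solution q E w \<and> w 0 = a \<and> w 1 = b"
proof -
  define f where "f k = fst (forward_pair q E (a, b) k)" for k
  define h where "h k = fst (backward_pair q E (a, b) k)" for k
  have f: "f 0 = a" "f (Suc 0) = b" "f (Suc (Suc k)) = (of_real (q (int k + 1)) - E) * f (Suc k) - f k" for k
    by (auto simp: f_def)
  have h: "h 0 = a" "h (Suc 0) = (of_real (q 0) - E) * a - b"
    "h (Suc (Suc k)) = (of_real (q (- int (Suc k))) - E) * h (Suc k) - h k" for k
    by (auto simp: h_def simp del: of_nat_Suc)
  define w where "w n = (if 0 \<le> n then f (nat n) else h (nat (- n)))" for n :: int
  have "w (n + 1) = (of_real (q n) - E) * w n - w (n - 1)" for n
  proof -
    consider "n = 0" | k where "n = int k + 1" | "n = - 1" | k where "n = - int k - 2"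
    proof -
      have "n = 0 \<or> n = int (nat (n - 1)) + 1 \<or> n = -1 \<or> n = - int (nat (- n - 2)) - 2"
        by linarith
      then show ?thesis using that by blast
    qed
    then show ?thesis
    proof cases
      case 1
      then show ?thesis using f h by (simp add: w_def)
    next
      case 2
      have "nat (int k + 1 + 1) = Suc (Suc k)" "nat (int k + 1) = Suc k" by auto
      then show ?thesis unfolding 2 w_def using f(3)[of k] by simp
    next
      case 3
      have "nat 2 = Suc (Suc 0)" by simp
      then show ?thesis unfolding 3 w_def using f h(2) h(3)[of 0] h(1) by (simp add: numeral_2_eq_2)
    next
      case 4
      have "nat (int k + 1) = Suc k" "nat (int k + 2) = Suc (Suc k)" "nat (int k + 3) = Suc (Suc (Suc k))" by auto
      then show ?thesis unfolding 4 w_def using h(3)[of "Suc k"] by (simp add: algebra_simps)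
    qed
  qed
  then have "solution q E w" by (simp add: solution_def)
  moreover have "w 0 = a" "w 1 = b" using f by (auto simp: w_def)
  ultimately show ?thesis by blast
qed

lemma wronskian_const:
  assumes "solution q E u" "solution q E w"
  shows "u n * w (n + 1) - u (n + 1) * w n = u m * w (m + 1) - u (m + 1) * w m"
proof -
  have step: "u (n + 1) * w (n + 1 + 1) - u (n + 1 + 1) * w (n + 1) = u n * w (n + 1) - u (n + 1) * w n" for n
    unfolding solution_step[OF assms(1), of "n + 1"] solution_step[OF assms(2), of "n + 1"]
    by (simp add: algebra_simps)
  show ?thesis
  proof (induction n rule: int_induct[where k = m])
    case (step1 i)
    then show ?case using step[of i] by simp
  next
    case (step2 i)
    then show ?case using step[of "i - 1"] by simp
  qed simp
qed

lemma solution_zero: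
  assumes "solution q E w" "w m = 0" "w (m + 1) = 0"
  shows "w n = 0"
proof -
  have "w n = 0 \<and> w (n + 1) = 0"
  proof (induction n rule: int_induct[where k = m])
    case (step1 i)
    then show ?case using solution_step[OF assms(1), of "i + 1"] by simp
  next
    case (step2 i)
    then show ?case using solution_step_back[OF assms(1), of i] by simp
  qed (use assms in auto)
  then show ?thesis by simp
qed

lemma solution_lincomb:
  assumes "solution q E u" "solution q E w"
  shows "solution q E (\<lambda>n. a * u n + b * w n)"
  unfolding solution_def
proof
  fix n
  show "a * u (n + 1) + b * w (n + 1)
      = (of_real (q n) - E) * (a * u n + b * w n) - (a * u (n - 1) + b * w (n - 1))"
    unfolding solution_step[OF assms(1), of n] solution_step[OF assms(2), of n]
    by (simp only: algebra_simps)
qed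

lemma solution_scale:
  assumes "solution q E u"
  shows "solution q E (\<lambda>n. a * u n)"
  using solution_lincomb[OF assms assms, of a 0] by simp

text \<open>
  The classical formula for a Green function from two solutions with Wronskian one.
\<close>

lemma solution_pair_green:
  assumes S: "solution q E S" and F: "solution q E F"
    and W1: "\<And>m. S m * F (m + 1) - S (m + 1) * F m = 1"
  defines "W \<equiv> \<lambda>m n. S (max m n) * F (min m n)"
  shows "- W m (n + 1) - W m (n - 1) + (of_real (q n) - E) * W m n = delta m n"
    and "- W (m + 1) n - W (m - 1) n + (of_real (q m) - E) * W m n = delta m n"
proof -
  have col: "- W m (n + 1) - W m (n - 1) + (of_real (q n) - E) * W m n = delta m n" for m n
  proof -
    consider "n < m" | "n = m" | "m < n" by linarith
    then show ?thesis
    proof cases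
      case 1
      then have w: "W m (n + 1) = S m * F (n + 1)" "W m (n - 1) = S m * F (n - 1)" "W m n = S m * F n"
        by (cases "m = n + 1"; auto simp: W_def max_def min_def)+
      have "- W m (n + 1) - W m (n - 1) + (of_real (q n) - E) * W m n
          = S m * ((of_real (q n) - E) * F n - F (n - 1) - F (n + 1))"
        unfolding w by (simp add: algebra_simps)
      then show ?thesis using 1 solution_step[OF F, of n] by (simp add: delta_def)
    next
      case 2
      have "W m (m + 1) = S (m + 1) * F m" "W m (m - 1) = S m * F (m - 1)" "W m m = S m * F m"
        by (auto simp: W_def max_def min_def)
      then have "- W m (m + 1) - W m (m - 1) + (of_real (q m) - E) * W m m
          = S m * ((of_real (q m) - E) * F m - F (m - 1)) - S (m + 1) * F m"
        by (simp add: algebra_simps)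
      also have "\<dots> = 1" using W1[of m] solution_step[OF F, of m] by simp
      finally show ?thesis using 2 by (simp add: delta_def)
    next
      case 3
      then have w: "W m (n + 1) = S (n + 1) * F m" "W m (n - 1) = S (n - 1) * F m" "W m n = S n * F m"
        by (auto simp: W_def max_def min_def)
      have "- W m (n + 1) - W m (n - 1) + (of_real (q n) - E) * W m n
          = F m * ((of_real (q n) - E) * S n - S (n - 1) - S (n + 1))"
        unfolding w by (simp add: algebra_simps)
      then show ?thesis using 3 solution_step[OF S, of n] by (simp add: delta_def)
    qed
  qed
  show "- W m (n + 1) - W m (n - 1) + (of_real (q n) - E) * W m n = delta m n" by (rule col)
  have sym: "W m n = W n m" for m n by (simp add: W_def max.commute min.commute)
  show "- W (m + 1) n - W (m - 1) n + (of_real (q m) - E) * W m n = delta m n"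
    using col[of n m] unfolding sym[of n] by (simp add: delta_def eq_commute)
qed

text \<open>
  The ratios of the Weyl solution. In the upper half plane the backward Riccati map
  \<open>z \<mapsto> 1 / (q - E - z)\<close> preserves \<open>Im z \<ge> 0\<close> and has values of modulus at most \<open>1 / Im E\<close>; start it with
  \<open>0\<close> at ever more distant sites and take a limit.
\<close>

lemma weyl_ratio_exists:
  assumes \<eta>: "0 < Im E"
  shows "\<exists>\<rho> :: int \<Rightarrow> complex. \<forall>n. 0 \<le> Im (\<rho> n) \<and> cmod (\<rho> n) \<le> 1 / Im E \<and> \<rho> (n - 1) * (of_real (q n) - E - \<rho> n) = 1"
proof -
  (* s N k is the ratio at the site N - k when the ratio at the site N is 0. *)
  define s where "s N k = rec_nat (0::complex) (\<lambda>j z. 1 / (of_real (q (int N - int j)) - E - z)) k" for N k :: nat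
  have s0: "s N 0 = 0" and sS: "s N (Suc k) = 1 / (of_real (q (int N - int k)) - E - s N k)" for N k
    by (auto simp: s_def)
  have inv: "0 \<le> Im (1 / (of_real t - E - z)) \<and> cmod (1 / (of_real t - E - z)) \<le> 1 / Im E
      \<and> of_real t - E - z \<noteq> 0" if "0 \<le> Im z" for t z
  proof -
    have im: "Im (of_real t - E - z) \<le> - Im E" using that by simp
    then have "Im E \<le> cmod (of_real t - E - z)" using abs_Im_le_cmod[of "of_real t - E - z"] by linarith
    then have "cmod (1 / (of_real t - E - z)) \<le> 1 / Im E"
      using \<eta> by (simp add: norm_divide frac_le)
    moreover have "0 \<le> Im (1 / (of_real t - E - z))"
      using im \<eta> by (simp add: Im_divide divide_nonneg_nonneg)
    moreover have "of_real t - E - z \<noteq> 0" using im \<eta> by (metis neg_0_less_iff_less not_le zero_complex.sel(2) order_less_le_trans neg_less_0_iff_less)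
    ultimately show ?thesis by blast
  qed
  have sp: "0 \<le> Im (s N k) \<and> cmod (s N k) \<le> 1 / Im E" for N k
  proof (induction k)
    case (Suc k)
    then show ?case using inv[of "s N k"] by (simp add: sS)
  qed (use \<eta> in \<open>simp add: s0\<close>)
  define r where "r N n = (if n \<le> int N then s N (nat (int N - n)) else 0)" for N n
  have rp: "0 \<le> Im (r N n)" "cmod (r N n) \<le> 1 / Im E" for N n
    using sp \<eta> by (auto simp: r_def)
  have req: "r N (n - 1) * (of_real (q n) - E - r N n) = 1" if "n \<le> int N" for N n
  proof -
    have "nat (int N - (n - 1)) = Suc (nat (int N - n))" using that by linarith
    moreover have "int N - int (nat (int N - n)) = n" using that by simp
    ultimately have "r N (n - 1) = 1 / (of_real (q n) - E - r N n)"
      using that by (simp add: r_def sS)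
    then show ?thesis using inv[OF rp(1)[of N n], of "q n"] by simp
  qed
  obtain k :: "nat \<Rightarrow> nat" where k: "strict_mono k" "\<And>n. n \<in> UNIV \<Longrightarrow> \<exists>l. (\<lambda>i. r (k i) n) \<longlonglongrightarrow> l"
    using function_convergent_subsequence[of "UNIV :: int set" r "1 / Im E"] rp(2) by blast
  then obtain \<rho> where lim: "\<And>n. (\<lambda>i. r (k i) n) \<longlonglongrightarrow> \<rho> n" by (metis UNIV_I)
  have "0 \<le> Im (\<rho> n)" for n
    by (rule tendsto_lowerbound[OF tendsto_Im[OF lim]]) (use rp in auto)
  moreover have "cmod (\<rho> n) \<le> 1 / Im E" for n
    by (rule tendsto_upperbound[OF tendsto_norm[OF lim]]) (use rp in auto)
  moreover have "\<rho> (n - 1) * (of_real (q n) - E - \<rho> n) = 1" for n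
  proof -
    have "(\<lambda>i. r (k i) (n - 1) * (of_real (q n) - E - r (k i) n)) \<longlonglongrightarrow> \<rho> (n - 1) * (of_real (q n) - E - \<rho> n)"
      by (intro tendsto_intros lim)
    moreover have "eventually (\<lambda>i. r (k i) (n - 1) * (of_real (q n) - E - r (k i) n) = 1) sequentially"
      using eventually_ge_at_top[of "nat n"]
    proof eventually_elim
      case (elim i)
      have "i \<le> k i" using k(1) by (rule strict_mono_imp_increasing)
      then have "n \<le> int (k i)" using elim by linarith
      then show ?case by (rule req)
    qed
    ultimately have "(\<lambda>i. 1) \<longlonglongrightarrow> \<rho> (n - 1) * (of_real (q n) - E - \<rho> n)"
      by (rule Lim_transform_eventually)
    then show ?thesis by (simp add: LIMSEQ_const_iff)
  qed
  ultimately show ?thesis by blast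
qed

text \<open>
  The quantity \<open>t\<^sub>n = Im \<rho>\<^sub>n |S\<^sub>n|\<^sup>2\<close> loses \<open>Im E |S\<^sub>n\<^sub>+\<^sub>1|\<^sup>2\<close> per step and is itself at most \<open>|S\<^sub>n|\<^sup>2 / Im E\<close>; hence it
  decays by the factor \<open>1 + (Im E)\<^sup>2\<close> per step.
\<close>

lemma weyl_solution_decay:
  assumes \<eta>: "0 < Im E" and S: "\<And>n. S (n + 1) = \<rho> n * S n"
    and \<rho>: "\<And>n. 0 \<le> Im (\<rho> n)" "\<And>n. cmod (\<rho> n) \<le> 1 / Im E" "\<And>n. \<rho> (n - 1) * (of_real (q n) - E - \<rho> n) = 1"
  shows "(cmod (S (m + int k)))\<^sup>2 * (1 + (Im E)\<^sup>2) ^ k \<le> (1 + (Im E)\<^sup>2) / (Im E)\<^sup>2 * (cmod (S m))\<^sup>2"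
proof -
  let ?\<eta> = "Im E"
  define t where "t n = Im (\<rho> n) * (cmod (S n))\<^sup>2" for n
  have t: "t n = ?\<eta> * (cmod (S (n + 1)))\<^sup>2 + t (n + 1)" for n
  proof -
    let ?z = "of_real (q (n + 1)) - E - \<rho> (n + 1)"
    have z: "\<rho> n * ?z = 1" using \<rho>(3)[of "n + 1"] by simp
    then have "cnj (\<rho> n) * (\<rho> n * ?z) = cnj (\<rho> n)" by simp
    then have "of_real ((cmod (\<rho> n))\<^sup>2) * ?z = cnj (\<rho> n)"
      by (simp only: complex_norm_square mult_ac)
    then have "Im (of_real ((cmod (\<rho> n))\<^sup>2) * ?z) = - Im (\<rho> n)" by simp
    then have "Im (\<rho> n) = (cmod (\<rho> n))\<^sup>2 * (?\<eta> + Im (\<rho> (n + 1)))"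
      by (simp add: algebra_simps)
    then have "t n = (cmod (\<rho> n * S n))\<^sup>2 * (?\<eta> + Im (\<rho> (n + 1)))"
      by (simp add: t_def norm_mult power_mult_distrib)
    then show ?thesis by (simp add: t_def[of "n + 1"] S ring_distribs mult_ac)
  qed
  have t0: "0 \<le> t n" for n using \<rho>(1) by (simp add: t_def)
  have tle: "t n \<le> (cmod (S n))\<^sup>2 / ?\<eta>" for n
  proof -
    have "Im (\<rho> n) \<le> 1 / ?\<eta>" using abs_Im_le_cmod[of "\<rho> n"] \<rho>(2)[of n] by linarith
    then have "Im (\<rho> n) * (cmod (S n))\<^sup>2 \<le> 1 / ?\<eta> * (cmod (S n))\<^sup>2" by (intro mult_right_mono) auto
    then show ?thesis by (simp add: t_def)
  qed
  have td: "(1 + ?\<eta>\<^sup>2) * t (n + 1) \<le> t n" for n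
  proof -
    have "?\<eta> * (?\<eta> * t (n + 1)) \<le> ?\<eta> * (cmod (S (n + 1)))\<^sup>2"
      using tle[of "n + 1"] \<eta> by (intro mult_left_mono) (auto simp: field_simps)
    then show ?thesis using t[of n] by (simp add: algebra_simps power2_eq_square)
  qed
  have tk: "(1 + ?\<eta>\<^sup>2) ^ k * t (m + int k) \<le> t m" for k
  proof (induction k)
    case (Suc k)
    have "(1 + ?\<eta>\<^sup>2) ^ Suc k * t (m + int (Suc k)) = (1 + ?\<eta>\<^sup>2) ^ k * ((1 + ?\<eta>\<^sup>2) * t (m + int k + 1))"
      by (simp add: algebra_simps)
    also have "\<dots> \<le> (1 + ?\<eta>\<^sup>2) ^ k * t (m + int k)" by (intro mult_left_mono td) auto
    also have "\<dots> \<le> t m" by (rule Suc)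
    finally show ?case .
  qed simp
  show ?thesis
  proof (cases k)
    case 0
    have "1 * (cmod (S m))\<^sup>2 \<le> (1 + ?\<eta>\<^sup>2) / ?\<eta>\<^sup>2 * (cmod (S m))\<^sup>2"
      using \<eta> by (intro mult_right_mono) (auto simp: field_simps)
    then show ?thesis using 0 by simp
  next
    case (Suc j)
    have "?\<eta> * (cmod (S (m + int k)))\<^sup>2 \<le> t (m + int j)"
      using t[of "m + int j"] t0[of "m + int j + 1"] Suc by (simp add: algebra_simps)
    then have "(1 + ?\<eta>\<^sup>2) ^ j * (?\<eta> * (cmod (S (m + int k)))\<^sup>2) \<le> (1 + ?\<eta>\<^sup>2) ^ j * t (m + int j)"
      by (intro mult_left_mono) auto
    also have "\<dots> \<le> t m" by (rule tk)
    also have "\<dots> \<le> (cmod (S m))\<^sup>2 / ?\<eta>" by (rule tle)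
    finally have "(1 + ?\<eta>\<^sup>2) ^ j * (?\<eta> * (cmod (S (m + int k)))\<^sup>2) * ?\<eta> \<le> (cmod (S m))\<^sup>2"
      using \<eta> by (simp add: pos_le_divide_eq)
    then have "(1 + ?\<eta>\<^sup>2) ^ j * (cmod (S (m + int k)))\<^sup>2 \<le> (cmod (S m))\<^sup>2 / ?\<eta>\<^sup>2"
      using \<eta> by (simp add: pos_le_divide_eq power2_eq_square mult_ac)
    then have "(1 + ?\<eta>\<^sup>2) * ((1 + ?\<eta>\<^sup>2) ^ j * (cmod (S (m + int k)))\<^sup>2) \<le> (1 + ?\<eta>\<^sup>2) * ((cmod (S m))\<^sup>2 / ?\<eta>\<^sup>2)"
      by (intro mult_left_mono) auto
    then show ?thesis using Suc by (simp add: mult_ac)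
  qed
qed

lemma solution_of_ratio:
  assumes \<rho>: "\<And>n. \<rho> (n - 1) * (of_real (q n) - E - \<rho> n) = 1"
  shows "\<exists>S. solution q E S \<and> S 0 = 1 \<and> (\<forall>n. S (n + 1) = \<rho> n * S n)"
proof -
  obtain S where S: "solution q E S" "S 0 = 1" "S 1 = \<rho> 0" using solution_exists by blast
  have "S (n + 1) = \<rho> n * S n" for n
  proof (induction n rule: int_induct[where k = 0])
    case (step1 i)
    have "S (i + 1 + 1) = (of_real (q (i + 1)) - E) * (\<rho> i * S i) - S i"
      using solution_step[OF S(1), of "i + 1"] step1 by simp
    also have "\<dots> = \<rho> (i + 1) * (\<rho> i * S i)"
      using arg_cong[OF \<rho>[of "i + 1"], of "\<lambda>z. z * S i"] by (simp add: algebra_simps)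
    finally show ?case using step1 by simp
  next
    case (step2 i)
    have "S (i - 1) = (of_real (q i) - E - \<rho> i) * S i"
      using solution_step[OF S(1), of i] step2 by (simp add: algebra_simps)
    then have "\<rho> (i - 1) * S (i - 1) = S i"
      using \<rho>[of i] by (simp flip: mult.assoc)
    then show ?case by simp
  qed (use S in auto)
  with S show ?thesis by blast
qed

text \<open>
  The Weyl solution at \<open>+\<infinity>\<close> and its mirror image at \<open>-\<infinity>\<close>. All three terms in \<open>q - E - \<sigma> - \<rho>\<close> have
  imaginary parts of the same sign, so the Wronskian cannot vanish.
\<close>

lemma green_kernel_upper_half_plane:
  assumes \<eta>: "0 < Im E"
  shows "\<exists>W C \<kappa>. green_kernel 0 q E W C \<kappa>"
proof -
  let ?\<eta> = "Im E"
  obtain \<rho> where \<rho>: "\<And>n. 0 \<le> Im (\<rho> n)" "\<And>n. cmod (\<rho> n) \<le> 1 / Im E" "\<And>n. \<rho> (n - 1) * (of_real (q n) - E - \<rho> n) = 1"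
    using weyl_ratio_exists[OF \<eta>, of q] by blast
  (* The Weyl solution at minus infinity is the mirror image of the one for the reflected potential. *)
  obtain \<rho>' where \<rho>': "\<And>n. 0 \<le> Im (\<rho>' n)" "\<And>n. cmod (\<rho>' n) \<le> 1 / Im E" "\<And>n. \<rho>' (n - 1) * (of_real (q (- n)) - E - \<rho>' n) = 1"
    using weyl_ratio_exists[OF \<eta>, of "\<lambda>n. q (- n)"] by blast
  obtain S where S: "solution q E S" "S 0 = 1" "\<And>n. S (n + 1) = \<rho> n * S n"
    using solution_of_ratio[of \<rho> q E] \<rho>(3) by blast
  obtain H where H: "solution (\<lambda>n. q (- n)) E H" "H 0 = 1" "\<And>n. H (n + 1) = \<rho>' n * H n"
    using solution_of_ratio[of \<rho>' "\<lambda>n. q (- n)" E] \<rho>'(3) by blast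
  define \<sigma> where "\<sigma> n = \<rho>' (- n)" for n
  have \<sigma>: "\<sigma> (n + 1) * (of_real (q n) - E - \<sigma> n) = 1" for n
    using \<rho>'(3)[of "- n"] by (simp add: \<sigma>_def)
  have \<sigma>Im: "0 \<le> Im (\<sigma> n)" for n using \<rho>'(1) by (simp add: \<sigma>_def)
  define F0 where "F0 n = H (- n)" for n
  have F0: "solution q E F0"
    unfolding solution_def
  proof
    fix n :: int
    have a: "- n - 1 = - (n + 1)" "- n + 1 = - (n - 1)" by auto
    have "H (- (n + 1)) = (of_real (q n) - E) * H (- n) - H (- (n - 1))"
      using solution_step_back[OF H(1), of "- n"] unfolding a by simp
    then show "F0 (n + 1) = (of_real (q n) - E) * F0 n - F0 (n - 1)"
      unfolding F0_def .
  qed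
  have F0\<sigma>: "F0 n = \<sigma> (n + 1) * F0 (n + 1)" for n
    using H(3)[of "- (n + 1)"] by (simp add: F0_def \<sigma>_def)
  have wr: "S n * F0 (n + 1) - S (n + 1) * F0 n = S n * F0 n * (of_real (q n) - E - \<sigma> n - \<rho> n)" for n
  proof -
    have f: "(of_real (q n) - E - \<sigma> n) * F0 n = F0 (n + 1)"
      unfolding F0\<sigma>[of n] using \<sigma>[of n] by (metis mult.assoc mult.commute mult_1)
    show ?thesis unfolding S(3) f[symmetric] by (simp only: algebra_simps)
  qed
  define \<omega> where "\<omega> = S 0 * F0 (0 + 1) - S (0 + 1) * F0 0"
  have den: "?\<eta> \<le> cmod (of_real (q n) - E - \<sigma> n - \<rho> n)" for n
    using abs_Im_le_cmod[of "of_real (q n) - E - \<sigma> n - \<rho> n"] \<sigma>Im[of n] \<rho>(1)[of n] \<eta> by simp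
  have \<omega>0: "\<omega> \<noteq> 0"
    unfolding \<omega>_def wr using den[of 0] \<eta> S(2) H(2) by (auto simp: F0_def)
  have wc: "S n * F0 (n + 1) - S (n + 1) * F0 n = \<omega>" for n
    unfolding \<omega>_def by (rule wronskian_const[OF S(1) F0])
  define F where "F n = (1 / \<omega>) * F0 n" for n
  have F: "solution q E F" unfolding F_def by (rule solution_scale[OF F0])
  have W1: "S m * F (m + 1) - S (m + 1) * F m = 1" for m
    using wc[of m] \<omega>0 by (simp add: F_def field_simps)
  define W where "W m n = S (max m n) * F (min m n)" for m n
  define B where "B = (1 + ?\<eta>\<^sup>2) / ?\<eta>\<^sup>2"
  have diag: "cmod (S n * F n) \<le> 1 / ?\<eta>" for n
  proof -
    have "S n * F n * (of_real (q n) - E - \<sigma> n - \<rho> n) = 1"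
      using wr[of n] wc[of n] \<omega>0 by (simp add: F_def field_simps)
    then have "cmod (S n * F n) * cmod (of_real (q n) - E - \<sigma> n - \<rho> n) = 1"
      by (metis norm_mult norm_one)
    moreover have "cmod (S n * F n) * ?\<eta> \<le> cmod (S n * F n) * cmod (of_real (q n) - E - \<sigma> n - \<rho> n)"
      by (intro mult_left_mono den) auto
    ultimately show ?thesis using \<eta> by (simp add: pos_le_divide_eq)
  qed
  have half: "cmod (W m n) \<le> sqrt B / ?\<eta> * exp (- (ln (1 + ?\<eta>\<^sup>2) / 2) * \<bar>real_of_int (n - m)\<bar>)" for m n
  proof -
    let ?a = "min m n" and ?b = "max m n"
    define k where "k = nat (?b - ?a)"
    have k: "?b = ?a + int k" "\<bar>real_of_int (n - m)\<bar> = real k" by (auto simp: k_def)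
    have e: "(exp (- (ln (1 + ?\<eta>\<^sup>2) / 2) * real k))\<^sup>2 * (1 + ?\<eta>\<^sup>2) ^ k = 1"
    proof -
      have "(1 + ?\<eta>\<^sup>2) ^ k = exp (ln (1 + ?\<eta>\<^sup>2) * real k)"
        using exp_of_nat_mult[of k "ln (1 + ?\<eta>\<^sup>2)"] by (simp add: add_pos_nonneg mult.commute)
      then show ?thesis by (simp add: power2_eq_square flip: exp_add)
    qed
    let ?e2 = "(exp (- (ln (1 + ?\<eta>\<^sup>2) / 2) * real k))\<^sup>2"
    have B0: "0 \<le> B" using \<eta> by (simp add: B_def)
    have "(cmod (S ?b))\<^sup>2 * (1 + ?\<eta>\<^sup>2) ^ k \<le> B * (cmod (S ?a))\<^sup>2"
      unfolding B_def k(1) by (rule weyl_solution_decay[OF \<eta> S(3) \<rho>])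
    then have "?e2 * ((cmod (S ?b))\<^sup>2 * (1 + ?\<eta>\<^sup>2) ^ k) \<le> ?e2 * (B * (cmod (S ?a))\<^sup>2)"
      by (intro mult_left_mono) auto
    also have "?e2 * ((cmod (S ?b))\<^sup>2 * (1 + ?\<eta>\<^sup>2) ^ k) = (cmod (S ?b))\<^sup>2"
      using e by (simp only: mult.left_commute[of _ "(cmod (S ?b))\<^sup>2"] mult_1_right)
    also have "?e2 * (B * (cmod (S ?a))\<^sup>2) = (exp (- (ln (1 + ?\<eta>\<^sup>2) / 2) * real k) * (sqrt B * cmod (S ?a)))\<^sup>2"
      unfolding power_mult_distrib real_sqrt_pow2[OF B0] ..
    finally have "(cmod (S ?b))\<^sup>2 \<le> (exp (- (ln (1 + ?\<eta>\<^sup>2) / 2) * real k) * (sqrt B * cmod (S ?a)))\<^sup>2" .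
    then have "cmod (S ?b) \<le> exp (- (ln (1 + ?\<eta>\<^sup>2) / 2) * real k) * (sqrt B * cmod (S ?a))"
      by (rule power2_le_imp_le) (use B0 in simp)
    then have "cmod (S ?b) * cmod (F ?a) \<le> exp (- (ln (1 + ?\<eta>\<^sup>2) / 2) * real k) * (sqrt B * cmod (S ?a)) * cmod (F ?a)"
      by (intro mult_right_mono) auto
    also have "\<dots> = exp (- (ln (1 + ?\<eta>\<^sup>2) / 2) * real k) * sqrt B * cmod (S ?a * F ?a)"
      by (simp add: norm_mult)
    also have "\<dots> \<le> exp (- (ln (1 + ?\<eta>\<^sup>2) / 2) * real k) * sqrt B * (1 / ?\<eta>)"
      using B0 by (intro mult_left_mono diag) auto
    finally show ?thesis unfolding W_def k(2) norm_mult by (simp add: mult_ac)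
  qed
  have "green_kernel 0 q E W (sqrt B / ?\<eta>) (ln (1 + ?\<eta>\<^sup>2) / 2)"
    unfolding green_kernel_def
  proof (intro conjI allI)
    show "0 < sqrt B / ?\<eta>" using \<eta> by (simp add: B_def add_pos_pos)
    show "0 < ln (1 + ?\<eta>\<^sup>2) / 2" using \<eta> by (simp add: ln_gt_zero)
    show "- W m (n + 1) - W m (n - 1) + (of_real (q n) - E) * W m n = delta m n"
      "- W (m + 1) n - W (m - 1) n + (of_real (q m) - E) * W m n = delta m n" for m n
      unfolding W_def by (rule solution_pair_green[OF S(1) F W1])+
    show "cmod (W m n) \<le> sqrt B / ?\<eta> * exp (0 * real_of_int (n - m) - ln (1 + ?\<eta>\<^sup>2) / 2 * \<bar>real_of_int (n - m)\<bar>)" for m n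
      using half[of m n] by simp
  qed
  then show ?thesis by blast
qed

lemma green_kernel_cnj:
  assumes "green_kernel g q E W C \<kappa>"
  shows "green_kernel g q (cnj E) (\<lambda>m n. cnj (W m n)) C \<kappa>"
  unfolding green_kernel_def
proof (intro conjI allI)
  fix m n
  have d: "cnj (delta m n) = delta m n" by (simp add: delta_def)
  have "cnj (- W m (n + 1) - W m (n - 1) + (of_real (q n) - E) * W m n) = delta m n"
    using assms unfolding green_kernel_def by (metis d)
  then show "- cnj (W m (n + 1)) - cnj (W m (n - 1)) + (of_real (q n) - cnj E) * cnj (W m n) = delta m n" by simp
  have "cnj (- W (m + 1) n - W (m - 1) n + (of_real (q m) - E) * W m n) = delta m n"
    using assms unfolding green_kernel_def by (metis d)
  then show "- cnj (W (m + 1) n) - cnj (W (m - 1) n) + (of_real (q m) - cnj E) * cnj (W m n) = delta m n" by simp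
qed (use assms in \<open>auto simp: green_kernel_def\<close>)

lemma green_kernel_nonreal:
  assumes "Im E \<noteq> 0"
  shows "\<exists>W C \<kappa>. green_kernel 0 q E W C \<kappa>"
proof (cases "0 < Im E")
  case True
  then show ?thesis by (rule green_kernel_upper_half_plane)
next
  case False
  then have "0 < Im (cnj E)" using assms by simp
  from green_kernel_upper_half_plane[OF this, of q] green_kernel_cnj[of 0 q "cnj E"]
  show ?thesis by fastforce
qed

text \<open>
  With fixed constants the kernels are bounded entrywise, a subsequence converges at every pair of
  sites, and the equations involve finitely many sites.
\<close>

lemma green_kernel_limit:
  assumes G: "\<And>k. green_kernel g (q k) (E k) (W k) C \<kappa>"
    and q: "\<And>n. (\<lambda>k. q k n) \<longlonglongrightarrow> q' n" and E: "E \<longlonglongrightarrow> E'"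
  shows "\<exists>W'. green_kernel g q' E' W' C \<kappa>"
proof -
  have C: "0 < C" "0 < \<kappa>" using G by (auto simp: green_kernel_def)
  define b where "b m n = C * exp (g * real_of_int (n - m) - \<kappa> * \<bar>real_of_int (n - m)\<bar>)" for m n
  have b: "0 < b m n" for m n using C by (simp add: b_def)
  have Wb: "cmod (W k m n) \<le> b m n" for k m n using G by (auto simp: green_kernel_def b_def)
  (* The kernel bounds are not uniform in the pair of sites; dividing by them makes the family bounded by 1. *)
  define f where "f k p = W k (fst p) (snd p) / of_real (b (fst p) (snd p))" for k and p :: "int \<times> int"
  have "norm (f k p) \<le> 1" for k p
    using Wb[of k "fst p" "snd p"] b[of "fst p" "snd p"] by (simp add: f_def norm_divide)
  then obtain r :: "nat \<Rightarrow> nat" where r: "strict_mono r" "\<And>p. p \<in> UNIV \<Longrightarrow> \<exists>l. (\<lambda>k. f (r k) p) \<longlonglongrightarrow> l"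
    using function_convergent_subsequence[of "UNIV :: (int \<times> int) set" f 1] by blast
  then obtain l where l: "\<And>p. (\<lambda>k. f (r k) p) \<longlonglongrightarrow> l p" by (metis UNIV_I)
  define W' where "W' m n = of_real (b m n) * l (m, n)" for m n
  have lim: "(\<lambda>k. W (r k) m n) \<longlonglongrightarrow> W' m n" for m n
  proof -
    have "(\<lambda>k. of_real (b m n) * f (r k) (m, n)) \<longlonglongrightarrow> W' m n"
      unfolding W'_def by (intro tendsto_intros l)
    moreover have "of_real (b m n) * f (r k) (m, n) = W (r k) m n" for k
      using b[of m n] by (simp add: f_def)
    ultimately show ?thesis by simp
  qed
  have ql: "(\<lambda>k. q (r k) n) \<longlonglongrightarrow> q' n" for n
    using LIMSEQ_subseq_LIMSEQ[OF q r(1)] by (simp add: o_def)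
  have El: "(\<lambda>k. E (r k)) \<longlonglongrightarrow> E'"
    using LIMSEQ_subseq_LIMSEQ[OF E r(1)] by (simp add: o_def)
  have "green_kernel g q' E' W' C \<kappa>"
    unfolding green_kernel_def
  proof (intro conjI allI C)
    fix m n
    have "(\<lambda>k. - W (r k) m (n + 1) - W (r k) m (n - 1) + (of_real (q (r k) n) - E (r k)) * W (r k) m n)
        \<longlonglongrightarrow> - W' m (n + 1) - W' m (n - 1) + (of_real (q' n) - E') * W' m n"
      by (intro tendsto_intros lim ql El)
    moreover have "- W (r k) m (n + 1) - W (r k) m (n - 1) + (of_real (q (r k) n) - E (r k)) * W (r k) m n = delta m n" for k
      using G[of "r k"] by (simp add: green_kernel_def)
    ultimately show "- W' m (n + 1) - W' m (n - 1) + (of_real (q' n) - E') * W' m n = delta m n"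
      by (simp add: LIMSEQ_const_iff)
    have "(\<lambda>k. - W (r k) (m + 1) n - W (r k) (m - 1) n + (of_real (q (r k) m) - E (r k)) * W (r k) m n)
        \<longlonglongrightarrow> - W' (m + 1) n - W' (m - 1) n + (of_real (q' m) - E') * W' m n"
      by (intro tendsto_intros lim ql El)
    moreover have "- W (r k) (m + 1) n - W (r k) (m - 1) n + (of_real (q (r k) m) - E (r k)) * W (r k) m n = delta m n" for k
      using G[of "r k"] by (simp add: green_kernel_def)
    ultimately show "- W' (m + 1) n - W' (m - 1) n + (of_real (q' m) - E') * W' m n = delta m n"
      by (simp add: LIMSEQ_const_iff)
    show "cmod (W' m n) \<le> C * exp (g * real_of_int (n - m) - \<kappa> * \<bar>real_of_int (n - m)\<bar>)"
      unfolding b_def[symmetric] by (rule tendsto_upperbound[OF tendsto_norm[OF lim]]) (use Wb in auto)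
  qed
  then show ?thesis by blast
qed

text \<open>
  For real \<open>E\<close> the kernels at \<open>E + \<i>/k\<close> exist, and the lower bound makes their decay uniform in \<open>k\<close>; their
  limit is a kernel at \<open>E\<close>.
\<close>

lemma green_kernel_of_coercive:
  assumes C: "coercive 0 q E C" and q: "\<And>n. \<bar>q n\<bar> \<le> M"
  shows "\<exists>W C \<kappa>. green_kernel 0 q E W C \<kappa>"
proof (cases "Im E = 0")
  case False
  then show ?thesis by (rule green_kernel_nonreal)
next
  case True
  have C0: "0 < C" using C by (simp add: coercive_def)
  (* The factor 2 in the rate condition pays for the constant 2 C of the perturbed energies. *)
  obtain \<kappa> where \<kappa>: "0 < \<kappa>" "(2 * C) * ((exp \<kappa> - 1) * (exp 0 + exp (- 0))) \<le> 1/2"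
    using combes_thomas_rate_exists[of "2 * C" 0] C0 by auto
  obtain k0 :: nat where k0: "2 * C < real k0" using reals_Archimedean2 by blast
  define e where "e k = inverse (real (Suc (k + k0)))" for k
  have e0: "0 < e k" for k by (simp add: e_def)
  define E' where "E' k = E + \<i> * of_real (e k)" for k
  have "\<exists>W. green_kernel 0 q (E' k) W (2 * (2 * C)) \<kappa>" for k
  proof -
    have "cmod (E - E' k) = e k" using e0[of k] by (simp add: E'_def norm_mult)
    moreover have "C * e k \<le> 1/2" using k0 C0 by (simp add: e_def field_simps)
    ultimately have co: "coercive 0 q (E' k) (2 * C)" by (intro coercive_perturb[OF C q]) simp
    have "Im (E' k) \<noteq> 0" using True e0[of k] by (simp add: E'_def)
    then obtain W D \<kappa>' where W: "green_kernel 0 q (E' k) W D \<kappa>'" using green_kernel_nonreal by blast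
    have t: "tilt 0 W m = W m" for m by (simp add: tilt_def fun_eq_iff)
    have "cmod (W m n) \<le> 2 * (2 * C) * exp (- \<kappa> * \<bar>real_of_int (n - m)\<bar>)" for m n
      using combes_thomas[OF co q \<kappa>] green_kernel_tilt(1,4)[OF W, of m] unfolding t by blast
    then have "green_kernel 0 q (E' k) W (2 * (2 * C)) \<kappa>"
      using W C0 \<kappa>(1) by (simp add: green_kernel_def)
    then show ?thesis by blast
  qed
  then obtain W where W: "\<And>k. green_kernel 0 q (E' k) (W k) (2 * (2 * C)) \<kappa>" by metis
  have "E' \<longlonglongrightarrow> E + \<i> * of_real 0"
    unfolding E'_def e_def
    by (intro tendsto_intros LIMSEQ_ignore_initial_segment[OF LIMSEQ_inverse_real_of_nat, of k0, unfolded add_Suc])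
  then have "E' \<longlonglongrightarrow> E" by simp
  from green_kernel_limit[OF W _ this, of q] show ?thesis by auto
qed

section \<open>Factorization of Green kernels\<close>

lemma solution_from: "\<exists>w. solution q E w \<and> w m = a \<and> w (m + 1) = b"
proof -
  obtain w where w: "solution (\<lambda>n. q (n + m)) E w" "w 0 = a" "w 1 = b"
    using solution_exists by blast
  have "solution q E (\<lambda>n. w (n - m))"
    unfolding solution_def
  proof
    fix n
    have "w (n - m + 1) = (of_real (q (n - m + m)) - E) * w (n - m) - w (n - m - 1)"
      by (rule solution_step[OF w(1)])
    moreover have "n - m + 1 = n + 1 - m" "n - m + m = n" "n - m - 1 = n - 1 - m" by auto
    ultimately show "w (n + 1 - m) = (of_real (q n) - E) * w (n - m) - w (n - 1 - m)" by simp
  qed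
  then show ?thesis using w(2,3) by (intro exI[of _ "\<lambda>n. w (n - m)"]) simp
qed

lemma solution_unique:
  assumes "solution q E u" "solution q E w" "u m = w m" "u (m + 1) = w (m + 1)"
  shows "u n = w n"
  using solution_zero[OF solution_lincomb[OF assms(1,2), of 1 "-1"], of m n] assms(3,4) by simp

lemma right_agree:
  assumes w: "solution q E w" and eq: "\<And>n. m < n \<Longrightarrow> u (n + 1) = (of_real (q n) - E) * u n - u (n - 1)"
    and init: "w m = u m" "w (m + 1) = u (m + 1)" and n: "m \<le> n"
  shows "w n = u n"
proof -
  have "w n = u n \<and> w (n + 1) = u (n + 1)"
    using n
  proof (induction n rule: int_ge_induct)
    case (step i)
    then show ?case using solution_step[OF w, of "i + 1"] eq[of "i + 1"] by simp
  qed (use init in simp)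
  then show ?thesis ..
qed

lemma left_agree:
  assumes w: "solution q E w" and eq: "\<And>n. n < m \<Longrightarrow> u (n - 1) = (of_real (q n) - E) * u n - u (n + 1)"
    and init: "w m = u m" "w (m - 1) = u (m - 1)" and n: "n \<le> m"
  shows "w n = u n"
proof -
  have "w n = u n \<and> w (n - 1) = u (n - 1)"
    using n
  proof (induction n rule: int_le_induct)
    case (step i)
    then show ?case using solution_step_back[OF w, of "i - 1"] eq[of "i - 1"] by simp
  qed (use init in simp)
  then show ?thesis ..
qed

lemma solution_span:
  assumes u: "solution q E u" and w: "solution q E w" and y: "solution q E y"
    and ne: "u m * w (m + 1) - u (m + 1) * w m = d" "d \<noteq> 0"
  shows "y n = (y m * w (m + 1) - y (m + 1) * w m) / d * u n + (u m * y (m + 1) - u (m + 1) * y m) / d * w n"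
proof (rule solution_unique[OF y solution_lincomb[OF u w], of m])
  let ?a = "y m * w (m + 1) - y (m + 1) * w m" and ?b = "u m * y (m + 1) - u (m + 1) * y m"
  have "?a * u m + ?b * w m = y m * d" unfolding ne(1)[symmetric] by (simp add: algebra_simps)
  then show "y m = ?a / d * u m + ?b / d * w m" using ne(2) by (simp add: field_simps)
  have "?a * u (m + 1) + ?b * w (m + 1) = y (m + 1) * d" unfolding ne(1)[symmetric] by (simp add: algebra_simps)
  then show "y (m + 1) = ?a / d * u (m + 1) + ?b / d * w (m + 1)" using ne(2) by (simp add: field_simps)
qed

lemma solution_proportional:
  assumes u: "solution q E u" and w: "solution q E w"
    and zero: "u 0 * w (0 + 1) - u (0 + 1) * w 0 = 0" and nz: "w k \<noteq> 0"
  shows "\<exists>a. \<forall>n. u n = a * w n"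
proof -
  have w0: "w 0 \<noteq> 0 \<or> w (0 + 1) \<noteq> 0" using solution_zero[OF w, of 0 k] nz by auto
  define a where "a = (if w 0 \<noteq> 0 then u 0 / w 0 else u (0 + 1) / w (0 + 1))"
  have "u 0 = a * w 0" "u (0 + 1) = a * w (0 + 1)"
    using w0 zero by (auto simp: a_def field_simps)
  then have "u n = a * w n" for n
    by (rule solution_unique[OF u solution_scale[OF w]])
  then show ?thesis by blast
qed

text \<open>
  Growth conditions at one end only: the constants are immaterial, since only the dimension of the
  space of solutions satisfying them matters.
\<close>

definition slow_right :: "real \<Rightarrow> (int \<Rightarrow> complex) \<Rightarrow> bool" where
  "slow_right a w \<longleftrightarrow> (\<exists>c N. \<forall>n\<ge>N. cmod (w n) \<le> c * exp (a * real_of_int n))"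

definition slow_left :: "real \<Rightarrow> (int \<Rightarrow> complex) \<Rightarrow> bool" where
  "slow_left a w \<longleftrightarrow> (\<exists>c N. \<forall>n\<le>N. cmod (w n) \<le> c * exp (a * real_of_int n))"

lemma slow_right_lincomb:
  assumes "slow_right a u" "slow_right a w"
  shows "slow_right a (\<lambda>n. \<alpha> * u n + \<beta> * w n)"
proof -
  obtain c N c' N' where b: "\<And>n. N \<le> n \<Longrightarrow> cmod (u n) \<le> c * exp (a * real_of_int n)"
    "\<And>n. N' \<le> n \<Longrightarrow> cmod (w n) \<le> c' * exp (a * real_of_int n)"
    using assms unfolding slow_right_def by blast
  have "cmod (\<alpha> * u n + \<beta> * w n) \<le> (cmod \<alpha> * c + cmod \<beta> * c') * exp (a * real_of_int n)"
    if "max N N' \<le> n" for n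
  proof -
    have "cmod (\<alpha> * u n + \<beta> * w n) \<le> cmod \<alpha> * cmod (u n) + cmod \<beta> * cmod (w n)"
      using norm_triangle_ineq[of "\<alpha> * u n" "\<beta> * w n"] by (simp add: norm_mult)
    also have "\<dots> \<le> cmod \<alpha> * (c * exp (a * real_of_int n)) + cmod \<beta> * (c' * exp (a * real_of_int n))"
      using that by (intro add_mono mult_left_mono b) auto
    finally show ?thesis by (simp add: algebra_simps)
  qed
  then show ?thesis unfolding slow_right_def by blast
qed

lemma slow_left_lincomb:
  assumes "slow_left a u" "slow_left a w"
  shows "slow_left a (\<lambda>n. \<alpha> * u n + \<beta> * w n)"
proof -
  obtain c N c' N' where b: "\<And>n. n \<le> N \<Longrightarrow> cmod (u n) \<le> c * exp (a * real_of_int n)"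
    "\<And>n. n \<le> N' \<Longrightarrow> cmod (w n) \<le> c' * exp (a * real_of_int n)"
    using assms unfolding slow_left_def by blast
  have "cmod (\<alpha> * u n + \<beta> * w n) \<le> (cmod \<alpha> * c + cmod \<beta> * c') * exp (a * real_of_int n)"
    if "n \<le> min N N'" for n
  proof -
    have "cmod (\<alpha> * u n + \<beta> * w n) \<le> cmod \<alpha> * cmod (u n) + cmod \<beta> * cmod (w n)"
      using norm_triangle_ineq[of "\<alpha> * u n" "\<beta> * w n"] by (simp add: norm_mult)
    also have "\<dots> \<le> cmod \<alpha> * (c * exp (a * real_of_int n)) + cmod \<beta> * (c' * exp (a * real_of_int n))"
      using that by (intro add_mono mult_left_mono b) auto
    finally show ?thesis by (simp add: algebra_simps)
  qed
  then show ?thesis unfolding slow_left_def by blast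
qed

lemma exp_linear_tendsto_0:
  fixes a c :: real
  assumes "0 < a"
  shows "(\<lambda>k. c * exp (- a * real k)) \<longlonglongrightarrow> 0"
proof -
  have "(\<lambda>k. c * exp (- a) ^ k) \<longlonglongrightarrow> 0"
    using assms by (intro tendsto_mult_right_zero LIMSEQ_power_zero) simp
  then show ?thesis by (simp add: exp_of_nat_mult[symmetric] mult.commute)
qed

lemma wronskian_le:
  fixes a b c d :: complex
  assumes "cmod a \<le> A" "cmod b \<le> A" "cmod c \<le> B" "cmod d \<le> B"
  shows "cmod (a * c - b * d) \<le> 2 * (A * B)"
proof -
  have "0 \<le> A" using assms(1) norm_ge_zero order_trans by blast
  then have "cmod a * cmod c + cmod b * cmod d \<le> A * B + A * B"
    using assms by (intro add_mono mult_mono) auto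
  then show ?thesis using norm_triangle_ineq4[of "a * c" "b * d"] by (simp add: norm_mult)
qed

text \<open>
  The Wronskian is constant but tends to zero at \<open>-\<infinity>\<close>, so solutions decaying to the left form a space
  of dimension at most one.
\<close>

lemma slow_left_wronskian_zero:
  assumes u: "solution q E u" "slow_left a u" and w: "solution q E w" "slow_left a w" and a: "0 < a"
  shows "u 0 * w (0 + 1) - u (0 + 1) * w 0 = 0"
proof -
  obtain c N c' N' where b: "\<And>n. n \<le> N \<Longrightarrow> cmod (u n) \<le> c * exp (a * real_of_int n)"
    "\<And>n. n \<le> N' \<Longrightarrow> cmod (w n) \<le> c' * exp (a * real_of_int n)"
    using u(2) w(2) unfolding slow_left_def by blast
  let ?\<omega> = "u 0 * w (0 + 1) - u (0 + 1) * w 0"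
  have le: "cmod ?\<omega> \<le> 2 * (\<bar>c\<bar> * exp a * (\<bar>c'\<bar> * exp a)) * exp (- a * real k)" if k: "max 0 (max (1 - N) (1 - N')) \<le> int k" for k
  proof -
    let ?n = "- int k"
    have e1: "c * exp (a * real_of_int n) \<le> \<bar>c\<bar> * exp a * exp (- a * real k)"
      and e2: "c' * exp (a * real_of_int n) \<le> \<bar>c'\<bar> * exp a" if "n = ?n \<or> n = ?n + 1" for n
    proof -
      have "a * real_of_int n \<le> a * (1 - real k)" using that a by (intro mult_left_mono) auto
      then have "exp (a * real_of_int n) \<le> exp a * exp (- a * real k)"
        by (simp add: algebra_simps flip: exp_add)
      then have "\<bar>c\<bar> * exp (a * real_of_int n) \<le> \<bar>c\<bar> * (exp a * exp (- a * real k))" by (intro mult_left_mono) auto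
      moreover have "c * exp (a * real_of_int n) \<le> \<bar>c\<bar> * exp (a * real_of_int n)" by (intro mult_right_mono) auto
      ultimately show "c * exp (a * real_of_int n) \<le> \<bar>c\<bar> * exp a * exp (- a * real k)" unfolding mult.assoc by linarith
      have "a * real_of_int n \<le> a * 1" using that a by (intro mult_left_mono) auto
      then have "\<bar>c'\<bar> * exp (a * real_of_int n) \<le> \<bar>c'\<bar> * exp a" by (intro mult_left_mono) auto
      moreover have "c' * exp (a * real_of_int n) \<le> \<bar>c'\<bar> * exp (a * real_of_int n)" by (intro mult_right_mono) auto
      ultimately show "c' * exp (a * real_of_int n) \<le> \<bar>c'\<bar> * exp a" by linarith
    qed
    have "?\<omega> = u ?n * w (?n + 1) - u (?n + 1) * w ?n" by (rule wronskian_const[OF u(1) w(1)])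
    also have "cmod \<dots> \<le> 2 * ((\<bar>c\<bar> * exp a * exp (- a * real k)) * (\<bar>c'\<bar> * exp a))"
      using k by (intro wronskian_le order_trans[OF b(1) e1] order_trans[OF b(2) e2]) auto
    finally show ?thesis by (simp add: mult_ac)
  qed
  have "eventually (\<lambda>k. cmod ?\<omega> \<le> 2 * (\<bar>c\<bar> * exp a * (\<bar>c'\<bar> * exp a)) * exp (- a * real k)) sequentially"
    using eventually_ge_at_top[of "nat (max 0 (max (1 - N) (1 - N')))"]
    by eventually_elim (rule le, linarith)
  then have "cmod ?\<omega> \<le> 0"
    by (intro tendsto_lowerbound[OF exp_linear_tendsto_0[OF a]]) auto
  then show ?thesis by simp
qed

lemma slow_right_not_all:
  assumes a: "0 < a"
  shows "\<exists>w. solution q E w \<and> \<not> slow_right (- a) w"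
proof (rule ccontr)
  assume "\<not> ?thesis"
  then have all: "\<And>w. solution q E w \<Longrightarrow> slow_right (- a) w" by blast
  obtain u where u: "solution q E u" "u 0 = 1" "u 1 = 0" using solution_exists by blast
  obtain w where w: "solution q E w" "w 0 = 0" "w 1 = 1" using solution_exists by blast
  have refl: "solution (\<lambda>n. q (- n)) E (\<lambda>n. y (- n))" "slow_left a (\<lambda>n. y (- n))" if y: "solution q E y" for y
  proof -
    show "solution (\<lambda>n. q (- n)) E (\<lambda>n. y (- n))"
      unfolding solution_def
    proof
      fix n :: int
      have "- (n + 1) = - n - 1" "- (n - 1) = - n + 1" by auto
      then show "y (- (n + 1)) = (of_real (q (- n)) - E) * y (- n) - y (- (n - 1))"
        using solution_step_back[OF y, of "- n"] by simp
    qed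
    obtain c N where "\<And>n. N \<le> n \<Longrightarrow> cmod (y n) \<le> c * exp (- a * real_of_int n)"
      using all[OF y] unfolding slow_right_def by blast
    from this[of "- _"] have "\<forall>n\<le>-N. cmod (y (- n)) \<le> c * exp (a * real_of_int n)" by simp
    then show "slow_left a (\<lambda>n. y (- n))" unfolding slow_left_def by blast
  qed
  have "u 0 * w (- 1) - u (- 1) * w 0 = 0"
    using slow_left_wronskian_zero[OF refl[OF u(1)] refl[OF w(1)] a] by simp
  moreover have "w (- 1) = - 1" using solution_step_back[OF w(1), of 0] w by simp
  ultimately show False using u w by simp
qed

text \<open>
  Column \<open>m\<close> of the kernel continues from its right part to a solution \<open>s\<close> and from its left part to a
  solution \<open>f\<close>; they agree at \<open>m\<close> and differ by one at \<open>m + 1\<close>. Two such columns show that every solution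
  is a difference of a left-decaying and a right-slow one. The left-decaying ones are multiples of one \<open>F\<close>;
  as not every solution is right-slow, the right-slow ones are multiples of one \<open>S\<close>.
  The two conditions at \<open>m\<close> and \<open>m + 1\<close> then determine the coefficients.
\<close>

lemma green_kernel_factorization:
  assumes G: "green_kernel g q E W C \<kappa>" and g: "0 \<le> g"
    and NS: "\<exists>w. solution q E w \<and> \<not> slow_right (g - \<kappa>) w"
  obtains S F where "solution q E S" and "solution q E F"
    and "\<And>n. S n * F (n + 1) - S (n + 1) * F n = 1"
    and "\<And>m n. W m n = S (max m n) * F (min m n)"
proof -
  have C: "0 < C" "0 < \<kappa>"
    and col: "\<And>m n. - W m (n + 1) - W m (n - 1) + (of_real (q n) - E) * W m n = delta m n"
    and bd: "\<And>m n. cmod (W m n) \<le> C * exp (g * real_of_int (n - m) - \<kappa> * \<bar>real_of_int (n - m)\<bar>)"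
    using G by (auto simp: green_kernel_def)
  let ?R = "\<lambda>w. solution q E w \<and> slow_right (g - \<kappa>) w"
  let ?L = "\<lambda>w. solution q E w \<and> slow_left (g + \<kappa>) w"
  have a: "0 < g + \<kappa>" using g C by simp
  have "\<exists>s. ?R s \<and> (\<forall>n\<ge>m. s n = W m n)" for m
  proof -
    obtain s where s: "solution q E s" "s m = W m m" "s (m + 1) = W m (m + 1)"
      using solution_from by blast
    have ag: "s n = W m n" if "m \<le> n" for n
    proof (rule right_agree[OF s(1) _ s(2,3) that])
      fix n assume "m < n"
      then show "W m (n + 1) = (of_real (q n) - E) * W m n - W m (n - 1)"
        using col[of m n] by (simp add: delta_def algebra_simps)
    qed
    have "cmod (s n) \<le> C * exp (- (g - \<kappa>) * real_of_int m) * exp ((g - \<kappa>) * real_of_int n)" if "m \<le> n" for n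
    proof -
      have "cmod (s n) \<le> C * exp (g * real_of_int (n - m) - \<kappa> * \<bar>real_of_int (n - m)\<bar>)"
        using ag[OF that] bd by simp
      also have "g * real_of_int (n - m) - \<kappa> * \<bar>real_of_int (n - m)\<bar>
          = - (g - \<kappa>) * real_of_int m + (g - \<kappa>) * real_of_int n"
        using that by (simp add: algebra_simps)
      finally show ?thesis unfolding exp_add by (simp only: mult.assoc)
    qed
    then have "slow_right (g - \<kappa>) s" unfolding slow_right_def by blast
    then show ?thesis using s(1) ag by blast
  qed
  then obtain s where s: "\<And>m. ?R (s m)" "\<And>m n. m \<le> n \<Longrightarrow> s m n = W m n" by metis
  have "\<exists>f. ?L f \<and> (\<forall>n\<le>m. f n = W m n)" for m
  proof -
    obtain f where f: "solution q E f" "f (m - 1) = W m (m - 1)" "f m = W m m"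
      using solution_from[of q E "m - 1"] by auto
    have ag: "f n = W m n" if "n \<le> m" for n
    proof (rule left_agree[OF f(1) _ f(3,2) that])
      fix n assume "n < m"
      then show "W m (n - 1) = (of_real (q n) - E) * W m n - W m (n + 1)"
        using col[of m n] by (simp add: delta_def algebra_simps)
    qed
    have "cmod (f n) \<le> C * exp (- (g + \<kappa>) * real_of_int m) * exp ((g + \<kappa>) * real_of_int n)" if "n \<le> m" for n
    proof -
      have "cmod (f n) \<le> C * exp (g * real_of_int (n - m) - \<kappa> * \<bar>real_of_int (n - m)\<bar>)"
        using ag[OF that] bd by simp
      also have "g * real_of_int (n - m) - \<kappa> * \<bar>real_of_int (n - m)\<bar>
          = - (g + \<kappa>) * real_of_int m + (g + \<kappa>) * real_of_int n"
        using that by (simp add: algebra_simps)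
      finally show ?thesis unfolding exp_add by (simp only: mult.assoc)
    qed
    then have "slow_left (g + \<kappa>) f" unfolding slow_left_def by blast
    then show ?thesis using f(1) ag by blast
  qed
  then obtain f where f: "\<And>m. ?L (f m)" "\<And>m n. n \<le> m \<Longrightarrow> f m n = W m n" by metis
  have d: "f m m - s m m = 0" "f m (m + 1) - s m (m + 1) = 1" for m
  proof -
    show "f m m - s m m = 0" using f(2)[of m m] s(2)[of m m] by simp
    have "f m (m + 1) = (of_real (q m) - E) * W m m - W m (m - 1)"
      using solution_step[of q E "f m" m] f(1)[of m] f(2)[of m m] f(2)[of "m - 1" m] by simp
    then show "f m (m + 1) - s m (m + 1) = 1"
      using col[of m m] s(2)[of m "m + 1"] by (simp add: delta_def algebra_simps)
  qed
  have Rlin: "?R (\<lambda>n. \<alpha> * u n + \<beta> * w n)" if "?R u" "?R w" for u w \<alpha> \<beta>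
    using that solution_lincomb slow_right_lincomb by blast
  have Llin: "?L (\<lambda>n. \<alpha> * u n + \<beta> * w n)" if "?L u" "?L w" for u w \<alpha> \<beta>
    using that solution_lincomb slow_left_lincomb by blast
  have decomp: "\<exists>y z. ?L y \<and> ?R z \<and> (\<forall>n. w n = y n - z n)" if w: "solution q E w" for w
  proof -
    (* The differences for the columns -1 and 0 have the data (1, _) and (0, 1) at the sites 0 and 1 and so
     span all solutions. *)
    define d1 where "d1 n = f (-1) n - s (-1) n" for n
    define d0 where "d0 n = f 0 n - s 0 n" for n
    define \<beta> where "\<beta> = w 1 - w 0 * d1 1"
    have sol: "solution q E d1" "solution q E d0"
      using solution_lincomb[of q E "f _" "s _" 1 "-1"] f(1) s(1) unfolding d1_def d0_def by auto
    have i: "d1 0 = 1" "d0 0 = 0" "d0 1 = 1" unfolding d1_def d0_def using d[of "-1"] d[of 0] by auto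
    have "w n = w 0 * d1 n + \<beta> * d0 n" for n
      by (rule solution_unique[OF w solution_lincomb[OF sol], of 0]) (auto simp: \<beta>_def i)
    then have "w n = (w 0 * f (-1) n + \<beta> * f 0 n) - (w 0 * s (-1) n + \<beta> * s 0 n)" for n
      by (simp add: d1_def d0_def algebra_simps)
    then show ?thesis using Llin[OF f(1) f(1)] Rlin[OF s(1) s(1)] by blast
  qed
  have wL: "u 0 * w (0 + 1) - u (0 + 1) * w 0 = 0" if "?L u" "?L w" for u w
    using that a slow_left_wronskian_zero by blast
  obtain w0 where w0: "solution q E w0" "\<not> slow_right (g - \<kappa>) w0" using NS by blast
  (* F is the left-decaying part of a solution that is not slow to the right, hence nonzero. *)
  obtain F0 z0 where F0: "?L F0" "?R z0" "\<And>n. w0 n = F0 n - z0 n" using decomp[OF w0(1)] by blast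
  have "\<exists>k. F0 k \<noteq> 0"
  proof (rule ccontr)
    assume "\<not> ?thesis"
    then have "w0 = (\<lambda>n. 0 * z0 n + -1 * z0 n)" using F0(3) by (simp add: fun_eq_iff)
    then show False using Rlin[OF F0(2) F0(2), of 0 "-1"] w0(2) by simp
  qed
  then obtain k where k: "F0 k \<noteq> 0" by blast
  (* If all right-slow solutions were parallel to F0, every solution would be, by the decomposition. *)
  have "\<exists>S. ?R S \<and> S 0 * F0 (0 + 1) - S (0 + 1) * F0 0 \<noteq> 0"
  proof (rule ccontr)
    assume no: "\<not> ?thesis"
    have all0: "u 0 * F0 (0 + 1) - u (0 + 1) * F0 0 = 0" if u: "solution q E u" for u
    proof -
      obtain y z where yz: "?L y" "?R z" "\<And>n. u n = y n - z n" using decomp[OF u] by blast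
      have "y 0 * F0 (0 + 1) - y (0 + 1) * F0 0 = 0" by (rule wL[OF yz(1) F0(1)])
      moreover have "z 0 * F0 (0 + 1) - z (0 + 1) * F0 0 = 0" using no yz(2) by blast
      ultimately show ?thesis unfolding yz(3) by (simp add: algebra_simps)
    qed
    obtain u1 where u1: "solution q E u1" "u1 0 = 1" "u1 1 = 0" using solution_exists by blast
    obtain u2 where u2: "solution q E u2" "u2 0 = 0" "u2 1 = 1" using solution_exists by blast
    have "F0 (0 + 1) = 0" "F0 0 = 0" using all0[OF u1(1)] all0[OF u2(1)] u1 u2 by auto
    then have "F0 k = 0" using solution_zero[of q E F0 0 k] F0(1) by blast
    then show False using k by simp
  qed
  then obtain S where S: "?R S" "S 0 * F0 (0 + 1) - S (0 + 1) * F0 0 \<noteq> 0" by blast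
  define \<omega> where "\<omega> = S 0 * F0 (0 + 1) - S (0 + 1) * F0 0"
  define F where "F n = (1 / \<omega>) * F0 n" for n
  have F: "?L F" using Llin[OF F0(1) F0(1), of "1 / \<omega>" 0] unfolding F_def by simp
  have W1: "S n * F (n + 1) - S (n + 1) * F n = 1" for n
  proof -
    have "S n * F0 (n + 1) - S (n + 1) * F0 n = \<omega>"
      unfolding \<omega>_def using S(1) F0(1) by (intro wronskian_const) auto
    then show ?thesis using S(2) unfolding \<omega>_def[symmetric] F_def by (simp add: field_simps)
  qed
  have S0: "\<exists>k. S k \<noteq> 0" using W1[of 0] by (metis diff_self mult_zero_left zero_neq_one)
  have Fk: "\<exists>k. F k \<noteq> 0" using W1[of 0] by (metis diff_self mult_zero_right zero_neq_one)
  have wR: "u 0 * S (0 + 1) - u (0 + 1) * S 0 = 0" if u: "?R u" for u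
  proof (rule ccontr)
    assume ne: "u 0 * S (0 + 1) - u (0 + 1) * S 0 \<noteq> 0"
    let ?d = "u 0 * S (0 + 1) - u (0 + 1) * S 0"
    define \<alpha> where "\<alpha> = (w0 0 * S (0 + 1) - w0 (0 + 1) * S 0) / ?d"
    define \<beta> where "\<beta> = (u 0 * w0 (0 + 1) - u (0 + 1) * w0 0) / ?d"
    have "w0 n = \<alpha> * u n + \<beta> * S n" for n
      unfolding \<alpha>_def \<beta>_def using u S(1) w0(1) ne by (intro solution_span) auto
    then have eq: "w0 = (\<lambda>n. \<alpha> * u n + \<beta> * S n)" by blast
    have "slow_right (g - \<kappa>) w0"
      by (subst eq) (rule conjunct2[OF Rlin[OF u S(1)]])
    then show False using w0(2) by blast
  qed
  have WSF: "W m n = S (max m n) * F (min m n)" for m n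
  proof -
    obtain k1 k2 where k12: "S k1 \<noteq> 0" "F k2 \<noteq> 0" using S0 Fk by blast
    have "\<exists>a. \<forall>n. s m n = a * S n"
      using solution_proportional[OF _ _ wR[of "s m", OF s(1)] k12(1)] s(1) S(1) by blast
    then obtain a where a: "\<And>n. s m n = a * S n" by blast
    have "\<exists>b. \<forall>n. f m n = b * F n"
      using solution_proportional[OF _ _ wL[of "f m" F, OF f(1) F] k12(2)] f(1) F by blast
    then obtain b where b: "\<And>n. f m n = b * F n" by blast
    have e: "b * F m = a * S m" "b * F (m + 1) - a * S (m + 1) = 1" using d[of m] a b by auto
    have "a = F m" using e W1[of m] by algebra
    moreover have "b = S m" using e W1[of m] by algebra
    ultimately show ?thesis
      using s(2)[of m n] f(2)[of n m] a b by (cases "m \<le> n") (auto simp: max_def min_def mult.commute)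
  qed
  show thesis using that[of S F] S(1) F W1 WSF by blast
qed

text \<open>
  Symmetry transfers the decay rate \<open>g + \<kappa>\<close>, which is built into the left half, to the right half.
\<close>

lemma green_kernel_symmetric_decay:
  assumes G: "green_kernel g q E W C \<kappa>" and g: "0 \<le> g"
    and NS: "\<exists>w. solution q E w \<and> \<not> slow_right (g - \<kappa>) w"
  shows "W m n = W n m" and "cmod (W m n) \<le> C * exp (- (g + \<kappa>) * \<bar>real_of_int (n - m)\<bar>)"
proof -
  obtain S F where "\<And>m n. W m n = S (max m n) * F (min m n)"
    using green_kernel_factorization[OF G g NS] by metis
  then have sym: "W m n = W n m" for m n by (simp add: max.commute min.commute)
  show "W m n = W n m" by (rule sym)
  have bd: "\<And>m n. cmod (W m n) \<le> C * exp (g * real_of_int (n - m) - \<kappa> * \<bar>real_of_int (n - m)\<bar>)"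
    using G by (auto simp: green_kernel_def)
  have *: "cmod (W m n) \<le> C * exp (- (g + \<kappa>) * \<bar>real_of_int (n - m)\<bar>)" if "n \<le> m" for m n
  proof -
    have "g * real_of_int (n - m) - \<kappa> * \<bar>real_of_int (n - m)\<bar> = - (g + \<kappa>) * \<bar>real_of_int (n - m)\<bar>"
      using that by (simp add: algebra_simps)
    then show ?thesis using bd[of m n] by metis
  qed
  show "cmod (W m n) \<le> C * exp (- (g + \<kappa>) * \<bar>real_of_int (n - m)\<bar>)"
  proof (cases "n \<le> m")
    case False
    then show ?thesis using *[of m n] sym[of m n] by (simp add: abs_minus_commute)
  qed (rule *)
qed

lemma green_kernel_of_symmetric_decay:
  assumes G: "green_kernel g q E W C \<kappa>" and C': "0 < C'"
    and dec: "\<And>m n. cmod (W m n) \<le> C' * exp (- \<Lambda> * \<bar>real_of_int (n - m)\<bar>)" and g': "\<bar>g'\<bar> < \<Lambda>"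
  shows "green_kernel g' q E W C' (\<Lambda> - \<bar>g'\<bar>)"
  unfolding green_kernel_def
proof (intro conjI allI)
  fix m n
  have "- (\<bar>g'\<bar> * \<bar>real_of_int (n - m)\<bar>) \<le> g' * real_of_int (n - m)"
    by (metis abs_ge_minus_self abs_mult minus_le_iff)
  then have "- \<Lambda> * \<bar>real_of_int (n - m)\<bar> \<le> g' * real_of_int (n - m) - (\<Lambda> - \<bar>g'\<bar>) * \<bar>real_of_int (n - m)\<bar>"
    by (simp add: algebra_simps)
  then have "C' * exp (- \<Lambda> * \<bar>real_of_int (n - m)\<bar>) \<le> C' * exp (g' * real_of_int (n - m) - (\<Lambda> - \<bar>g'\<bar>) * \<bar>real_of_int (n - m)\<bar>)"
    using C' by simp
  then show "cmod (W m n) \<le> C' * exp (g' * real_of_int (n - m) - (\<Lambda> - \<bar>g'\<bar>) * \<bar>real_of_int (n - m)\<bar>)"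
    using dec[of m n] by linarith
qed (use assms in \<open>auto simp: green_kernel_def\<close>)

section \<open>Green kernels along the orbits of the dynamics\<close>

lemma norm_vec2_bounds:
  fixes a b :: complex
  shows "cmod a \<le> norm (vector [a, b] :: complex ^ 2)" "cmod b \<le> norm (vector [a, b] :: complex ^ 2)"
    "norm (vector [a, b] :: complex ^ 2) \<le> cmod a + cmod b"
proof -
  show "cmod a \<le> norm (vector [a, b] :: complex ^ 2)" "cmod b \<le> norm (vector [a, b] :: complex ^ 2)"
    using Finite_Cartesian_Product.norm_nth_le[of "vector [a, b] :: complex ^ 2" 1]
      Finite_Cartesian_Product.norm_nth_le[of "vector [a, b] :: complex ^ 2" 2] by auto
  have "norm (vector [a, b] :: complex ^ 2) \<le> (\<Sum>i\<in>UNIV. cmod ((vector [a, b] :: complex ^ 2) $ i))"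
    unfolding norm_vec_def by (rule L2_set_le_sum) simp
  then show "norm (vector [a, b] :: complex ^ 2) \<le> cmod a + cmod b" by (simp add: sum_2)
qed

context ergodic_schrodinger
begin

abbreviation "orb \<equiv> int_iterate T"

definition pot :: "'a \<Rightarrow> int \<Rightarrow> real" where "pot x n = v (orb n x)"

lemma orb_Suc: "orb (n + 1) x = T (orb n x)"
proof (cases "0 \<le> n")
  case True
  then have "nat (n + 1) = Suc (nat n)" by simp
  then show ?thesis using True by (simp add: int_iterate_def)
next
  case False
  define k where "k = nat (- n - 1)"
  have k: "nat (- n) = Suc k" using False by (simp add: k_def)
  have "orb n x = inv T ((inv T ^^ k) x)" using False k by (simp add: int_iterate_def)
  then have "T (orb n x) = (inv T ^^ k) x" by (simp add: T_inv_T)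
  also have "\<dots> = orb (n + 1) x"
  proof (cases "k = 0")
    case True
    then have "n = -1" using k by simp
    then show ?thesis using True by (simp add: int_iterate_def)
  next
    case False
    then have "\<not> 0 \<le> n + 1" "nat (- (n + 1)) = k" using k by auto
    then show ?thesis by (simp add: int_iterate_def)
  qed
  finally show ?thesis ..
qed

lemma orb_0: "orb 0 x = x" by (simp add: int_iterate_def)

lemma orb_pred: "orb (n - 1) x = inv T (orb n x)"
  using orb_Suc[of "n - 1" x] inv_T_T by (metis diff_add_cancel)

lemma orb_add: "orb (n + m) x = orb n (orb m x)"
proof (induction n rule: int_induct[where k = 0])
  case base
  then show ?case by (simp add: orb_0)
next
  case (step1 i)
  have "orb (i + 1 + m) x = T (orb (i + m) x)" using orb_Suc[of "i + m" x] by (simp add: add_ac)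
  then show ?case using step1 orb_Suc[of i "orb m x"] by simp
next
  case (step2 i)
  have "orb (i - 1 + m) x = inv T (orb (i + m) x)" using orb_pred[of "i + m" x] by (simp add: algebra_simps)
  then show ?case using step2 orb_pred[of i "orb m x"] by simp
qed

lemma funpow_orb: "(T ^^ k) (orb m x) = orb (m + int k) x"
proof (induction k)
  case (Suc k)
  then show ?case using orb_Suc[of "m + int k" x] by (simp add: add_ac)
qed simp

lemma T_orb: "T (orb m x) = orb (m + 1) x" by (simp add: orb_Suc)

lemma cont_orb: "continuous_on UNIV (orb n)"
proof (induction n rule: int_induct[where k = 0])
  case base
  have "orb 0 = (\<lambda>x. x)" by (simp add: orb_0 fun_eq_iff)
  then show ?case by (simp add: continuous_on_id)
next
  case (step1 i)
  have "orb (i + 1) = (\<lambda>x. T (orb i x))" by (simp add: orb_Suc fun_eq_iff)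
  then show ?case using continuous_on_compose2[OF cont_T step1(2)] by simp
next
  case (step2 i)
  have "orb (i - 1) = (\<lambda>x. inv T (orb i x))" by (simp add: orb_pred fun_eq_iff)
  then show ?case using continuous_on_compose2[OF cont_inv_T step2(2)] by simp
qed

lemma pot_bounded: "\<exists>M. \<forall>x n. \<bar>pot x n\<bar> \<le> M"
  using v_bounded unfolding pot_def by blast

lemma dense_orbit: "closure (range (\<lambda>n. orb n x)) = UNIV"
  using minimal_T by (simp add: minimal_map_def)

lemma closed_orbit_induct:
  assumes "closed {y. P y}" and "\<And>m. P (orb m x)"
  shows "P y"
proof -
  have "closure (range (\<lambda>n. orb n x)) \<subseteq> {y. P y}"
    using assms by (intro closure_minimal) auto
  then show ?thesis using dense_orbit[of x] by auto
qed

lemma transfer_matrix_solution: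
  assumes w: "solution (pot x) E w"
  shows "transfer_matrix T v E k (orb m x) *v vector [w m, w (m - 1)] = vector [w (m + int k), w (m + int k - 1)]"
proof (induction k)
  case (Suc k)
  have "transfer_matrix T v E (Suc k) (orb m x) *v vector [w m, w (m - 1)]
      = schrodinger_matrix v E ((T ^^ k) (orb m x)) *v vector [w (m + int k), w (m + int k - 1)]"
    using Suc by (simp flip: matrix_vector_mul_assoc)
  also have "\<dots> = vector [(of_real (pot x (m + int k)) - E) * w (m + int k) - w (m + int k - 1), w (m + int k)]"
    by (simp add: funpow_orb schrodinger_matrix_def pot_def vec_eq_iff forall_2 matrix_vector_mult_def sum_2)
  also have "(of_real (pot x (m + int k)) - E) * w (m + int k) - w (m + int k - 1) = w (m + int k + 1)"
    by (rule solution_step[OF w, symmetric])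
  finally show ?case by (simp add: add_ac)
qed (simp add: vec_eq_iff forall_2)

text \<open>
  Let \<open>s\<close> and \<open>f\<close> denote the sizes of \<open>S\<close> and \<open>F\<close> on pairs of neighbouring sites. Wronskian one and boundedness of
  the kernel give \<open>1 \<le> s n * f n\<close> and \<open>s n * f m \<le> D\<close> for \<open>m \<le> n\<close>. Expanding in the basis \<open>S, F\<close> yields that the norm
  of the transfer matrix from \<open>m\<close> to \<open>n\<close> is comparable to \<open>f n / f m\<close>, which is exactly multiplicative, and that
  the kernel between \<open>m\<close> and \<open>n\<close> is comparable to the inverse of this ratio.
\<close>

lemma green_growth_estimates:
  assumes G: "green_kernel 0 (pot x) E W C \<kappa>"
  obtains c D where "0 < c" and "0 < D"
    and "\<forall>m j k. c * normA E j (orb m x) * normA E k (orb (m + int j) x) \<le> normA E (j + k) (orb m x)"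
    and "\<forall>m k. cmod (W m (m + int k)) * normA E k (orb m x) \<le> D"
    and "\<forall>m k. 0 < k \<longrightarrow> (\<exists>i\<in>{0,1}. \<exists>j\<in>{0,1}. 1/8 \<le> cmod (W (m - j) (m + int k - i)) * normA E k (orb m x))"
proof -
  have C: "0 < C" "0 < \<kappa>"
    and bd: "\<And>m n. cmod (W m n) \<le> C * exp (0 * real_of_int (n - m) - \<kappa> * \<bar>real_of_int (n - m)\<bar>)"
    using G by (auto simp: green_kernel_def)
  have WC: "cmod (W m n) \<le> C" for m n
  proof -
    have "cmod (W m n) \<le> C * exp (0 * real_of_int (n - m) - \<kappa> * \<bar>real_of_int (n - m)\<bar>)" by (rule bd)
    also have "\<dots> \<le> C * 1" using C by (intro mult_left_mono) auto
    finally show ?thesis by simp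
  qed
  have "\<exists>w. solution (pot x) E w \<and> \<not> slow_right (0 - \<kappa>) w"
    using slow_right_not_all[OF C(2)] by simp
  then obtain S F where S: "solution (pot x) E S" and F: "solution (pot x) E F"
    and W1: "\<And>n. S n * F (n + 1) - S (n + 1) * F n = 1"
    and W: "\<And>m n. W m n = S (max m n) * F (min m n)"
    using green_kernel_factorization[OF G order_refl] by metis
  define s where "s n = cmod (S n) + cmod (S (n - 1))" for n
  define f where "f n = cmod (F n) + cmod (F (n - 1))" for n
  define D where "D = 4 * (C + 1)"
  have D: "0 < D" using C by (simp add: D_def)
  have prod: "cmod (S i) * cmod (F j) \<le> C" if "j \<le> i" for i j
    using WC[of j i] that by (simp add: W max_def min_def norm_mult split: if_splits)
  (* The pair (n - 1, n) is in the wrong order for W; the Wronskian exchanges the two sites at the cost of 1. *)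
  have prod1: "cmod (S (j - 1)) * cmod (F j) \<le> C + 1" for j
  proof -
    have "S (j - 1) * F j = 1 + S j * F (j - 1)" using W1[of "j - 1"] by (simp add: algebra_simps)
    then have "cmod (S (j - 1)) * cmod (F j) \<le> 1 + cmod (S j) * cmod (F (j - 1))"
      by (metis norm_mult norm_one norm_triangle_ineq)
    then show ?thesis using prod[of "j - 1" j] by simp
  qed
  have sf: "s n * f m \<le> D" if "m \<le> n" for m n
  proof -
    have "cmod (S (n - 1)) * cmod (F m) \<le> C + 1"
      using prod1[of n] prod[of m "n - 1"] that by (cases "m = n") auto
    moreover have "cmod (S n) * cmod (F m) \<le> C" "cmod (S n) * cmod (F (m - 1)) \<le> C"
      "cmod (S (n - 1)) * cmod (F (m - 1)) \<le> C" using that by (auto intro!: prod)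
    ultimately show ?thesis by (simp add: s_def f_def D_def algebra_simps)
  qed
  have one: "1 \<le> s n * f n" for n
  proof -
    have "1 = cmod (S (n - 1) * F n - S n * F (n - 1))" using W1[of "n - 1"] by simp
    also have "\<dots> \<le> cmod (S (n - 1)) * cmod (F n) + cmod (S n) * cmod (F (n - 1))"
      unfolding norm_mult[symmetric] by (rule norm_triangle_ineq4)
    also have "\<dots> \<le> s n * f n" by (simp add: s_def f_def algebra_simps)
    finally show ?thesis .
  qed
  have s0: "0 \<le> s n" and f0: "0 \<le> f n" for n by (auto simp: s_def f_def)
  have fpos: "0 < f n" for n using one[of n] f0[of n] by (metis less_eq_real_def mult_zero_right not_one_le_zero)
  have lower: "f (m + int k) \<le> 2 * normA E k (orb m x) * f m" for m k
  proof -
    let ?V = "\<lambda>n. vector [F n, F (n - 1)] :: complex ^ 2"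
    have "norm (?V (m + int k)) \<le> normA E k (orb m x) * norm (?V m)"
      unfolding growth_def transfer_matrix_solution[OF F, symmetric] by (rule norm_mult_vec_le_matnorm)
    also have "\<dots> \<le> normA E k (orb m x) * f m"
      unfolding f_def by (intro mult_left_mono norm_vec2_bounds) simp
    finally have "norm (?V (m + int k)) \<le> normA E k (orb m x) * f m" .
    moreover have "f (m + int k) \<le> 2 * norm (?V (m + int k))"
      unfolding f_def using norm_vec2_bounds(1)[of "F (m + int k)" "F (m + int k - 1)"]
        norm_vec2_bounds(2)[of "F (m + int k - 1)" "F (m + int k)"] by linarith
    ultimately show ?thesis by simp
  qed
  have upper0: "normA E k (orb m x) \<le> f m * s (m + int k) + s m * f (m + int k)" for m k
    unfolding growth_def
  proof (rule onorm_le)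
    fix V :: "complex ^ 2"
    obtain w where w: "solution (pot x) E w" "w (m - 1) = V $ 2" "w m = V $ 1"
      using solution_from[of "pot x" E "m - 1" "V $ 2" "V $ 1"] by auto
    have V: "V = vector [w m, w (m - 1)]" using w by (simp add: vec_eq_iff forall_2)
    let ?a = "w (m - 1) * F m - w m * F (m - 1)" and ?b = "S (m - 1) * w m - S m * w (m - 1)"
    have span: "w n = ?a * S n + ?b * F n" for n
      using solution_span[OF S F w(1), of "m - 1" 1 n] W1[of "m - 1"] by simp
    have nw: "cmod (w m) \<le> norm V" "cmod (w (m - 1)) \<le> norm V" unfolding V by (rule norm_vec2_bounds)+
    have a: "cmod ?a \<le> norm V * f m"
    proof -
      have "cmod ?a \<le> cmod (w (m - 1)) * cmod (F m) + cmod (w m) * cmod (F (m - 1))"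
        unfolding norm_mult[symmetric] by (rule norm_triangle_ineq4)
      also have "\<dots> \<le> norm V * cmod (F m) + norm V * cmod (F (m - 1))"
        using nw by (intro add_mono mult_right_mono) auto
      finally show ?thesis by (simp add: f_def algebra_simps)
    qed
    have b: "cmod ?b \<le> norm V * s m"
    proof -
      have "cmod ?b \<le> cmod (S (m - 1)) * cmod (w m) + cmod (S m) * cmod (w (m - 1))"
        unfolding norm_mult[symmetric] by (rule norm_triangle_ineq4)
      also have "\<dots> \<le> cmod (S (m - 1)) * norm V + cmod (S m) * norm V"
        using nw by (intro add_mono mult_left_mono) auto
      finally show ?thesis by (simp add: s_def algebra_simps)
    qed
    have c: "cmod (w n) \<le> norm V * f m * cmod (S n) + norm V * s m * cmod (F n)" for n
    proof -
      have "cmod (w n) \<le> cmod ?a * cmod (S n) + cmod ?b * cmod (F n)"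
        unfolding span[of n] norm_mult[symmetric] by (rule norm_triangle_ineq)
      also have "\<dots> \<le> norm V * f m * cmod (S n) + norm V * s m * cmod (F n)"
        using a b by (intro add_mono mult_right_mono) auto
      finally show ?thesis .
    qed
    let ?n = "m + int k"
    have "norm (transfer_matrix T v E k (orb m x) *v V) \<le> cmod (w ?n) + cmod (w (?n - 1))"
      unfolding V transfer_matrix_solution[OF w(1)] by (rule norm_vec2_bounds)
    also have "\<dots> \<le> (f m * s ?n + s m * f ?n) * norm V"
      using c[of ?n] c[of "?n - 1"] by (simp add: s_def f_def algebra_simps)
    finally show "norm (transfer_matrix T v E k (orb m x) *v V) \<le> (f m * s ?n + s m * f ?n) * norm V" .
  qed
  have ratio: "f m \<le> D * f (m + int k)" for m k
  proof -
    have "f m * 1 \<le> f m * (s (m + int k) * f (m + int k))" by (intro mult_left_mono one f0)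
    also have "\<dots> = (s (m + int k) * f m) * f (m + int k)" by simp
    also have "\<dots> \<le> D * f (m + int k)" by (intro mult_right_mono sf f0) auto
    finally show ?thesis by simp
  qed
  define D' where "D' = D * D + D"
  have D': "0 < D'" using D by (simp add: D'_def add_pos_pos)
  have upper: "normA E k (orb m x) * f m \<le> D' * f (m + int k)" for m k
  proof -
    have "normA E k (orb m x) * f m \<le> (f m * s (m + int k) + s m * f (m + int k)) * f m"
      by (intro mult_right_mono upper0 f0)
    also have "\<dots> = (s (m + int k) * f m) * f m + (s m * f m) * f (m + int k)" by (simp add: algebra_simps)
    also have "\<dots> \<le> D * f m + D * f (m + int k)"
      by (intro add_mono mult_right_mono sf f0) auto
    also have "\<dots> \<le> D * (D * f (m + int k)) + D * f (m + int k)"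
      using D by (intro add_mono mult_left_mono ratio) auto
    finally show ?thesis by (simp add: D'_def algebra_simps)
  qed
  show thesis
  proof (rule that[of "1 / (2 * D'\<^sup>2)" "D * D'"])
    show "0 < 1 / (2 * D'\<^sup>2)" "0 < D * D'" using D D' by auto
    show "\<forall>m j k. 1 / (2 * D'\<^sup>2) * normA E j (orb m x) * normA E k (orb (m + int j) x) \<le> normA E (j + k) (orb m x)"
    proof (intro allI)
      fix m j k
      let ?l = "m + int j" and ?n = "m + int (j + k)"
      let ?a = "normA E j (orb m x)" and ?b = "normA E k (orb ?l x)"
      have n: "?l + int k = ?n" by simp
      have "(?a * ?b) * (f m * f ?l) = (?a * f m) * (?b * f ?l)" by simp
      also have "\<dots> \<le> (D' * f ?l) * (D' * f ?n)"
        using upper[of j m] upper[of k ?l] D' f0 unfolding n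
        by (intro mult_mono[of "?a * f m" "D' * f ?l" "?b * f ?l" "D' * f ?n"]) auto
      also have "\<dots> \<le> (D' * f ?l) * (D' * (2 * normA E (j + k) (orb m x) * f m))"
        using D' f0 by (intro mult_left_mono lower) auto
      also have "\<dots> = (2 * D'\<^sup>2 * normA E (j + k) (orb m x)) * (f m * f ?l)"
        by (simp add: power2_eq_square)
      finally have "?a * ?b \<le> 2 * D'\<^sup>2 * normA E (j + k) (orb m x)"
        using mult_pos_pos[OF fpos[of m] fpos[of ?l]] by (rule mult_right_le_imp_le)
      then show "1 / (2 * D'\<^sup>2) * ?a * ?b \<le> normA E (j + k) (orb m x)"
        using D' by (simp add: field_simps)
    qed
    show "\<forall>m k. cmod (W m (m + int k)) * normA E k (orb m x) \<le> D * D'"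
    proof (intro allI)
      fix m k
      let ?n = "m + int k"
      have "cmod (W m ?n) \<le> s ?n * f m"
        unfolding W norm_mult s_def f_def by (intro mult_mono) (auto simp: max_def min_def)
      then have "cmod (W m ?n) * normA E k (orb m x) \<le> s ?n * f m * normA E k (orb m x)"
        by (intro mult_right_mono) auto
      also have "\<dots> = s ?n * (normA E k (orb m x) * f m)" by simp
      also have "\<dots> \<le> s ?n * (D' * f ?n)" by (intro mult_left_mono upper s0)
      also have "\<dots> = (s ?n * f ?n) * D'" by simp
      also have "\<dots> \<le> D * D'" using D' by (intro mult_right_mono sf) auto
      finally show "cmod (W m ?n) * normA E k (orb m x) \<le> D * D'" .
    qed
    (* One of the four entries between neighbouring sites is large; a single entry may vanish. *)
    show "\<forall>m k. 0 < k \<longrightarrow> (\<exists>i\<in>{0,1}. \<exists>j\<in>{0,1}. 1/8 \<le> cmod (W (m - j) (m + int k - i)) * normA E k (orb m x))"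
    proof (intro allI impI, rule ccontr)
      fix m and k :: nat
      let ?n = "m + int k" and ?a = "normA E k (orb m x)"
      assume k: "0 < k" and "\<not> (\<exists>i\<in>{0,1}. \<exists>j\<in>{0,1}. 1/8 \<le> cmod (W (m - j) (?n - i)) * ?a)"
      then have lt: "\<And>i j. i \<in> {0,1} \<Longrightarrow> j \<in> {0,1} \<Longrightarrow> cmod (W (m - j) (?n - i)) * ?a < 1/8"
        by (auto simp: not_le)
      have w: "cmod (W m ?n) = cmod (S ?n) * cmod (F m)" "cmod (W m (?n - 1)) = cmod (S (?n - 1)) * cmod (F m)"
        "cmod (W (m - 1) ?n) = cmod (S ?n) * cmod (F (m - 1))"
        "cmod (W (m - 1) (?n - 1)) = cmod (S (?n - 1)) * cmod (F (m - 1))"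
        using k by (auto simp: W max_def min_def norm_mult)
      have "1 * f m \<le> (s ?n * f ?n) * f m" by (intro mult_right_mono one f0)
      also have "\<dots> = (s ?n * f m) * f ?n" by simp
      also have "\<dots> \<le> (s ?n * f m) * (2 * ?a * f m)"
        using s0 f0 by (intro mult_left_mono lower) auto
      also have "\<dots> = 2 * ((s ?n * f m) * ?a) * f m" by simp
      finally have "1 \<le> 2 * ((s ?n * f m) * ?a)" using fpos[of m] by (rule mult_right_le_imp_le)
      moreover have "(s ?n * f m) * ?a = cmod (W m ?n) * ?a + cmod (W m (?n - 1)) * ?a
          + cmod (W (m - 1) ?n) * ?a + cmod (W (m - 1) (?n - 1)) * ?a"
        unfolding w by (simp add: s_def f_def algebra_simps)
      ultimately show False using lt[of 0 0] lt[of 1 0] lt[of 0 1] lt[of 1 1] by simp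
    qed
  qed
qed

text \<open>
  The estimates hold along one orbit with constants; supermultiplicativity is a closed condition and
  extends to all points by minimality.
\<close>

lemma green_decay_rate:
  assumes G: "green_kernel 0 (pot x) E W C \<kappa>" and \<Lambda>: "\<Lambda> < L E"
  obtains C' where "0 < C'" and "\<forall>m n. cmod (W m n) \<le> C' * exp (- \<Lambda> * \<bar>real_of_int (n - m)\<bar>)"
proof -
  obtain c D where cD: "0 < c" "0 < D"
    "\<forall>m j k. c * normA E j (orb m x) * normA E k (orb (m + int j) x) \<le> normA E (j + k) (orb m x)"
    "\<forall>m k. cmod (W m (m + int k)) * normA E k (orb m x) \<le> D"
    using green_growth_estimates[OF G] by metis
  have "c * normA E j y * normA E k ((T ^^ j) y) \<le> normA E (j + k) y" for j k y
  proof (rule closed_orbit_induct[where x = x])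
    show "closed {y. c * normA E j y * normA E k ((T ^^ j) y) \<le> normA E (j + k) y}"
      by (intro closed_Collect_le continuous_intros continuous_growth
          continuous_on_compose2[OF continuous_growth cont_funpow]) auto
    show "c * normA E j (orb m x) * normA E k ((T ^^ j) (orb m x)) \<le> normA E (j + k) (orb m x)" for m
      using cD(3) by (simp add: funpow_orb)
  qed
  then obtain B where B: "0 < B" "\<And>n y. B * exp (\<Lambda> * real n) \<le> normA E n y"
    using growth_lower[OF cD(1) _ \<Lambda>] by metis
  have "0 < \<kappa>" using G by (simp add: green_kernel_def)
  then have NS: "\<exists>w. solution (pot x) E w \<and> \<not> slow_right (0 - \<kappa>) w"
    using slow_right_not_all by simp
  have sym: "W m n = W n m" for m n by (rule green_kernel_symmetric_decay(1)[OF G order_refl NS])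
  have le: "cmod (W m n) \<le> D / B * exp (- \<Lambda> * \<bar>real_of_int (n - m)\<bar>)" if "m \<le> n" for m n
  proof -
    define k where "k = nat (n - m)"
    have k: "n = m + int k" "\<bar>real_of_int (n - m)\<bar> = real k" using that by (auto simp: k_def)
    have "cmod (W m n) * (B * exp (\<Lambda> * real k)) \<le> cmod (W m n) * normA E k (orb m x)"
      by (intro mult_left_mono B) auto
    also have "\<dots> \<le> D" using cD(4) k by simp
    finally show ?thesis unfolding k(2) using B(1) by (simp add: exp_minus field_simps)
  qed
  show thesis
  proof (rule that[of "D / B"])
    show "0 < D / B" using cD B by simp
    show "\<forall>m n. cmod (W m n) \<le> D / B * exp (- \<Lambda> * \<bar>real_of_int (n - m)\<bar>)"
    proof (intro allI)
      fix m n
      show "cmod (W m n) \<le> D / B * exp (- \<Lambda> * \<bar>real_of_int (n - m)\<bar>)"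
      proof (cases "m \<le> n")
        case False
        then show ?thesis using le[of n m] sym[of m n] by (simp add: abs_minus_commute)
      qed (rule le)
    qed
  qed
qed

definition has_green :: "real \<Rightarrow> complex \<Rightarrow> 'a \<Rightarrow> bool" where
  "has_green g E x \<longleftrightarrow> (\<exists>W C \<kappa>. green_kernel g (pot x) E W C \<kappa>)"

text \<open>
  Translates of the potential along a dense orbit converge to the potential at any other phase.
\<close>

lemma green_kernel_all_phases:
  assumes G: "green_kernel g (pot x) E W C \<kappa>"
  shows "\<exists>W. green_kernel g (pot y) E W C \<kappa>"
proof -
  have "y \<in> closure (range (\<lambda>n. orb n x))" using dense_orbit[of x] by simp
  then obtain z where z: "\<And>k. z k \<in> range (\<lambda>n. orb n x)" "z \<longlonglongrightarrow> y"
    unfolding closure_sequential by blast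
  then have "\<forall>k. \<exists>n. z k = orb n x" by blast
  then obtain m where m: "\<And>k. z k = orb (m k) x" by metis
  have G': "green_kernel g (pot (z k)) E (\<lambda>i n. W (i + m k) (n + m k)) C \<kappa>" for k
    unfolding green_kernel_def
  proof (intro conjI allI)
    fix i n
    have p: "pot (z k) j = pot x (j + m k)" for j by (simp add: pot_def m orb_add)
    have d: "delta (i + m k) (n + m k) = delta i n" by (simp add: delta_def)
    have G1: "- W i (n + 1) - W i (n - 1) + (of_real (pot x n) - E) * W i n = delta i n"
      "- W (i + 1) n - W (i - 1) n + (of_real (pot x i) - E) * W i n = delta i n"
      "cmod (W i n) \<le> C * exp (g * real_of_int (n - i) - \<kappa> * \<bar>real_of_int (n - i)\<bar>)" for i n
      using G by (auto simp: green_kernel_def)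
    have a: "j + 1 + m k = j + m k + 1" "j - 1 + m k = j + m k - 1" for j by auto
    show "- W (i + m k) (n + 1 + m k) - W (i + m k) (n - 1 + m k) + (of_real (pot (z k) n) - E) * W (i + m k) (n + m k) = delta i n"
      unfolding p a using G1(1)[of "i + m k" "n + m k"] d by simp
    show "- W (i + 1 + m k) (n + m k) - W (i - 1 + m k) (n + m k) + (of_real (pot (z k) i) - E) * W (i + m k) (n + m k) = delta i n"
      unfolding p a using G1(2)[of "i + m k" "n + m k"] d by simp
    show "cmod (W (i + m k) (n + m k)) \<le> C * exp (g * real_of_int (n - i) - \<kappa> * \<bar>real_of_int (n - i)\<bar>)"
      using G1(3)[of "i + m k" "n + m k"] by simp
  qed (use G in \<open>auto simp: green_kernel_def\<close>)
  have lim: "(\<lambda>k. pot (z k) n) \<longlonglongrightarrow> pot y n" for n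
  proof -
    have "continuous_on UNIV (\<lambda>x. pot x n)"
      unfolding pot_def by (rule continuous_on_compose2[OF cont_v cont_orb]) simp
    from continuous_on_tendsto_compose[OF this z(2)] show ?thesis by simp
  qed
  show ?thesis by (rule green_kernel_limit[OF G' lim tendsto_const])
qed

lemma has_green_phase: "has_green g E x \<longleftrightarrow> has_green g E y"
  unfolding has_green_def using green_kernel_all_phases by blast

lemma not_in_spectrum_iff: "E \<notin> l2_spectrum (hatano_nelson T v g x) \<longleftrightarrow> has_green g E x"
proof -
  have sh: "(\<lambda>n. hatano_nelson T v g x u n - E * u n) = hn_op g (pot x) E u" for u
    by (simp add: hatano_nelson_def hn_op_def pot_def fun_eq_iff algebra_simps)
  have "E \<notin> l2_spectrum (hatano_nelson T v g x) \<longleftrightarrow> (\<exists>R. l2_inverse g (pot x) E R)"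
    unfolding l2_spectrum_def l2_inverse_def by (simp only: mem_Collect_eq sh not_not)
  also have "\<dots> \<longleftrightarrow> has_green g E x"
  proof -
    obtain M where M: "\<And>n. \<bar>pot x n\<bar> \<le> M" using pot_bounded by blast
    show ?thesis
      unfolding has_green_def
      using green_kernel_of_inverse[of g "pot x" E _ M] schur_inverse[of g "pot x" E _ _ _ M] M by blast
  qed
  finally show ?thesis .
qed

text \<open>
  Makes the common spectrum well defined.
\<close>

lemma in_Sigma_iff: "E \<in> Sigma_HN T v g \<longleftrightarrow> \<not> has_green g E x"
proof -
  have all: "l2_spectrum (hatano_nelson T v g y) = {E. \<not> has_green g E x}" for y
    using not_in_spectrum_iff[of _ g y] has_green_phase[of g _ x y] by blast
  have "Sigma_HN T v g = {E. \<not> has_green g E x}"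
    unfolding Sigma_HN_def
  proof (rule the_equality)
    show "\<forall>y. l2_spectrum (hatano_nelson T v g y) = {E. \<not> has_green g E x}" using all by blast
    show "S = {E. \<not> has_green g E x}" if "\<forall>y. l2_spectrum (hatano_nelson T v g y) = S" for S
      using that all by blast
  qed
  then show ?thesis by simp
qed

end

section \<open>The resolvent set in terms of the Lyapunov exponent\<close>

context ergodic_schrodinger
begin

lemma pot_shift: "pot x (m + int j) = v ((T ^^ j) (orb m x))"
  by (simp add: pot_def funpow_orb)

text \<open>
  The fundamental solution with the value \<open>0\<close> at site \<open>m - 1\<close> and \<open>1\<close> at site \<open>m\<close>, indexed so that
  \<open>dirichlet x E m k\<close> is its value at site \<open>m - 1 + k\<close>.
\<close>

definition dirichlet :: "'a \<Rightarrow> complex \<Rightarrow> int \<Rightarrow> nat \<Rightarrow> complex" where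
  "dirichlet x E m k = fundsol (\<lambda>j. pot x (m + int j)) E k"

lemma dirichlet_simps:
  "dirichlet x E m 0 = 0" "dirichlet x E m (Suc 0) = 1"
  "dirichlet x E m (Suc (Suc k)) = (of_real (pot x (m + int k)) - E) * dirichlet x E m (Suc k) - dirichlet x E m k"
  "dirichlet x E m (Suc (Suc k)) = (of_real (pot x m) - E) * dirichlet x E (m + 1) (Suc k) - dirichlet x E (m + 2) k"
proof -
  show "dirichlet x E m 0 = 0" "dirichlet x E m (Suc 0) = 1"
    "dirichlet x E m (Suc (Suc k)) = (of_real (pot x (m + int k)) - E) * dirichlet x E m (Suc k) - dirichlet x E m k"
    by (auto simp: dirichlet_def)
  have "m + int (Suc j) = m + 1 + int j" "m + int (Suc (Suc j)) = m + 2 + int j" for j by auto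
  then show "dirichlet x E m (Suc (Suc k)) = (of_real (pot x m) - E) * dirichlet x E (m + 1) (Suc k) - dirichlet x E (m + 2) k"
    unfolding dirichlet_def fundsol_row_recurrence[of "\<lambda>j. pot x (m + int j)"] by (simp add: add.assoc)
qed

lemma dirichlet_le_growth: "cmod (dirichlet x E m k) \<le> normA E k (orb m x)"
proof (cases k)
  case 0
  then show ?thesis by (simp add: dirichlet_simps)
next
  case (Suc j)
  then show ?thesis
    using fundsol_le_growth(2)[of v T "orb m x" E j] by (simp add: dirichlet_def pot_shift)
qed

lemma growth_le_dirichlet:
  "normA E (Suc k) (orb m x) \<le> cmod (dirichlet x E m (Suc (Suc k))) + cmod (dirichlet x E (m + 1) (Suc k))
     + cmod (dirichlet x E m (Suc k)) + cmod (dirichlet x E (m + 1) k)"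
  using growth_le_fundsol[of T v E k "orb m x"] unfolding dirichlet_def pot_shift T_orb .

text \<open>
  The kernel is supported on \<open>m < n\<close>. Choosing \<open>\<Lambda>\<close> strictly between \<open>L(E)\<close> and \<open>g\<close> leaves the room
  \<open>\<kappa> = g - \<Lambda>\<close>.
\<close>

lemma has_green_below_rate:
  assumes "L E < g"
  shows "has_green g E x"
proof -
  obtain \<Lambda> where \<Lambda>: "L E < \<Lambda>" "\<Lambda> < g" using dense assms by blast
  obtain C where C: "0 < C" "\<And>n x. normA E n x \<le> C * exp (\<Lambda> * real n)"
    using growth_upper[OF \<Lambda>(1)] by metis
  define W where "W m n = (if m \<le> n then - dirichlet x E (m + 1) (nat (n - m)) else 0)" for m n
  have "green_kernel g (pot x) E W C (g - \<Lambda>)"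
    unfolding green_kernel_def
  proof (intro conjI allI)
    fix m n
    consider "n < m - 1" | "n = m - 1" | "n = m" | k where "n = m + 1 + int k"
    proof -
      have "n < m - 1 \<or> n = m - 1 \<or> n = m \<or> n = m + 1 + int (nat (n - m - 1))" by linarith
      then show ?thesis using that by blast
    qed
    note cs = this
    show "- W m (n + 1) - W m (n - 1) + (of_real (pot x n) - E) * W m n = delta m n"
    proof (cases rule: cs)
      case (4 k)
      have "nat (n - m) = Suc k" "nat (n + 1 - m) = Suc (Suc k)" "nat (n - 1 - m) = k" using 4 by auto
      then show ?thesis using 4 dirichlet_simps(3)[of x E "m + 1" k] by (simp add: W_def delta_def)
    qed (auto simp: W_def delta_def dirichlet_simps)
    show "- W (m + 1) n - W (m - 1) n + (of_real (pot x m) - E) * W m n = delta m n"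
    proof (cases rule: cs)
      case (4 k)
      have "nat (n - m) = Suc k" "nat (n - (m - 1)) = Suc (Suc k)" "nat (n - (m + 1)) = k" using 4 by auto
      then show ?thesis using 4 dirichlet_simps(4)[of x E m k] by (simp add: W_def delta_def add.commute)
    qed (auto simp: W_def delta_def dirichlet_simps)
    show "cmod (W m n) \<le> C * exp (g * real_of_int (n - m) - (g - \<Lambda>) * \<bar>real_of_int (n - m)\<bar>)"
    proof (cases "m \<le> n")
      case True
      have "cmod (W m n) \<le> normA E (nat (n - m)) (orb (m + 1) x)"
        using True dirichlet_le_growth by (simp add: W_def)
      also have "\<dots> \<le> C * exp (\<Lambda> * real (nat (n - m)))" by (rule C)
      also have "\<Lambda> * real (nat (n - m)) = g * real_of_int (n - m) - (g - \<Lambda>) * \<bar>real_of_int (n - m)\<bar>"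
        using True by (simp add: algebra_simps)
      finally show ?thesis .
    next
      case False
      then show ?thesis using C(1) by (simp add: W_def)
    qed
  qed (use C \<Lambda> in auto)
  then show ?thesis unfolding has_green_def by blast
qed

lemma lyapunov_le_of_orbit:
  assumes dec: "\<And>m k. cmod (dirichlet x E m k) \<le> C * exp (a * real k)"
  shows "L E \<le> a"
proof -
  define D where "D = 4 * (C * exp (2 * \<bar>a\<bar>)) + 2 * exp \<bar>a\<bar>"
  have C: "0 \<le> C" using order_trans[OF norm_ge_zero dec[of 0 0]] by simp
  have e: "cmod (dirichlet x E m j) \<le> C * exp (2 * \<bar>a\<bar>) * exp (a * real k)"
    if "j \<in> {k - 1, k, Suc k}" "k \<noteq> 0" for m j k
  proof -
    have "a * real j \<le> 2 * \<bar>a\<bar> + a * real k"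
    proof -
      have "\<bar>real j - real k\<bar> \<le> 2" using that by (auto simp: of_nat_diff)
      then have "\<bar>a\<bar> * \<bar>real j - real k\<bar> \<le> \<bar>a\<bar> * 2" by (intro mult_left_mono) auto
      then have "a * (real j - real k) \<le> \<bar>a\<bar> * 2"
        by (metis abs_ge_self abs_mult order_trans)
      then show ?thesis by (simp add: algebra_simps)
    qed
    then have "C * exp (a * real j) \<le> C * exp (2 * \<bar>a\<bar> + a * real k)" using C by (intro mult_left_mono) auto
    then show ?thesis using dec[of m j] by (simp add: exp_add)
  qed
  have orbit: "normA E k (orb m x) \<le> D * exp (a * real k)" for m k
  proof (cases k)
    case 0
    have "normA E 0 (orb m x) \<le> 2" by (rule growth_0)
    also have "2 * 1 \<le> 2 * exp \<bar>a\<bar>" by (intro mult_left_mono) auto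
    finally show ?thesis using 0 C by (simp add: D_def) (smt (verit) C exp_ge_zero mult_nonneg_nonneg)
  next
    case (Suc j)
    have "normA E (Suc j) (orb m x) \<le> 4 * (C * exp (2 * \<bar>a\<bar>) * exp (a * real (Suc j)))"
      using growth_le_dirichlet[of E j m x] e[of "Suc (Suc j)" "Suc j" m] e[of "Suc j" "Suc j" "m + 1"]
        e[of "Suc j" "Suc j" m] e[of j "Suc j" "m + 1"] by simp
    also have "\<dots> \<le> D * exp (a * real (Suc j))"
      unfolding D_def by (simp add: ring_distribs del: of_nat_Suc)
    finally show ?thesis using Suc by simp
  qed
  have "normA E k y \<le> D * exp (a * real k)" for k y
    by (rule closed_orbit_induct[where x = x])
      (auto intro!: closed_Collect_le continuous_intros continuous_growth orbit)
  moreover have "0 < D" using C by (simp add: D_def add_nonneg_pos)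
  ultimately show ?thesis by (intro lyapunov_leI[of D])
qed

text \<open>
  To the left of \<open>m\<close> column \<open>m\<close> is a solution of size \<open>exp(- (g + \<kappa>) k)\<close> at distance \<open>k\<close>. Transported back to \<open>m\<close> it can
  have grown by at most \<open>exp((g + \<kappa>/2) k)\<close>, so it vanishes. To the right it is then minus the fundamental
  solution, for every \<open>m\<close>, and the kernel bound controls all transfer matrices along the orbit.
\<close>

lemma lyapunov_less_of_green:
  assumes G: "green_kernel g (pot x) E W C \<kappa>" and g: "0 \<le> g" and le: "L E \<le> g"
  shows "L E < g"
proof -
  have C: "0 < C" "0 < \<kappa>"
    and col: "\<And>m n. - W m (n + 1) - W m (n - 1) + (of_real (pot x n) - E) * W m n = delta m n"
    and bd: "\<And>m n. cmod (W m n) \<le> C * exp (g * real_of_int (n - m) - \<kappa> * \<bar>real_of_int (n - m)\<bar>)"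
    using G by (auto simp: green_kernel_def)
  have "L E < g + \<kappa> / 2" using le C by simp
  then obtain B where B: "0 < B" "\<And>n y. normA E n y \<le> B * exp ((g + \<kappa> / 2) * real n)"
    using growth_upper by metis
  have left: "W m m = 0 \<and> W m (m - 1) = 0" for m
  proof -
    obtain w where w: "solution (pot x) E w" "w (m - 1) = W m (m - 1)" "w m = W m m"
      using solution_from[of "pot x" E "m - 1"] by auto
    have ag: "w n = W m n" if "n \<le> m" for n
    proof (rule left_agree[OF w(1) _ w(3,2) that])
      fix n assume "n < m"
      then show "W m (n - 1) = (of_real (pot x n) - E) * W m n - W m (n + 1)"
        using col[of m n] by (simp add: delta_def algebra_simps)
    qed
    let ?V = "\<lambda>n. vector [w n, w (n - 1)] :: complex ^ 2"
    have "norm (?V m) \<le> B * (2 * C * exp 0) * exp (- (\<kappa> / 2) * real k)" for k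
    proof -
      have wb: "cmod (w n) \<le> C * exp (- (g + \<kappa>) * real k)" if "n = m - int k \<or> n = m - int k - 1" for n
      proof -
        have "cmod (w n) \<le> C * exp (g * real_of_int (n - m) - \<kappa> * \<bar>real_of_int (n - m)\<bar>)"
          using ag[of n] bd[of m n] that by auto
        also have "\<dots> \<le> C * exp (- (g + \<kappa>) * real k)"
        proof -
          have "g * real_of_int (n - m) - \<kappa> * \<bar>real_of_int (n - m)\<bar> = (g + \<kappa>) * real_of_int (n - m)"
            using that by (auto simp: algebra_simps)
          also have "\<dots> \<le> (g + \<kappa>) * (- real k)" using that g C by (intro mult_left_mono) auto
          finally show ?thesis using C by (simp add: algebra_simps)
        qed
        finally show ?thesis .
      qed
      have "norm (?V m) \<le> normA E k (orb (m - int k) x) * norm (?V (m - int k))"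
        using norm_mult_vec_le_matnorm[of "transfer_matrix T v E k (orb (m - int k) x)" "?V (m - int k)"]
        unfolding transfer_matrix_solution[OF w(1)] by (simp add: growth_def)
      also have "\<dots> \<le> (B * exp ((g + \<kappa> / 2) * real k)) * (2 * C * exp (- (g + \<kappa>) * real k))"
      proof (rule mult_mono)
        have "norm (?V (m - int k)) \<le> cmod (w (m - int k)) + cmod (w (m - int k - 1))"
          by (rule norm_vec2_bounds)
        then show "norm (?V (m - int k)) \<le> 2 * C * exp (- (g + \<kappa>) * real k)"
          using wb[of "m - int k"] wb[of "m - int k - 1"] by simp
      qed (use B in auto)
      also have "\<dots> = B * (2 * C) * (exp ((g + \<kappa> / 2) * real k) * exp (- (g + \<kappa>) * real k))" by simp
      also have "\<dots> = B * (2 * C) * exp (- (\<kappa> / 2) * real k)"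
        unfolding exp_add[symmetric] by (simp add: algebra_simps)
      finally show ?thesis by simp
    qed
    moreover have "(\<lambda>k. B * (2 * C * exp 0) * exp (- (\<kappa> / 2) * real k)) \<longlonglongrightarrow> 0"
      using C by (intro exp_linear_tendsto_0) simp
    ultimately have "norm (?V m) \<le> 0"
      by (intro tendsto_lowerbound[where F = sequentially]) auto
    then have "w m = 0" "w (m - 1) = 0"
      using norm_vec2_bounds(1)[of "w m" "w (m - 1)"] norm_vec2_bounds(2)[of "w (m - 1)" "w m"] by auto
    then show ?thesis using w by simp
  qed
  have right: "W m (m + int k) = - dirichlet x E (m + 1) k" for m k
  proof -
    have "W m (m + int k) = - dirichlet x E (m + 1) k \<and> W m (m + int (Suc k)) = - dirichlet x E (m + 1) (Suc k)"
    proof (induction k)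
      case 0
      have "- W m (m + 1) = 1" using col[of m m] left[of m] by (simp add: delta_def)
      then have "W m (m + 1) = - 1" by (metis minus_minus)
      then show ?case using left[of m] by (simp add: dirichlet_simps)
    next
      case (Suc k)
      have e: "m + int (Suc k) + 1 = m + int (Suc (Suc k))" "m + int (Suc k) - 1 = m + int k"
        "m + 1 + int k = m + int (Suc k)" by auto
      have c: "W m (m + int (Suc (Suc k))) = (of_real (pot x (m + int (Suc k))) - E) * W m (m + int (Suc k)) - W m (m + int k)"
        using col[of m "m + int (Suc k)", unfolded e(1,2)] by (simp add: delta_def) algebra
      have d: "dirichlet x E (m + 1) (Suc (Suc k)) = (of_real (pot x (m + int (Suc k))) - E) * dirichlet x E (m + 1) (Suc k) - dirichlet x E (m + 1) k"
        using dirichlet_simps(3)[of x E "m + 1" k] unfolding e(3) .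
      have "W m (m + int (Suc (Suc k))) = - dirichlet x E (m + 1) (Suc (Suc k))"
        unfolding c d using Suc by simp
      then show ?case using Suc by blast
    qed
    then show ?thesis ..
  qed
  have "L E \<le> g - \<kappa>"
  proof (rule lyapunov_le_of_orbit)
    fix m k
    have "cmod (dirichlet x E m k) = cmod (W (m - 1) (m - 1 + int k))" using right[of "m - 1" k] by simp
    also have "\<dots> \<le> C * exp (g * real_of_int (m - 1 + int k - (m - 1)) - \<kappa> * \<bar>real_of_int (m - 1 + int k - (m - 1))\<bar>)"
      by (rule bd)
    finally show "cmod (dirichlet x E m k) \<le> C * exp ((g - \<kappa>) * real k)" by (simp add: algebra_simps)
  qed
  then show ?thesis using C by simp
qed

lemma slow_right_nat_bound:
  assumes "slow_right a w" "a \<le> b"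
  shows "\<exists>c>0. \<forall>k. cmod (w (int k)) \<le> c * exp (b * real k)"
proof -
  obtain c N where c: "\<And>n. N \<le> n \<Longrightarrow> cmod (w n) \<le> c * exp (a * real_of_int n)"
    using assms(1) unfolding slow_right_def by blast
  define d where "d = (\<Sum>k<nat N. cmod (w (int k)) / exp (b * real k))"
  have d0: "0 \<le> d" unfolding d_def by (intro sum_nonneg) simp
  have "cmod (w (int k)) \<le> (\<bar>c\<bar> + d + 1) * exp (b * real k)" for k
  proof (cases "N \<le> int k")
    case True
    have "cmod (w (int k)) \<le> c * exp (a * real k)" using c[OF True] by simp
    also have "\<dots> \<le> \<bar>c\<bar> * exp (b * real k)" using assms(2) by (intro mult_mono) (auto intro: mult_right_mono)
    also have "\<dots> \<le> (\<bar>c\<bar> + d + 1) * exp (b * real k)" using d0 by (intro mult_right_mono) auto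
    finally show ?thesis .
  next
    case False
    then have "cmod (w (int k)) / exp (b * real k) \<le> d"
      unfolding d_def by (intro member_le_sum) auto
    then have "cmod (w (int k)) \<le> d * exp (b * real k)" by (simp add: pos_divide_le_eq)
    also have "\<dots> \<le> (\<bar>c\<bar> + d + 1) * exp (b * real k)" using d0 by (intro mult_right_mono) auto
    finally show ?thesis .
  qed
  then show ?thesis using d0 by (intro exI[of _ "\<bar>c\<bar> + d + 1"]) auto
qed

text \<open>
  Contrapositive: if \<open>L(E) > b\<close>, some phase carries a solution that is not slow to the right. The phase
  is not arbitrary, which is why phase independence of the spectrum is used next.
\<close>

lemma lyapunov_le_of_slow_solutions:
  assumes slow: "\<And>x w. solution (pot x) E w \<Longrightarrow> \<exists>a\<le>b. slow_right a w"
  shows "L E \<le> b"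
proof (rule lyapunov_le_of_pointwise)
  fix x
  have sol: "\<exists>c>0. \<forall>k. cmod (dirichlet x E m k) \<le> c * exp (b * real k)" if m: "m = 0 \<or> m = 1" for m
  proof -
    obtain w where w: "solution (pot x) E w" "w (m - 1) = 0" "w m = 1"
      using solution_from[of "pot x" E "m - 1"] by auto
    have wd: "w (m - 1 + int k) = dirichlet x E m k" for k
    proof -
      have "w (m - 1 + int k) = dirichlet x E m k \<and> w (m - 1 + int (Suc k)) = dirichlet x E m (Suc k)"
      proof (induction k)
        case (Suc k)
        have e: "m - 1 + int (Suc (Suc k)) = m + int k + 1" "m - 1 + int (Suc k) = m + int k"
          "m - 1 + int k = m + int k - 1" by auto
        have i: "w (m + int k - 1) = dirichlet x E m k" "w (m + int k) = dirichlet x E m (Suc k)"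
          using Suc unfolding e(2,3) by auto
        show ?case
          unfolding e(1,2) solution_step[OF w(1), of "m + int k"] i dirichlet_simps(3)[of x E m k] by simp
      qed (use w in \<open>simp add: dirichlet_simps\<close>)
      then show ?thesis ..
    qed
    obtain a where "a \<le> b" "slow_right a w" using slow[OF w(1)] by blast
    then obtain c where c: "0 < c" "\<And>k. cmod (w (int k)) \<le> c * exp (b * real k)"
      using slow_right_nat_bound by metis
    have "cmod (dirichlet x E m k) \<le> c * exp \<bar>b\<bar> * exp (b * real k)" for k
    proof (cases "m = 0 \<and> k = 0")
      case True
      then show ?thesis using c(1) by (simp add: dirichlet_simps)
    next
      case False
      define j where "j = nat (m - 1 + int k)"
      have j: "m - 1 + int k = int j" "real j = real k \<or> real j = real k - 1" using False m by (auto simp: j_def)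
      have "b * real j = b * real k \<or> b * real j = b * real k - b"
        using j(2) by (auto simp: right_diff_distrib)
      then have e: "b * real j \<le> \<bar>b\<bar> + b * real k" by linarith
      have "cmod (dirichlet x E m k) \<le> c * exp (b * real j)" using c(2)[of j] wd[of k] j by simp
      also have "\<dots> \<le> c * exp (\<bar>b\<bar> + b * real k)" using c(1) e by simp
      finally show ?thesis by (simp add: exp_add)
    qed
    then show ?thesis using c(1) by (intro exI[of _ "c * exp \<bar>b\<bar>"]) simp
  qed
  obtain c0 c1 where c: "0 < c0" "0 < c1" "\<And>k. cmod (dirichlet x E 0 k) \<le> c0 * exp (b * real k)"
    "\<And>k. cmod (dirichlet x E 1 k) \<le> c1 * exp (b * real k)"
    using sol[of 0] sol[of 1] by blast
  define c where "c = c0 + c1"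
  have le: "cmod (dirichlet x E m j) \<le> c * exp \<bar>b\<bar> * exp (b * real (Suc k))"
    if "m = 0 \<or> m = 1" "j = k \<or> j = Suc k \<or> j = Suc (Suc k)" for m j k
  proof -
    have "cmod (dirichlet x E m j) \<le> c * exp (b * real j)"
      using that(1) order_trans[OF c(3)[of j] mult_right_mono[of c0 c "exp (b * real j)"]]
        order_trans[OF c(4)[of j] mult_right_mono[of c1 c "exp (b * real j)"]] c(1,2)
      by (auto simp: c_def)
    also have "\<dots> \<le> c * exp (\<bar>b\<bar> + b * real (Suc k))"
    proof -
      have "b * real j \<le> \<bar>b\<bar> + b * real (Suc k)" using that(2) by (auto simp: algebra_simps)
      then show ?thesis using c(1,2) by (simp add: c_def)
    qed
    finally show ?thesis by (simp add: exp_add)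
  qed
  define D where "D = 4 * (c * exp \<bar>b\<bar>) + 2"
  have cpos: "0 < c" using c by (simp add: c_def)
  have "normA E k x \<le> D * exp (b * real k)" for k
  proof (cases k)
    case 0
    have "0 \<le> c * exp \<bar>b\<bar>" using cpos by simp
    then show ?thesis using 0 growth_0[of T v E x] unfolding D_def by simp
  next
    case (Suc j)
    have "normA E (Suc j) x \<le> 4 * (c * exp \<bar>b\<bar> * exp (b * real (Suc j)))"
      using growth_le_dirichlet[of E j 0 x] le[of 0 "Suc (Suc j)" j] le[of 1 "Suc j" j] le[of 0 "Suc j" j] le[of 1 j j]
      by (simp add: orb_0 del: of_nat_Suc)
    also have "\<dots> \<le> D * exp (b * real (Suc j))" unfolding D_def by (simp add: ring_distribs del: of_nat_Suc)
    finally show ?thesis using Suc by simp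
  qed
  then show "\<exists>C. \<forall>n. normA E n x \<le> C * exp (b * real n)" by blast
qed

text \<open>
  A phase with a fast solution satisfies the hypothesis of the factorization.
\<close>

lemma has_green_zero_of_green:
  assumes g: "0 \<le> g" and less: "g < L E" and G: "has_green g E x"
  shows "has_green 0 E x"
proof (cases "\<exists>y. \<exists>w. solution (pot y) E w \<and> \<not> (\<exists>a\<le>g. slow_right a w)")
  case False
  then have "L E \<le> g" by (intro lyapunov_le_of_slow_solutions) blast
  then show ?thesis using less by simp
next
  case True
  then obtain y w where w: "solution (pot y) E w" "\<not> (\<exists>a\<le>g. slow_right a w)" by blast
  have "has_green g E y" using G has_green_phase by blast
  then obtain W C \<kappa> where W: "green_kernel g (pot y) E W C \<kappa>" unfolding has_green_def by blast
  then have C: "0 < C" "0 < \<kappa>" by (auto simp: green_kernel_def)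
  have NS: "\<exists>w. solution (pot y) E w \<and> \<not> slow_right (g - \<kappa>) w"
    using w C(2) by (intro exI[of _ w]) auto
  have "green_kernel 0 (pot y) E W C (g + \<kappa> - \<bar>0\<bar>)"
    using g C by (intro green_kernel_of_symmetric_decay[OF W C(1) green_kernel_symmetric_decay(2)[OF W g NS]]) simp
  then have "has_green 0 E y" unfolding has_green_def by blast
  then show ?thesis using has_green_phase by blast
qed

lemma green_kernel_tilted:
  assumes G: "green_kernel 0 (pot x) E W C \<kappa>" and "\<bar>g\<bar> < L E"
  shows "\<exists>C' \<kappa>'. green_kernel g (pot x) E W C' \<kappa>'"
proof -
  obtain \<Lambda> where \<Lambda>: "\<bar>g\<bar> < \<Lambda>" "\<Lambda> < L E" using dense assms(2) by blast
  obtain C' where "0 < C'" "\<forall>m n. cmod (W m n) \<le> C' * exp (- \<Lambda> * \<bar>real_of_int (n - m)\<bar>)"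
    using green_decay_rate[OF G \<Lambda>(2)] by metis
  then show ?thesis using green_kernel_of_symmetric_decay[OF G _ _ \<Lambda>(1)] by blast
qed

text \<open>
  The description of the spectrum: for \<open>g \<ge> 0\<close> it says
  \<open>\<Sigma>(g) = {L = g} \<union> (\<Sigma>(0) \<inter> {L > g})\<close>.
\<close>

theorem has_green_iff:
  assumes g: "0 \<le> g"
  shows "has_green g E x \<longleftrightarrow> L E < g \<or> (g < L E \<and> has_green 0 E x)"
proof
  assume G: "has_green g E x"
  then obtain W C \<kappa> where W: "green_kernel g (pot x) E W C \<kappa>" unfolding has_green_def by blast
  show "L E < g \<or> (g < L E \<and> has_green 0 E x)"
    using lyapunov_less_of_green[OF W g] has_green_zero_of_green[OF g _ G] by linarith
next
  assume "L E < g \<or> (g < L E \<and> has_green 0 E x)"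
  then show "has_green g E x"
  proof
    assume "g < L E \<and> has_green 0 E x"
    moreover from this obtain W C \<kappa> where "green_kernel 0 (pot x) E W C \<kappa>" unfolding has_green_def by blast
    ultimately show ?thesis
      using green_kernel_tilted[of x E W C \<kappa> g] g unfolding has_green_def by auto
  qed (rule has_green_below_rate)
qed

end

section \<open>Dependence of the Green kernel on the energy\<close>

lemma solution_l2_bound:
  assumes C: "coercive g q E C" and u: "u \<in> l2" "hn_op g q E u = delta m"
  shows "l2_norm u \<le> C"
proof -
  have "l2_norm u \<le> C * l2_norm (delta m)" using C u by (auto simp: coercive_def)
  also have "\<dots> \<le> C * 1" using C l2_norm_delta by (intro mult_left_mono) (auto simp: coercive_def)
  finally show ?thesis by simp
qed

lemma coercive_large_energy:
  assumes q: "\<And>n. \<bar>q n\<bar> \<le> M" and E: "M + 2 < cmod E"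
  shows "coercive 0 q E (1 / (cmod E - M - 2))"
  unfolding coercive_def
proof (intro conjI ballI)
  show "0 < 1 / (cmod E - M - 2)" using E by simp
  fix u assume u: "u \<in> l2"
  have M: "0 \<le> M" using q[of 0] by linarith
  have a: "hn_op 0 q 0 u \<in> l2" "l2_norm (hn_op 0 q 0 u) \<le> (2 + M) * l2_norm u"
    using hn_op_l2[of q M u 0 0, OF q u] by auto
  have b: "hn_op 0 q E u \<in> l2" by (rule hn_op_l2(1)[of q M, OF q u])
  have "(\<lambda>n. E * u n) = (\<lambda>n. hn_op 0 q 0 u n + -1 * hn_op 0 q E u n)"
    by (simp add: hn_op_def fun_eq_iff algebra_simps)
  then have "l2_norm (\<lambda>n. E * u n) \<le> l2_norm (hn_op 0 q 0 u) + l2_norm (\<lambda>n. -1 * hn_op 0 q E u n)"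
    using l2_add(2)[OF a(1) l2_scale(1)[OF b, of "-1"]] by simp
  also have "\<dots> \<le> (2 + M) * l2_norm u + l2_norm (hn_op 0 q E u)"
    using a(2) l2_scale(2)[OF b, of "-1"] by simp
  also have "cmod E * l2_norm u \<le> l2_norm (\<lambda>n. E * u n)"
  proof -
    have E0: "E \<noteq> 0" using E M by auto
    have "l2_norm u = l2_norm (\<lambda>n. (1 / E) * (E * u n))" using E0 by simp
    also have "\<dots> \<le> cmod (1 / E) * l2_norm (\<lambda>n. E * u n)"
      by (rule l2_scale(2)[OF l2_scale(1)[OF u]])
    finally show ?thesis using E0 by (simp add: norm_divide field_simps)
  qed
  finally have "(cmod E - M - 2) * l2_norm u \<le> l2_norm (hn_op 0 q E u)" by (simp add: algebra_simps)
  then show "l2_norm u \<le> 1 / (cmod E - M - 2) * l2_norm (hn_op 0 q E u)"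
    using E by (simp add: field_simps)
qed

context ergodic_schrodinger
begin

lemma has_green_nonreal: "Im E \<noteq> 0 \<Longrightarrow> has_green 0 E x"
  unfolding has_green_def by (rule green_kernel_nonreal)

lemma has_green_of_coercive: "coercive 0 (pot x) E C \<Longrightarrow> has_green 0 E x"
proof -
  assume C: "coercive 0 (pot x) E C"
  obtain M where M: "\<And>n. \<bar>pot x n\<bar> \<le> M" using pot_bounded by blast
  show ?thesis unfolding has_green_def by (rule green_kernel_of_coercive[OF C M])
qed

lemma inverse_of_has_green:
  assumes "has_green g E x"
  obtains R C where "l2_inverse g (pot x) E R" and "coercive g (pot x) E C"
proof -
  obtain M where M: "\<And>n. \<bar>pot x n\<bar> \<le> M" using pot_bounded by blast
  obtain W C \<kappa> where "green_kernel g (pot x) E W C \<kappa>" using assms unfolding has_green_def by blast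
  then obtain R where R: "l2_inverse g (pot x) E R" using schur_inverse[of g "pot x" E W C \<kappa> M] M by blast
  obtain D where "coercive g (pot x) E D" using coercive_of_inverse[of g "pot x" E R M] R M by blast
  then show thesis using that R by blast
qed

lemma locally_coercive:
  assumes "has_green g E x"
  obtains C d where "0 < C" "0 < d" and "\<forall>E'. dist E E' < d \<longrightarrow> coercive g (pot x) E' C"
proof -
  obtain M where M: "\<And>n. \<bar>pot x n\<bar> \<le> M" using pot_bounded by blast
  obtain R C where C: "coercive g (pot x) E C" using inverse_of_has_green[OF assms] by metis
  then have C0: "0 < C" by (simp add: coercive_def)
  have "coercive g (pot x) E' (2 * C)" if "dist E E' < 1 / (2 * C)" for E'
  proof -
    have "C * dist E E' \<le> C * (1 / (2 * C))" using that C0 by (intro mult_left_mono) auto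
    then have "C * cmod (E - E') \<le> 1/2" using C0 by (simp add: dist_norm)
    then show ?thesis using coercive_perturb[of g "pot x" E C M E'] C M by blast
  qed
  then show thesis using C0 by (intro that[of "2 * C" "1 / (2 * C)"]) auto
qed

lemma open_resolvent: "open {E. has_green 0 E x}"
  unfolding open_contains_ball
proof
  fix E assume "E \<in> {E. has_green 0 E x}"
  then obtain C d where d: "0 < d" "\<forall>E'. dist E E' < d \<longrightarrow> coercive 0 (pot x) E' C"
    using locally_coercive[of 0 E x] by blast
  then have "ball E d \<subseteq> {E. has_green 0 E x}" using has_green_of_coercive by (auto simp: ball_def)
  then show "\<exists>d>0. ball E d \<subseteq> {E. has_green 0 E x}" using d(1) by blast
qed

text \<open>
  A choice of kernel for each energy; the lemmas below hold for every choice.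
\<close>

definition green0 :: "'a \<Rightarrow> complex \<Rightarrow> int \<Rightarrow> int \<Rightarrow> complex" where
  "green0 x E = (SOME W. \<exists>C \<kappa>. green_kernel 0 (pot x) E W C \<kappa>)"

lemma green0_green_kernel:
  assumes "has_green 0 E x"
  obtains C \<kappa> where "green_kernel 0 (pot x) E (green0 x E) C \<kappa>"
  using someI_ex[of "\<lambda>W. \<exists>C \<kappa>. green_kernel 0 (pot x) E W C \<kappa>"] assms
  unfolding has_green_def green0_def by blast

lemma green0_column:
  assumes "has_green 0 E x"
  shows "green0 x E m \<in> l2" and "hn_op 0 (pot x) E (green0 x E m) = delta m"
proof -
  obtain C \<kappa> where G: "green_kernel 0 (pot x) E (green0 x E) C \<kappa>" by (rule green0_green_kernel[OF assms])
  have "tilt 0 (green0 x E) m = green0 x E m" by (simp add: tilt_def fun_eq_iff)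
  then show "green0 x E m \<in> l2" "hn_op 0 (pot x) E (green0 x E m) = delta m"
    using green_kernel_tilt(1,4)[OF G, of m] by auto
qed

text \<open>
  The resolvent identity for single columns: \<open>u(E') - u(E) = (E' - E) R u(E')\<close> with the fixed inverse \<open>R\<close> at
  \<open>E\<close>. A common lower bound near \<open>E\<close> keeps \<open>u(E')\<close> bounded.
\<close>

lemma green0_holomorphic: "(\<lambda>E. green0 x E m n) holomorphic_on {E. has_green 0 E x}"
  unfolding holomorphic_on_open[OF open_resolvent]
proof
  fix E assume "E \<in> {E. has_green 0 E x}"
  then have E: "has_green 0 E x" by simp
  obtain M where M: "\<And>n. \<bar>pot x n\<bar> \<le> M" using pot_bounded by blast
  obtain R where R: "l2_inverse 0 (pot x) E R" using inverse_of_has_green[OF E] by metis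
  then have bo: "l2_bounded_operator R" by (simp add: l2_inverse_def)
  obtain B where B: "0 < B" "\<And>u. u \<in> l2 \<Longrightarrow> l2_norm (R u) \<le> B * l2_norm u"
    using l2_bounded_operatorD(3)[OF bo] by blast
  obtain C d where Cd: "0 < C" "0 < d" "\<forall>E'. dist E E' < d \<longrightarrow> coercive 0 (pot x) E' C"
    using locally_coercive[OF E] by metis
  let ?u = "\<lambda>E'. green0 x E' m"
  have near: "has_green 0 E' x" if "dist E E' < d" for E' using that Cd(3) has_green_of_coercive by blast
  have diff: "?u E' j - ?u E j = (E' - E) * R (?u E') j" if E': "dist E E' < d" for E' j
  proof -
    have u': "?u E' \<in> l2" "hn_op 0 (pot x) E' (?u E') = delta m" using green0_column[OF near[OF E']] by auto
    have u: "?u E \<in> l2" "hn_op 0 (pot x) E (?u E) = delta m" using green0_column[OF E] by auto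
    have "hn_op 0 (pot x) E (?u E') = (\<lambda>j. 1 * delta m j + (E' - E) * ?u E' j)"
      unfolding u'(2)[symmetric] by (simp add: hn_op_def fun_eq_iff algebra_simps)
    then have "?u E' = R (\<lambda>j. 1 * delta m j + (E' - E) * ?u E' j)"
      using R u'(1) by (metis l2_inverse_def)
    also have "\<dots> = (\<lambda>j. 1 * R (delta m) j + (E' - E) * R (?u E') j)"
      by (rule l2_bounded_operatorD(2)[OF bo l2_delta u'(1)])
    finally have "?u E' j = R (delta m) j + (E' - E) * R (?u E') j" by (metis mult_1)
    moreover have "R (delta m) = ?u E" using R u by (metis l2_inverse_def)
    ultimately show ?thesis by simp
  qed
  have bound: "cmod ((?u E' n - ?u E n) / (E' - E) - R (?u E) n) \<le> B * B * C * cmod (E' - E)"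
    if E': "dist E E' < d" "E' \<noteq> E" for E'
  proof -
    have u': "?u E' \<in> l2" and u: "?u E \<in> l2" using green0_column(1) near[OF E'(1)] E by auto
    have nu': "l2_norm (?u E') \<le> C"
      using solution_l2_bound[OF _ u'] green0_column(2)[OF near[OF E'(1)]] Cd(3) E'(1) by blast
    have Ru': "R (?u E') \<in> l2" by (rule l2_bounded_operatorD(1)[OF bo u'])
    have dl2: "(\<lambda>j. 1 * ?u E' j + - 1 * ?u E j) \<in> l2" by (intro l2_add l2_scale u u')
    have deq: "(\<lambda>j. 1 * ?u E' j + - 1 * ?u E j) = (\<lambda>j. (E' - E) * R (?u E') j)"
      using diff[OF E'(1)] by (simp add: fun_eq_iff)
    have "(?u E' n - ?u E n) / (E' - E) - R (?u E) n = R (?u E') n - R (?u E) n"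
      using diff[OF E'(1), of n] E'(2) by simp
    also have "\<dots> = R (\<lambda>j. 1 * ?u E' j + - 1 * ?u E j) n"
      unfolding l2_bounded_operatorD(2)[OF bo u' u] by simp
    finally have "cmod ((?u E' n - ?u E n) / (E' - E) - R (?u E) n) \<le> l2_norm (R (\<lambda>j. 1 * ?u E' j + - 1 * ?u E j))"
      using cmod_le_l2_norm[OF l2_bounded_operatorD(1)[OF bo dl2]] by simp
    also have "\<dots> \<le> B * l2_norm (\<lambda>j. 1 * ?u E' j + - 1 * ?u E j)" by (rule B(2)[OF dl2])
    also have "\<dots> \<le> B * (cmod (E' - E) * (B * C))"
      unfolding deq
    proof (intro mult_left_mono)
      have "l2_norm (R (?u E')) \<le> B * l2_norm (?u E')" by (rule B(2)[OF u'])
      also have "\<dots> \<le> B * C" using nu' B(1) by (intro mult_left_mono) auto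
      finally have "cmod (E' - E) * l2_norm (R (?u E')) \<le> cmod (E' - E) * (B * C)"
        by (intro mult_left_mono) auto
      then show "l2_norm (\<lambda>j. (E' - E) * R (?u E') j) \<le> cmod (E' - E) * (B * C)"
        using l2_scale(2)[OF Ru', of "E' - E"] by linarith
    qed (use B in auto)
    finally show ?thesis by (simp add: mult_ac)
  qed
  have "((\<lambda>E'. (?u E' n - ?u E n) / (E' - E) - R (?u E) n) \<longlongrightarrow> 0) (at E)"
  proof (rule Lim_null_comparison)
    show "\<forall>\<^sub>F E' in at E. norm ((?u E' n - ?u E n) / (E' - E) - R (?u E) n) \<le> B * B * C * cmod (E' - E)"
      unfolding eventually_at using Cd(2) bound by (intro exI[of _ d]) (auto simp: dist_commute)
    have "((\<lambda>E'. B * B * C * cmod (E' - E)) \<longlongrightarrow> B * B * C * cmod (E - E)) (at E)"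
      by (intro tendsto_intros)
    then show "((\<lambda>E'. B * B * C * cmod (E' - E)) \<longlongrightarrow> 0) (at E)" by simp
  qed
  then have "((\<lambda>E'. green0 x E' m n) has_field_derivative R (?u E) n) (at E)"
    unfolding has_field_derivative_iff by (simp add: Lim_null[symmetric])
  then show "\<exists>f'. ((\<lambda>E. green0 x E m n) has_field_derivative f') (at E)" by blast
qed

text \<open>
  Otherwise the entries of the kernel would be entire and vanish at infinity, hence be zero.
\<close>

lemma spectrum_nonempty: "\<exists>E. \<not> has_green 0 E x"
proof (rule ccontr)
  assume "\<not> ?thesis"
  then have all: "\<And>E. has_green 0 E x" by blast
  obtain M where M: "\<And>n. \<bar>pot x n\<bar> \<le> M" using pot_bounded by blast
  have zero: "green0 x E 0 n = 0" for E n
  proof (rule Liouville_weak[of "\<lambda>E. green0 x E 0 n" 0 E])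
    have "{E. has_green 0 E x} = UNIV" using all by blast
    then show "(\<lambda>E. green0 x E 0 n) holomorphic_on UNIV" using green0_holomorphic[of x 0 n] by simp
    show "((\<lambda>E. green0 x E 0 n) \<longlongrightarrow> 0) at_infinity"
    proof (rule Lim_null_comparison)
      show "\<forall>\<^sub>F E in at_infinity. norm (green0 x E 0 n) \<le> 1 / (cmod E - M - 2)"
        unfolding eventually_at_infinity
      proof (intro exI[of _ "M + 3"] allI impI)
        fix E :: complex assume "M + 3 \<le> norm E"
        then have co: "coercive 0 (pot x) E (1 / (cmod E - M - 2))" by (intro coercive_large_energy M) auto
        show "norm (green0 x E 0 n) \<le> 1 / (cmod E - M - 2)"
          using solution_l2_bound[OF co green0_column[OF all]] cmod_le_l2_norm[OF green0_column(1)[OF all]] order_trans by blast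
      qed
      have "filterlim (\<lambda>E :: complex. (- M - 2) + norm E) at_top at_infinity"
        by (rule filterlim_tendsto_add_at_top[OF tendsto_const filterlim_norm_at_top])
      then have "((\<lambda>E :: complex. inverse ((- M - 2) + norm E)) \<longlongrightarrow> 0) at_infinity"
        by (rule tendsto_inverse_0_at_top)
      then show "((\<lambda>E :: complex. 1 / (cmod E - M - 2)) \<longlongrightarrow> 0) at_infinity"
        by (simp add: inverse_eq_divide algebra_simps)
    qed
  qed
  have "hn_op 0 (pot x) 0 (green0 x 0 0) 0 = 1" using green0_column(2)[OF all, of 0 0] by (simp add: delta_def)
  then show False by (simp add: hn_op_def zero)
qed

text \<open>
  Lower bounds of \<open>H(g) - E\<close> are locally uniform in \<open>E\<close> and bound the columns of its inverse.
\<close>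

lemma green0_uniform_decay:
  assumes Q: "compact Q" and g: "0 \<le> g"
    and rate: "\<And>E. E \<in> Q \<Longrightarrow> has_green 0 E x \<and> g < L E"
  obtains C where "0 < C" and "\<forall>E\<in>Q. \<forall>m n. cmod (green0 x E m n) \<le> C * exp (- g * \<bar>real_of_int (n - m)\<bar>)"
proof -
  have loc: "\<exists>C d. 0 < C \<and> 0 < d \<and> (\<forall>E'. dist E E' < d \<longrightarrow> coercive g (pot x) E' C)" if "E \<in> Q" for E
  proof -
    have "has_green g E x" using has_green_iff[OF g] rate[OF that] by blast
    then show ?thesis using locally_coercive by metis
  qed
  then obtain C d where Cd: "\<And>E. E \<in> Q \<Longrightarrow> 0 < C E \<and> 0 < d E \<and> (\<forall>E'. dist E E' < d E \<longrightarrow> coercive g (pot x) E' (C E))"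
    by metis
  then have "Q \<subseteq> (\<Union>E\<in>Q. ball E (d E))" by force
  then obtain P where P: "P \<subseteq> Q" "finite P" "Q \<subseteq> (\<Union>E\<in>P. ball E (d E))"
    using compactE_image[OF Q, of Q "\<lambda>E. ball E (d E)"] by (metis open_ball)
  define D where "D = 1 + (\<Sum>E\<in>P. C E)"
  have CP: "0 < C E" if "E \<in> P" for E using Cd P(1) that by blast
  have D: "C E \<le> D" if "E \<in> P" for E
    using member_le_sum[of E P C] that P(2) CP unfolding D_def by (fastforce intro: less_imp_le)
  have "0 \<le> (\<Sum>E\<in>P. C E)" using CP by (intro sum_nonneg) (auto intro: less_imp_le)
  then have D0: "0 < D" by (simp add: D_def)
  have "cmod (green0 x E m n) \<le> D * exp (- g * \<bar>real_of_int (n - m)\<bar>)" if E: "E \<in> Q" for E m n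
  proof -
    obtain E1 where E1: "E1 \<in> P" "dist E1 E < d E1" using P(3) E by auto
    then have co: "coercive g (pot x) E (C E1)" using Cd P(1) by blast
    obtain C0 \<kappa> where G: "green_kernel 0 (pot x) E (green0 x E) C0 \<kappa>" using green0_green_kernel rate[OF E] by metis
    then have \<kappa>: "0 < \<kappa>" by (simp add: green_kernel_def)
    have sym: "green0 x E m n = green0 x E n m" for m n
      using green_kernel_symmetric_decay(1)[OF G order_refl] slow_right_not_all[OF \<kappa>] by simp
    obtain C1 \<kappa>1 where G1: "green_kernel g (pot x) E (green0 x E) C1 \<kappa>1"
      using green_kernel_tilted[OF G, of g] rate[OF E] g by auto
    have le: "cmod (green0 x E m n) \<le> D * exp (- g * \<bar>real_of_int (n - m)\<bar>)" if "n \<le> m" for m n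
    proof -
      have "l2_norm (tilt g (green0 x E) m) \<le> C E1"
        by (rule solution_l2_bound[OF co green_kernel_tilt(4)[OF G1] green_kernel_tilt(1)[OF G1]])
      then have "cmod (tilt g (green0 x E) m n) \<le> D"
        using cmod_le_l2_norm[OF green_kernel_tilt(4)[OF G1], of m n] D[OF E1(1)] by linarith
      define p where "p = exp (- g * real_of_int (n - m))"
      define e where "e = exp (- g * \<bar>real_of_int (n - m)\<bar>)"
      have pe: "e * p = 1"
        using that unfolding p_def e_def exp_add[symmetric] by (simp add: algebra_simps)
      have "p * cmod (green0 x E m n) \<le> D"
        using \<open>cmod (tilt g (green0 x E) m n) \<le> D\<close> by (simp add: tilt_def norm_mult p_def)
      then have "e * (p * cmod (green0 x E m n)) \<le> e * D"
        by (intro mult_left_mono) (auto simp: e_def)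
      then show ?thesis unfolding mult.assoc[symmetric] pe by (simp add: e_def mult.commute)
    qed
    show ?thesis
    proof (cases "n \<le> m")
      case False
      then show ?thesis using le[of m n] sym[of m n] by (simp add: abs_minus_commute)
    qed (rule le)
  qed
  then show thesis using that D0 by blast
qed

end

section \<open>Minima and intermediate values of the Lyapunov exponent\<close>

text \<open>
  The maximum principle for the product of four rotated copies of \<open>f\<close> about the centre. For every
  point of the circle at least two of its four rotations are far from the real direction, so the better
  bound \<open>B\<close>, available only there, contributes half of the factors.
\<close>

lemma rotated_product_bound:
  assumes hol: "f holomorphic_on U" and U: "open U" "cball E0 r \<subseteq> U" and r: "0 < r"
    and a: "\<And>E. cmod (E - E0) = r \<Longrightarrow> cmod (f E) \<le> A"
    and b: "\<And>E. cmod (E - E0) = r \<Longrightarrow> r / 2 \<le> \<bar>Im (E - E0)\<bar> \<Longrightarrow> cmod (f E) \<le> B"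
  shows "cmod (f E0) ^ 4 \<le> A\<^sup>2 * B\<^sup>2"
proof -
  define h where "h z = f (E0 + z) * f (E0 - z) * (f (E0 + \<i> * z) * f (E0 - \<i> * z))" for z
  have comp: "(\<lambda>z. f (E0 + c * z)) holomorphic_on cball 0 r" if "cmod c = 1" for c
  proof -
    have "(f \<circ> (\<lambda>z. E0 + c * z)) holomorphic_on cball 0 r"
    proof (rule holomorphic_on_compose_gen[OF _ hol])
      show "(\<lambda>z. E0 + c * z) holomorphic_on cball 0 r" by (intro holomorphic_intros)
      have "E0 + c * z \<in> cball E0 r" if "z \<in> cball 0 r" for z
        using that \<open>cmod c = 1\<close> by (simp add: dist_norm norm_mult)
      then show "(\<lambda>z. E0 + c * z) ` cball 0 r \<subseteq> U" using U(2) by blast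
    qed
    then show ?thesis by (simp add: o_def)
  qed
  have hol_h: "h holomorphic_on cball 0 r"
    unfolding h_def using comp[of 1] comp[of "-1"] comp[of \<i>] comp[of "-\<i>"]
    by (intro holomorphic_on_mult) simp_all
  have bound: "cmod (h z) \<le> A\<^sup>2 * B\<^sup>2" if z: "cmod z = r" for z
  proof -
    have "cmod (f (E0 + of_real r)) \<le> A" using r by (intro a) simp
    then have A0: "0 \<le> A" using norm_ge_zero[of "f (E0 + of_real r)"] by linarith
    have "cmod (f (E0 + \<i> * of_real r)) \<le> B" using r by (intro b) (simp_all add: norm_mult)
    then have B0: "0 \<le> B" using norm_ge_zero[of "f (E0 + \<i> * of_real r)"] by linarith
    have A4: "cmod (f (E0 + z)) \<le> A" "cmod (f (E0 - z)) \<le> A" "cmod (f (E0 + \<i> * z)) \<le> A" "cmod (f (E0 - \<i> * z)) \<le> A"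
      using z by (auto intro!: a simp: norm_mult)
    have "r / 2 \<le> \<bar>Im z\<bar> \<or> r / 2 \<le> \<bar>Re z\<bar>"
      using z cmod_le[of z] by linarith
    then show ?thesis
    proof
      assume im: "r / 2 \<le> \<bar>Im z\<bar>"
      have "cmod (f (E0 + z)) \<le> B" "cmod (f (E0 - z)) \<le> B" using z im by (auto intro!: b)
      then have "cmod (f (E0 + z)) * cmod (f (E0 - z)) * (cmod (f (E0 + \<i> * z)) * cmod (f (E0 - \<i> * z))) \<le> (B * B) * (A * A)"
        using A4 A0 B0 by (intro mult_mono) auto
      then show ?thesis by (simp add: h_def norm_mult power2_eq_square mult_ac)
    next
      assume re: "r / 2 \<le> \<bar>Re z\<bar>"
      have "cmod (f (E0 + \<i> * z)) \<le> B" "cmod (f (E0 - \<i> * z)) \<le> B" using z re by (auto intro!: b simp: norm_mult)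
      then have "cmod (f (E0 + z)) * cmod (f (E0 - z)) * (cmod (f (E0 + \<i> * z)) * cmod (f (E0 - \<i> * z))) \<le> (A * A) * (B * B)"
        using A4 A0 B0 by (intro mult_mono) auto
      then show ?thesis by (simp add: h_def norm_mult power2_eq_square mult_ac)
    qed
  qed
  have "cmod (h 0) \<le> A\<^sup>2 * B\<^sup>2"
  proof (rule maximum_modulus_frontier[of h "cball 0 r"])
    show "h holomorphic_on interior (cball 0 r)" by (rule holomorphic_on_subset[OF hol_h interior_subset])
    show "continuous_on (closure (cball 0 r)) h" using holomorphic_on_imp_continuous_on[OF hol_h] by simp
    show "cmod (h z) \<le> A\<^sup>2 * B\<^sup>2" if "z \<in> frontier (cball 0 r)" for z
      using that r by (intro bound) (simp add: frontier_cball)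
  qed (use r in auto)
  moreover have "cmod (h 0) = cmod (f E0) ^ 4"
    by (simp add: h_def norm_mult power4_eq_xxxx)
  ultimately show ?thesis by simp
qed

lemma exp_growth_contradiction:
  fixes c K :: real
  assumes "0 < c" and "\<And>k::nat. 0 < k \<Longrightarrow> exp (c * real k) \<le> K"
  shows False
proof -
  obtain k :: nat where k: "K / c < real k" using reals_Archimedean2 by blast
  have "K < c * real (Suc k)" using k assms(1) by (simp add: field_simps)
  also have "\<dots> \<le> exp (c * real (Suc k))" using exp_ge_add_one_self[of "c * real (Suc k)"] by linarith
  also have "\<dots> \<le> K" by (rule assms(2)) simp
  finally show False by simp
qed

context ergodic_schrodinger
begin

text \<open>
  On a circle around \<open>e\<close> inside the gap, \<open>L \<ge> g\<close> by monotonicity in the imaginary direction, and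
  \<open>L \<ge> g + c\<close> away from the real axis. Hence the kernel entry between sites at distance \<open>k\<close> is at most about
  \<open>exp(- g k)\<close> on the circle and \<open>exp(- (g + c) k)\<close> on the two arcs, and by \<open>rotated_product_bound\<close> at most
  \<open>exp(- (g + c/2) k)\<close> at the centre. But there it is at least about \<open>1/\<parallel>A\<^sub>k\<parallel>\<close>, which is about
  \<open>exp(- g k)\<close>.
\<close>

lemma lyapunov_no_real_minimum:
  assumes g: "0 < g" and E0: "has_green 0 (of_real e) x" and eq: "L (of_real e) = g"
    and min: "\<And>a. g \<le> L (of_real a)"
  shows False
proof -
  obtain M where M: "\<And>x. \<bar>v x\<bar> \<le> M" "0 < M" using v_bounded by blast
  let ?U = "{E. has_green 0 E x}" and ?E0 = "of_real e :: complex"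
  obtain r where r: "0 < r" "cball ?E0 r \<subseteq> ?U"
    using open_contains_cball[of ?U] open_resolvent[of x] E0 by blast
  define R where "R = \<bar>e\<bar> + r + M + 2"
  have R: "0 < R" using r M(2) by (simp add: R_def)
  define c where "c = ln (sqrt (1 + (r / 2)\<^sup>2 / R\<^sup>2))"
  have c: "0 < c" unfolding c_def using r R by (intro ln_gt_zero) simp
  have sph: "sphere ?E0 r \<subseteq> ?U" using r(2) by auto
  have ReE: "\<bar>Re E\<bar> \<le> \<bar>e\<bar> + r" if "cmod (E - ?E0) = r" for E
    using abs_Re_le_cmod[of "E - ?E0"] that by simp
  have Lg: "g \<le> L E" for E
    using min[of "Re E"] lyapunov_mono_imaginary[of 0 "Im E" "Re E"] by (simp add: complex_of_real_def)
  have Lgc: "g + c \<le> L E" if E: "cmod (E - ?E0) = r" "r / 2 \<le> \<bar>Im (E - ?E0)\<bar>" for E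
  proof -
    have "L (of_real (Re E)) + ln (sqrt (1 + (r / 2)\<^sup>2 / R\<^sup>2)) \<le> L (Complex (Re E) (Im E))"
      using ReE[OF E(1)] E(2) r by (intro lyapunov_strict_imaginary[OF M(1) R]) (auto simp: R_def)
    then show ?thesis using min[of "Re E"] by (simp add: c_def)
  qed
  (* Four factors lose epsilon in the lower bound and four in the upper bound, against a gain of 2 c. *)
  define \<epsilon> where "\<epsilon> = min (c / 8) (g / 2)"
  have \<epsilon>: "0 < \<epsilon>" "8 * \<epsilon> \<le> c" "\<epsilon> < g" using c g by (auto simp: \<epsilon>_def)
  let ?a = "g - \<epsilon>" and ?b = "g + c - \<epsilon>"
  have "compact (sphere ?E0 r)" by simp
  then obtain A where A: "0 < A" "\<forall>E\<in>sphere ?E0 r. \<forall>m n. cmod (green0 x E m n) \<le> A * exp (- ?a * \<bar>real_of_int (n - m)\<bar>)"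
  proof (rule green0_uniform_decay[where g = ?a and x = x])
    show "0 \<le> ?a" using \<epsilon> by simp
    show "has_green 0 E x \<and> ?a < L E" if "E \<in> sphere ?E0 r" for E
      using sph that Lg[of E] \<epsilon> by auto
  qed blast
  let ?Q = "sphere ?E0 r \<inter> {E. r / 2 \<le> \<bar>Im (E - ?E0)\<bar>}"
  have "closed {E. r / 2 \<le> \<bar>Im (E - ?E0)\<bar>}" by (intro closed_Collect_le continuous_intros)
  then have "compact ?Q" by (intro compact_Int_closed) auto
  then obtain B where B: "0 < B" "\<forall>E\<in>?Q. \<forall>m n. cmod (green0 x E m n) \<le> B * exp (- ?b * \<bar>real_of_int (n - m)\<bar>)"
  proof (rule green0_uniform_decay[where g = ?b and x = x])
    show "0 \<le> ?b" using \<epsilon> c by simp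
    show "has_green 0 E x \<and> ?b < L E" if "E \<in> ?Q" for E
      using sph that Lgc[of E] \<epsilon> by (auto simp: dist_norm norm_minus_commute)
  qed blast
  have up: "cmod (green0 x ?E0 m n) ^ 4 \<le> (A * B)\<^sup>2 * exp (- 2 * (?a + ?b) * \<bar>real_of_int (n - m)\<bar>)" for m n
  proof -
    let ?d = "\<bar>real_of_int (n - m)\<bar>"
    have "cmod (green0 x ?E0 m n) ^ 4 \<le> (A * exp (- ?a * ?d))\<^sup>2 * (B * exp (- ?b * ?d))\<^sup>2"
    proof (rule rotated_product_bound[OF green0_holomorphic open_resolvent r(2,1)])
      fix E assume E: "cmod (E - ?E0) = r"
      then have s: "E \<in> sphere ?E0 r" by (simp add: dist_norm norm_minus_commute)
      show "cmod (green0 x E m n) \<le> A * exp (- ?a * ?d)" using A(2) s by blast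
      assume "r / 2 \<le> \<bar>Im (E - ?E0)\<bar>"
      then show "cmod (green0 x E m n) \<le> B * exp (- ?b * ?d)" using B(2) s by blast
    qed
    also have "\<dots> = (A * B)\<^sup>2 * (exp (- ?a * ?d) * exp (- ?a * ?d) * (exp (- ?b * ?d) * exp (- ?b * ?d)))"
      by (simp add: power2_eq_square mult_ac)
    also have "exp (- ?a * ?d) * exp (- ?a * ?d) * (exp (- ?b * ?d) * exp (- ?b * ?d)) = exp (- 2 * (?a + ?b) * ?d)"
      unfolding exp_add[symmetric] by (rule arg_cong[where f = exp]) (simp add: algebra_simps)
    finally show ?thesis .
  qed
  obtain C0 \<kappa> where G: "green_kernel 0 (pot x) ?E0 (green0 x ?E0) C0 \<kappa>" by (rule green0_green_kernel[OF E0])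
  have low: "\<forall>m k. 0 < k \<longrightarrow> (\<exists>i\<in>{0,1}. \<exists>j\<in>{0,1}. 1/8 \<le> cmod (green0 x ?E0 (m - j) (m + int k - i)) * normA ?E0 k (orb m x))"
    using green_growth_estimates[OF G] by metis
  have "L ?E0 < g + \<epsilon>" using eq \<epsilon> by simp
  then obtain D where D: "0 < D" "\<And>n y. normA ?E0 n y \<le> D * exp ((g + \<epsilon>) * real n)" using growth_upper by metis
  define s where "s = ?a + ?b"
  have s: "0 < s" "4 * (g + \<epsilon>) + c \<le> 2 * s" using \<epsilon> c by (auto simp: s_def)
  show False
  proof (rule exp_growth_contradiction[OF c])
    fix k :: nat assume k: "0 < k"
    obtain i j where ij: "i \<in> {0,1}" "j \<in> {0,1}" "1/8 \<le> cmod (green0 x ?E0 (0 - j) (0 + int k - i)) * normA ?E0 k (orb 0 x)"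
      using low k by blast
    let ?y = "cmod (green0 x ?E0 (0 - j) (0 + int k - i))"
    (* Four entries are offered by the lower bound; whichever is large, its sites are at distance at least k - 1. *)
    have d: "real k - 1 \<le> \<bar>real_of_int ((0 + int k - i) - (0 - j))\<bar>" using ij(1,2) k by auto
    have "1/8 \<le> ?y * (D * exp ((g + \<epsilon>) * real k))"
      by (rule order_trans[OF ij(3) mult_left_mono[OF D(2) norm_ge_zero]])
    then have "(1/8) ^ 4 \<le> (?y * (D * exp ((g + \<epsilon>) * real k))) ^ 4" by (intro power_mono) auto
    also have "\<dots> = ?y ^ 4 * (D ^ 4 * exp (4 * (g + \<epsilon>) * real k))"
      by (simp add: power_mult_distrib exp_of_nat_mult[symmetric] mult.assoc)
    also have "\<dots> \<le> ((A * B)\<^sup>2 * exp (- 2 * s * (real k - 1))) * (D ^ 4 * exp (4 * (g + \<epsilon>) * real k))"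
    proof (rule mult_right_mono)
      have "?y ^ 4 \<le> (A * B)\<^sup>2 * exp (- 2 * s * \<bar>real_of_int ((0 + int k - i) - (0 - j))\<bar>)"
        unfolding s_def by (rule up)
      also have "\<dots> \<le> (A * B)\<^sup>2 * exp (- 2 * s * (real k - 1))"
        using d s(1) by (intro mult_left_mono) auto
      finally show "?y ^ 4 \<le> (A * B)\<^sup>2 * exp (- 2 * s * (real k - 1))" .
    qed (use D in auto)
    also have "\<dots> = (A * B)\<^sup>2 * D ^ 4 * (exp (- 2 * s * (real k - 1)) * exp (4 * (g + \<epsilon>) * real k))" by simp
    also have "\<dots> \<le> (A * B)\<^sup>2 * D ^ 4 * (exp (2 * s) * exp (- c * real k))"
    proof (rule mult_left_mono)
      have "(4 * (g + \<epsilon>) + c) * real k \<le> 2 * s * real k" using s(2) by (intro mult_right_mono) auto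
      then have "- 2 * s * (real k - 1) + 4 * (g + \<epsilon>) * real k \<le> 2 * s + - c * real k"
        by (simp add: algebra_simps)
      then show "exp (- 2 * s * (real k - 1)) * exp (4 * (g + \<epsilon>) * real k) \<le> exp (2 * s) * exp (- c * real k)"
        unfolding exp_add[symmetric] by simp
    qed (use A B D in auto)
    finally have "(1/8) ^ 4 \<le> (A * B)\<^sup>2 * D ^ 4 * exp (2 * s) * exp (- c * real k)" by (simp add: mult_ac)
    then have "(1/8) ^ 4 * exp (c * real k) \<le> (A * B)\<^sup>2 * D ^ 4 * exp (2 * s) * exp (- c * real k) * exp (c * real k)"
      by (intro mult_right_mono) auto
    also have "\<dots> = (A * B)\<^sup>2 * D ^ 4 * exp (2 * s) * (exp (- c * real k) * exp (c * real k))" by simp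
    also have "exp (- c * real k) * exp (c * real k) = 1" unfolding exp_add[symmetric] by simp
    finally show "exp (c * real k) \<le> 8 ^ 4 * ((A * B)\<^sup>2 * D ^ 4 * exp (2 * s))"
      by (simp add: field_simps)
  qed
qed

lemma lyapunov_min_not_in_gap:
  assumes g: "0 < g" and E: "has_green 0 E x" and eq: "L E = g" and min: "\<And>a. g \<le> L (of_real a)"
  shows False
proof (cases "Im E = 0")
  case True
  then have "E = of_real (Re E)" by (simp add: complex_eq_iff)
  then show False using lyapunov_no_real_minimum[OF g, of "Re E" x] E eq min by metis
next
  case False
  obtain M where M: "\<And>x. \<bar>v x\<bar> \<le> M" "0 < M" using v_bounded by blast
  define R where "R = \<bar>Re E\<bar> + M + 2"
  have R: "0 < R" using M(2) by (simp add: R_def)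
  have "L (of_real (Re E)) + ln (sqrt (1 + \<bar>Im E\<bar>\<^sup>2 / R\<^sup>2)) \<le> L (Complex (Re E) (Im E))"
    by (rule lyapunov_strict_imaginary[OF M(1) R]) (auto simp: R_def)
  moreover have "0 < ln (sqrt (1 + \<bar>Im E\<bar>\<^sup>2 / R\<^sup>2))" using False R by (intro ln_gt_zero) simp
  ultimately show False using eq min[of "Re E"] by simp
qed

text \<open>
  Semicontinuity provides a point just above \<open>a\<close> with \<open>L < g\<close>, high up \<open>L\<close> exceeds \<open>g\<close>, and in between
  \<open>L\<close> is Lipschitz in \<open>ln b\<close>.
\<close>

lemma lyapunov_intermediate_value:
  assumes less: "L (of_real a) < g"
  shows "\<exists>E. L E = g"
proof -
  have g: "0 < g" using lyapunov_nonneg[of "of_real a"] less by linarith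
  define \<beta> where "\<beta> k = inverse (real (Suc k))" for k
  have "(\<lambda>k. Complex a (\<beta> k)) \<longlonglongrightarrow> Complex a 0"
    unfolding \<beta>_def by (intro tendsto_Complex tendsto_const LIMSEQ_inverse_real_of_nat)
  then have "\<forall>\<^sub>F k in sequentially. L (Complex a (\<beta> k)) < g"
    using less by (intro lyapunov_upper_semicontinuous) (auto simp: complex_of_real_def)
  then obtain k where k: "L (Complex a (\<beta> k)) < g" by (auto simp: eventually_sequentially)
  define b1 where "b1 = \<beta> k"
  have b1: "0 < b1" "L (Complex a b1) < g" using k by (auto simp: b1_def \<beta>_def)
  define b2 where "b2 = max b1 (exp g)"
  have b2: "b1 \<le> b2" "exp g \<le> b2" by (auto simp: b2_def)
  have "1 \<le> exp g" using g by simp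
  then have "ln b2 \<le> L (Complex a b2)" using b2(2) by (intro lyapunov_ge_ln_imaginary) linarith
  moreover have "g \<le> ln b2" using ln_mono[OF b2(2)] by simp
  ultimately have hi: "g \<le> L (Complex a b2)" by linarith
  have mod: "\<bar>L (Complex a b) - L (Complex a b')\<bar> \<le> \<bar>ln b - ln b'\<bar>" if "0 < b" "0 < b'" for b b'
  proof -
    have *: "\<bar>L (Complex a b) - L (Complex a b')\<bar> \<le> \<bar>ln b - ln b'\<bar>" if "0 < b'" "b' \<le> b" for b b'
    proof -
      have "ln (b / b') = ln b - ln b'" using that by (simp add: ln_div)
      then show ?thesis
        using lyapunov_ratio_imaginary[OF that, of a] lyapunov_mono_imaginary[of b' b a] that by simp
    qed
    show ?thesis using *[of b b'] *[of b' b] that by (cases "b \<le> b'") (auto simp: abs_minus_commute)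
  qed
  have "continuous_on {b1..b2} (\<lambda>b. L (Complex a b))"
    unfolding continuous_on_def
  proof
    fix b assume b: "b \<in> {b1..b2}"
    then have b0: "0 < b" using b1 by auto
    have "((\<lambda>b'. L (Complex a b') - L (Complex a b)) \<longlongrightarrow> 0) (at b within {b1..b2})"
    proof (rule Lim_null_comparison)
      show "\<forall>\<^sub>F b' in at b within {b1..b2}. norm (L (Complex a b') - L (Complex a b)) \<le> \<bar>ln b' - ln b\<bar>"
        unfolding eventually_at using mod b0 b1 by (intro exI[of _ 1]) auto
      have "((\<lambda>b'. \<bar>ln b' - ln b\<bar>) \<longlongrightarrow> \<bar>ln b - ln b\<bar>) (at b within {b1..b2})"
        using b0 by (intro tendsto_intros) auto
      then show "((\<lambda>b'. \<bar>ln b' - ln b\<bar>) \<longlongrightarrow> 0) (at b within {b1..b2})" by simp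
    qed
    then show "((\<lambda>b. L (Complex a b)) \<longlongrightarrow> L (Complex a b)) (at b within {b1..b2})"
      by (simp add: Lim_null[symmetric])
  qed
  then have "\<exists>b\<ge>b1. b \<le> b2 \<and> L (Complex a b) = g"
    using b1(2) hi b2(1) by (intro IVT') auto
  then show ?thesis by blast
qed

end

section \<open>Real and complex components of the spectrum\<close>

theorem theorem1p2:
  fixes T :: "'a::metric_space \<Rightarrow> 'a" and v :: "'a \<Rightarrow> real"
    and \<mu> :: "'a measure" and g :: real
  assumes "compact (UNIV :: 'a set)" and "connected (UNIV :: 'a set)"
    and "homeomorphism UNIV UNIV T (inv T)"
    and "strictly_ergodic T" and "invariant_prob T \<mu>"
    and "continuous_on UNIV v"
    and "g > 0"
  shows "(g \<le> g_cr_lower T v \<mu> \<longrightarrow>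
            Sigma_HN T v g = Sigma_HN T v 0 \<and> Sigma_HN T v 0 \<subseteq> \<real>) \<and>
         (g_cr_lower T v \<mu> < g \<and> g < g_cr_upper T v \<mu> \<longrightarrow>
            E_zero T v \<mu> g \<noteq> {} \<and> Sigma_HN T v 0 \<inter> E_plus T v \<mu> g \<noteq> {}) \<and>
         (g \<ge> g_cr_upper T v \<mu> \<longrightarrow>
            Sigma_HN T v g = E_zero T v \<mu> g \<and> Sigma_HN T v 0 \<inter> E_plus T v \<mu> g = {})"
proof -
  interpret ergodic_schrodinger T v \<mu> using assms(1,3-6) by unfold_locales
  (* All phases have the same spectrum, so any point of the space will do. *)
  define x where "x = (undefined :: 'a)"
  have g: "0 < g" by fact
  have Sg: "E \<in> Sigma_HN T v g \<longleftrightarrow> L E = g \<or> (g < L E \<and> E \<in> Sigma_HN T v 0)" for E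
    unfolding in_Sigma_iff[of E g x] in_Sigma_iff[of E 0 x] has_green_iff[OF less_imp_le[OF g], of E x] by auto
  have real0: "Im E = 0" if "E \<in> Sigma_HN T v 0" for E
    using that has_green_nonreal[of E x] in_Sigma_iff[of E 0 x] by blast
  have ne: "Sigma_HN T v 0 \<noteq> {}" using spectrum_nonempty[of x] in_Sigma_iff[of _ 0 x] by blast
  obtain M where M: "\<And>x. \<bar>v x\<bar> \<le> M" "0 < M" using v_bounded by blast
  have bdd: "bdd_above (L ` Sigma_HN T v 0)"
  proof (rule bdd_aboveI2)
    fix E assume E: "E \<in> Sigma_HN T v 0"
    have "cmod E \<le> M + 2"
    proof (rule ccontr)
      assume "\<not> ?thesis"
      then have "coercive 0 (pot x) E (1 / (cmod E - M - 2))"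
        using M(1) by (intro coercive_large_energy) (auto simp: pot_def)
      then show False using E in_Sigma_iff[of E 0 x] has_green_of_coercive by blast
    qed
    then have "ln (M + cmod E + 2) \<le> ln (M + (M + 2) + 2)" using M(2) norm_ge_zero[of E] by (intro ln_mono) linarith+
    then show "L E \<le> ln (M + (M + 2) + 2)" using lyapunov_le_ln_bound[OF M(1), of E] by linarith
  qed
  have bddl: "bdd_below (L ` \<real>)" using lyapunov_nonneg by (intro bdd_belowI2[of _ 0]) auto
  show ?thesis
  proof (intro conjI impI)
    assume low: "g \<le> g_cr_lower T v \<mu>"
    have min: "g \<le> L (of_real a)" for a
      using low cINF_lower[OF bddl, of "of_real a"] unfolding g_cr_lower_def by force
    show "Sigma_HN T v 0 \<subseteq> \<real>" using real0 by (auto simp: complex_is_Real_iff)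
    have "E \<in> Sigma_HN T v g \<longleftrightarrow> E \<in> Sigma_HN T v 0" for E
    proof
      assume "E \<in> Sigma_HN T v g"
      then show "E \<in> Sigma_HN T v 0"
        using Sg[of E] lyapunov_min_not_in_gap[OF g _ _ min, of E x] in_Sigma_iff[of E 0 x] by blast
    next
      assume E: "E \<in> Sigma_HN T v 0"
      then have "E = of_real (Re E)" using real0 by (simp add: complex_eq_iff)
      then have "g \<le> L E" using min[of "Re E"] by simp
      then show "E \<in> Sigma_HN T v g" using Sg[of E] E by auto
    qed
    then show "Sigma_HN T v g = Sigma_HN T v 0" by blast
  next
    assume mid: "g_cr_lower T v \<mu> < g \<and> g < g_cr_upper T v \<mu>"
    have "\<exists>E\<in>\<real>. L E < g"
    proof (rule ccontr)
      assume "\<not> ?thesis"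
      then have "g \<le> g_cr_lower T v \<mu>"
        unfolding g_cr_lower_def by (intro cINF_greatest) auto
      then show False using mid by simp
    qed
    then obtain a where "L (of_real a) < g" by (auto elim: Reals_cases)
    then show "E_zero T v \<mu> g \<noteq> {}" using lyapunov_intermediate_value by (auto simp: E_zero_def)
    have "\<exists>E\<in>Sigma_HN T v 0. g < L E"
    proof (rule ccontr)
      assume "\<not> ?thesis"
      then have "g_cr_upper T v \<mu> \<le> g"
        unfolding g_cr_upper_def using ne by (intro cSUP_least) auto
      then show False using mid by simp
    qed
    then show "Sigma_HN T v 0 \<inter> E_plus T v \<mu> g \<noteq> {}" by (auto simp: E_plus_def)
  next
    assume up: "g_cr_upper T v \<mu> \<le> g"
    have le: "L E \<le> g" if "E \<in> Sigma_HN T v 0" for E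
      using up cSUP_upper[OF that bdd] unfolding g_cr_upper_def by linarith
    show "Sigma_HN T v g = E_zero T v \<mu> g" using Sg le by (force simp: E_zero_def)
    show "Sigma_HN T v 0 \<inter> E_plus T v \<mu> g = {}" using le by (force simp: E_plus_def)
  qed
qed

end
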